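(* Let $q\ge2$ be an integer and $k$ a positive integer. Assume the Generalized Riemann Hypothesis. Then for every $\varepsilon>0$, \[\sum_{\substack{\chi\bmod q\\ \chi(-1)=-1}}\frac{1}{|L(1,\chi)|^{2k}}=\frac{C(k)}{2}\,\varphi(q)\prod_{p\mid q}\left(1+\frac{\binom{k}{1}^2}{p^2}+\dots+\frac{\binom{k}{k}^2}{p^{2k}}\right)^{-1}\left(1+O\!\left(q^{-1+\varepsilon}\right)\right),\] where the sum runs over the odd Dirichlet characters modulo $q$ and \[C(k)=\prod_p\left(1+\frac{\binom{k}{1}^2}{p^2}+\dots+\frac{\binom{k}{k}^2}{p^{2k}}\right),\] the products being over primes $p$.
   Context: $L(s,\chi)$ is the Dirichlet $L$-function, $\varphi$ Euler's totient function. GRH asserts all nontrivial zeros of all Dirichlet $L$-functions have real part $1/2$. The implied constant may depend on $k$ and $\varepsilon$. *)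

theory Defs
  imports "HOL-Analysis.Analysis" "HOL-Number_Theory.Number_Theory"
begin

definition dirichlet_char :: "nat \<Rightarrow> (nat \<Rightarrow> complex) \<Rightarrow> bool" where
  "dirichlet_char q chi \<longleftrightarrow>
     chi 1 = 1 \<and>
     (\<forall>m n. chi (m * n) = chi m * chi n) \<and>
     (\<forall>n. chi (n + q) = chi n) \<and>
     (\<forall>n. chi n = 0 \<longleftrightarrow> \<not> coprime n q)"

definition principal_char :: "nat \<Rightarrow> (nat \<Rightarrow> complex) \<Rightarrow> bool" where
  "principal_char q chi \<longleftrightarrow> dirichlet_char q chi \<and> (\<forall>n. coprime n q \<longrightarrow> chi n = 1)"

text \<open>Odd character: chi(-1) = -1, i.e. chi(q-1) = -1 by periodicity.\<close>
definition odd_char :: "nat \<Rightarrow> (nat \<Rightarrow> complex) \<Rightarrow> bool" where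
  "odd_char q chi \<longleftrightarrow> dirichlet_char q chi \<and> chi (q - 1) = -1"

text \<open>L(s,chi) via its Dirichlet series (partial sums limit); for nonprincipal chi this
  converges for Re s > 0, which covers s = 1 and the critical strip.\<close>
definition dirichlet_L :: "(nat \<Rightarrow> complex) \<Rightarrow> complex \<Rightarrow> complex" where
  "dirichlet_L chi s = (\<Sum>n. chi (Suc n) / (of_nat (Suc n)) powr s)"

text \<open>Dirichlet eta function, converging for Re s > 0; zeta(s) = eta(s)/(1 - 2^(1-s)),
  and the factor 1 - 2^(1-s) has no zeros in 0 < Re s < 1.\<close>
definition dirichlet_eta :: "complex \<Rightarrow> complex" where
  "dirichlet_eta s = (\<Sum>n. (-1) ^ n / (of_nat (Suc n)) powr s)"

text \<open>GRH: nontrivial zeros (those in the open critical strip) of all Dirichlet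
  L-functions lie on Re s = 1/2. For principal characters the zeros in the strip are
  those of zeta, expressed via eta.\<close>
definition GRH :: bool where
  "GRH \<longleftrightarrow>
     (\<forall>s. 0 < Re s \<and> Re s < 1 \<and> dirichlet_eta s = 0 \<longrightarrow> Re s = 1/2) \<and>
     (\<forall>q chi s. q \<ge> 1 \<and> dirichlet_char q chi \<and> \<not> principal_char q chi \<and>
        0 < Re s \<and> Re s < 1 \<and> dirichlet_L chi s = 0 \<longrightarrow> Re s = 1/2)"

definition local_factor :: "nat \<Rightarrow> nat \<Rightarrow> real" where
  "local_factor k p = (\<Sum>j=0..k. real (k choose j) ^ 2 / real p ^ (2 * j))"

definition C_const :: "nat \<Rightarrow> real" where
  "C_const k = (\<Prod>p. if prime p then local_factor k p else 1)"

end

theory Submission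
  imports Defs "HOL-Complex_Analysis.Complex_Analysis"
begin

text \<open>
  Under GRH (and the classical non-vanishing on the line \<open>Re s = 1\<close>) the function
  \<open>F(s) = L(s,\<chi>)\<^sup>-\<^sup>k\<close> is holomorphic on the disc of radius \<open>3/2\<close> around 2, and
  Borel--Caratheodory bounds it by a power of \<open>q\<close> on the circle of radius \<open>5/4\<close>. Hence the first
  \<open>J\<close> terms of the Taylor series at 2, with \<open>J\<close> a multiple of \<open>log q\<close>, give \<open>F(1)\<close> up to a
  negligible error. Written out, this approximation is the Dirichlet series of \<open>F\<close> at 1 with \<open>1/n\<close>
  replaced by the weight \<open>n\<^sup>-\<^sup>2 (\<Sum>j<J. (log n)\<^sup>j / j!)\<close>, which plays the role of a smooth
  cutoff at a power of \<open>q\<close> but needs no contour integrals. In the mean square over the odd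
  characters, orthogonality leaves the diagonal, which is the Euler product of the main term, and
  the pairs \<open>m \<equiv> \<plusminus>n (mod q)\<close>, whose contribution relative to \<open>\<phi>(q)\<close> is at most \<open>q\<close> to the power
  \<open>-1 + \<epsilon>\<close>.
\<close>

section \<open>Characters modulo q\<close>

text \<open>The radii are forced: a disc of radius 3/2 around 2 just fits into Re s > 1/2, which GRH
  clears of zeros, and 5/4 lies strictly between 3/2 and the distance 1 from 2 to the point 1.
  Borel--Caratheodory then costs the exponent 2 (5/4) / (3/2 - 5/4) = 10, so on the circle 1/|L| is
  only known to be at most a multiple of q^10. The decay (4/5)^J of the Taylor tail pays for this,
  at the price of a large multiple of log q for J, that is, of an effective cutoff at a high power
  of q. This does no harm, because the cutoff enters only through Rankin's trick: the sum of x^j /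
  j! over j < J is at most b^J exp(x / b) for every b \<ge> 1. With b slightly above 1 the loss b^J
  is as small a power of q as desired, whatever the multiple of log q, and the weight still decays
  faster than 1/n. Odd characters are never principal, so no pole occurs. Since \<open>GRH\<close>
  speaks of the open strip only, non-vanishing on Re s = 1 has to be proved: by the 3-4-1
  inequality, except at s = 1 for real characters, where Monsky's argument takes over.\<close>

lemma sum_powers_root_of_unity:
  fixes z :: "'a :: field"
  assumes "z ^ n = 1" "z \<noteq> 1"
  shows "(\<Sum>k<n. z ^ k) = 0"
  using geometric_sum[of z n] assms by simp

text \<open>Characters are found as common eigenfunctions of the maps \<open>f \<mapsto> (\<lambda>x. f (g * x))\<close>; the sums
  below are, up to a factor, the projections to the eigenspaces of one such map.\<close>

lemma eigenprojection_nonzero: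
  fixes f :: "nat \<Rightarrow> complex"
  assumes "n > 0" "f x \<noteq> 0"
  shows "\<exists>z. z ^ n = 1 \<and> (\<Sum>j<n. z ^ j * f (g ^ j * x)) \<noteq> 0"
proof (rule ccontr)
  assume *: "\<not> ?thesis"
  define w where "w = cis (2 * pi / n)"
  have wn: "w ^ n = 1" using assms(1) by (simp add: w_def Complex.DeMoivre)
  have wj: "w ^ j \<noteq> 1" if "0 < j" "j < n" for j
  proof
    assume "w ^ j = 1"
    then have "cis (2 * pi * j / n) = cis (2 * pi * 0 / n)"
      by (simp add: w_def Complex.DeMoivre field_simps)
    moreover have "inj_on (\<lambda>k. cis (2 * pi * real k / real n)) {..<n}"
      using Complex.bij_betw_roots_unity[OF assms(1)] by (simp add: bij_betw_def)
    ultimately have "j = 0" using that by (auto dest: inj_onD[of _ _ j 0])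
    with that show False by simp
  qed
  \<comment> \<open>Summed over all \<open>n\<close>-th roots of unity, the projections add up to
    \<open>of_nat n * f x\<close>; so they cannot all vanish at \<open>x\<close>.\<close>
  have "0 = (\<Sum>k<n. \<Sum>j<n. (w ^ k) ^ j * f (g ^ j * x))"
  proof -
    have "(w ^ k) ^ n = 1" for k using wn by (metis power_mult mult.commute power_one)
    with * show ?thesis by auto
  qed
  also have "\<dots> = (\<Sum>j<n. (\<Sum>k<n. (w ^ j) ^ k) * f (g ^ j * x))"
    unfolding sum_distrib_right
    by (subst sum.swap) (simp flip: power_mult add: mult.commute)
  also have "\<dots> = (\<Sum>j<n. if j = 0 then of_nat n * f x else 0)"
  proof (rule sum.cong)
    fix j assume "j \<in> {..<n}"
    moreover have "(w ^ j) ^ n = 1" using wn by (metis power_mult mult.commute power_one)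
    ultimately show "(\<Sum>k<n. (w ^ j) ^ k) * f (g ^ j * x) = (if j = 0 then of_nat n * f x else 0)"
      using wj[of j] sum_powers_root_of_unity[of "w ^ j" n] by auto
  qed auto
  also have "\<dots> = of_nat n * f x" using assms(1) by simp
  finally show False using assms by simp
qed

lemma eigenprojection_shift:
  fixes f :: "nat \<Rightarrow> complex"
  assumes "z ^ n = 1" "n > 0" "f (g ^ n * x) = f x"
  shows "(\<Sum>j<n. z ^ j * f (g ^ j * (g * x))) = inverse z * (\<Sum>j<n. z ^ j * f (g ^ j * x))"
proof -
  have z: "z \<noteq> 0" using assms by (auto simp: power_0_left)
  have "z * (\<Sum>j<n. z ^ j * f (g ^ j * (g * x))) = (\<Sum>j<n. z ^ Suc j * f (g ^ Suc j * x))"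
    by (simp add: sum_distrib_left mult_ac)
  also have "\<dots> = (\<Sum>j<Suc n. z ^ j * f (g ^ j * x)) - f x"
    by (subst sum.lessThan_Suc_shift) simp
  also have "\<dots> = (\<Sum>j<n. z ^ j * f (g ^ j * x))"
    using assms by simp
  finally show ?thesis using z by (simp add: field_simps)
qed

lemma periodic_cong:
  fixes f :: "nat \<Rightarrow> 'a"
  assumes "\<And>n. f (n + q) = f n" "[m = n] (mod q)"
  shows "f m = f n"
proof -
  have *: "f (n + k * q) = f n" for n k
  proof (induction k)
    case (Suc k)
    then show ?case using assms(1)[of "n + k * q"] by (simp add: add_ac)
  qed simp
  show ?thesis using assms(2) *[of "m mod q" "m div q"] *[of "n mod q" "n div q"]
    unfolding cong_def by (metis mod_mult_div_eq mult.commute)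
qed

text \<open>Induction on \<open>S\<close>: projecting to an eigenspace of \<open>g\<close> commutes
  with multiplying the argument by any other element, so it keeps the eigenvalue equations already
  obtained and all linear side conditions. The vanishing sums over the powers of \<open>a\<close>
  are carried along because in the end they rule out the eigenvalue 1 at \<open>a\<close>.\<close>

lemma common_eigenfunction:
  fixes f0 :: "nat \<Rightarrow> complex" and a q n :: nat
  assumes "q > 0" and n: "n = totient q"
    and "finite S" "\<And>g. g \<in> S \<Longrightarrow> coprime g q"
    and "\<exists>x. f0 x \<noteq> 0" "\<And>x. f0 (x + q) = f0 x" "\<And>x. \<not> coprime x q \<Longrightarrow> f0 x = 0"
    and "\<And>x. (\<Sum>j<n. f0 (a ^ j * x)) = 0"
  shows "\<exists>f. (\<exists>x. f x \<noteq> 0) \<and> (\<forall>x. f (x + q) = f x) \<and> (\<forall>x. \<not> coprime x q \<longrightarrow> f x = 0) \<and>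
     (\<forall>x. (\<Sum>j<n. f (a ^ j * x)) = 0) \<and> (\<forall>g\<in>S. \<exists>z::complex. \<forall>x. f (g * x) = z * f x)"
  using assms(3,4)
proof (induction S)
  case empty
  show ?case using assms(5-8) by (intro exI[of _ f0]) auto
next
  case (insert g S)
  have "\<And>g. g \<in> S \<Longrightarrow> coprime g q" using insert.prems by simp
  from insert.IH[OF this] obtain f x0 where f: "f x0 \<noteq> 0" "\<And>x. f (x + q) = f x" "\<And>x. \<not> coprime x q \<Longrightarrow> f x = 0"
     "\<And>x. (\<Sum>j<n. f (a ^ j * x)) = 0" "\<And>g. g \<in> S \<Longrightarrow> \<exists>z::complex. \<forall>x. f (g * x) = z * f x"
    by blast
  have n0: "n > 0" using assms by simp
  obtain z where z: "z ^ n = 1" "(\<Sum>j<n. z ^ j * f (g ^ j * x0)) \<noteq> 0"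
    using eigenprojection_nonzero[of n f x0 g] n0 f by blast
  define h where "h x = (\<Sum>j<n. z ^ j * f (g ^ j * x))" for x
  have cg: "coprime g q" using insert by auto
  have fg: "f (g ^ n * x) = f x" for x
  proof (rule periodic_cong[of f q, OF f(2)])
    have "[g ^ n = 1] (mod q)" using euler_theorem[OF cg] n by simp
    then show "[g ^ n * x = x] (mod q)" using cong_mult[of "g ^ n" 1 q x x] by simp
  qed
  show ?case
  proof (intro exI[of _ h] conjI allI ballI impI)
    show "\<exists>x. h x \<noteq> 0" using z(2) unfolding h_def by blast
    show "h (x + q) = h x" for x
      unfolding h_def
    proof (intro sum.cong refl arg_cong2[of _ _ _ _ "(*)"])
      show "f (g ^ j * (x + q)) = f (g ^ j * x)" for j
        by (rule periodic_cong[of f q, OF f(2)]) (simp add: cong_def distrib_left)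
    qed
    show "h x = 0" if "\<not> coprime x q" for x
      unfolding h_def using that f(3) by simp
    show "(\<Sum>j<n. h (a ^ j * x)) = 0" for x
    proof -
      have "(\<Sum>j<n. h (a ^ j * x)) = (\<Sum>i<n. z ^ i * (\<Sum>j<n. f (a ^ j * (g ^ i * x))))"
        unfolding h_def sum_distrib_left by (subst sum.swap) (simp add: mult_ac)
      then show ?thesis using f(4) by simp
    qed
    show "\<exists>w. \<forall>x. h (g' * x) = w * h x" if g': "g' \<in> insert g S" for g'
    proof (cases "g' = g")
      case True
      then show ?thesis unfolding h_def
        using eigenprojection_shift[of z n f g, OF z(1) n0 fg] by blast
    next
      case False
      then obtain w where w: "\<forall>x. f (g' * x) = w * f x" using f(5)[of g'] g' by auto
      then have "h (g' * x) = w * h x" for x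
        unfolding h_def sum_distrib_left
        by (intro sum.cong refl) (metis (no_types, opaque_lifting) w mult.left_commute)
      then show ?thesis by blast
    qed
  qed
qed

text \<open>This is the part of the duality of finite abelian groups that orthogonality needs,
  obtained without decomposing the unit group into cyclic factors. A common eigenfunction normalised
  at 1 is a character; if its value at \<open>a\<close> were 1, the sum of \<open>f\<close> over the
  powers of \<open>a\<close> would be \<open>of_nat n * f 1\<close> instead of 0.\<close>

lemma dirichlet_char_separates:
  assumes "q > 0" "coprime a q" "\<not> [a = 1] (mod q)"
  shows "\<exists>chi. dirichlet_char q chi \<and> chi a \<noteq> 1"
proof -
  define n where "n = totient q"
  \<comment> \<open>The indicator of the class of 1 minus that of \<open>a\<close>: nonzero because
    the classes differ, and telescoping along the sequence \<open>a ^ j * x\<close>.\<close>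
  define f0 :: "nat \<Rightarrow> complex" where "f0 x = of_bool [x = 1] (mod q) - of_bool [x = a] (mod q)" for x
  have n0: "n > 0" using assms by (simp add: n_def)
  have an: "[a ^ n = 1] (mod q)" using euler_theorem[OF assms(2)] n_def by simp
  have cop: "coprime x q" if "[x = b] (mod q)" "coprime b q" for x b
    using that by (metis cong_imp_coprime cong_sym)
  have "(\<Sum>j<n. f0 (a ^ j * x)) = 0" for x
  proof -
    define h :: "nat \<Rightarrow> complex" where "h j = of_bool [a ^ j * x = a] (mod q)" for j
    have "f0 (a ^ j * x) = h (Suc j) - h j" for j
    proof -
      have "[a * (a ^ j * x) = a * 1] (mod q) \<longleftrightarrow> [a ^ j * x = 1] (mod q)"
        using cong_mult_lcancel_nat assms(2) by blast
      then show ?thesis by (simp add: f0_def h_def mult.assoc)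
    qed
    then have "(\<Sum>j<n. f0 (a ^ j * x)) = h n - h 0"
      using sum_lessThan_telescope[of h n] by simp
    also have "[a ^ n * x = 1 * x] (mod q)" using an cong_mult cong_refl by blast
    then have "h n = h 0" unfolding h_def by (simp add: cong_def)
    finally show ?thesis by simp
  qed
  moreover have "f0 1 \<noteq> 0" using assms(3) by (auto simp: f0_def cong_sym_eq)
  moreover have "f0 (x + q) = f0 x" for x by (simp add: f0_def cong_def)
  moreover have "f0 x = 0" if "\<not> coprime x q" for x
    using that cop[of x 1] cop[of x a] assms(2) by (auto simp: f0_def)
  ultimately have "\<exists>f. (\<exists>x. f x \<noteq> 0) \<and> (\<forall>x. f (x + q) = f x) \<and> (\<forall>x. \<not> coprime x q \<longrightarrow> f x = 0) \<and>
     (\<forall>x. (\<Sum>j<n. f (a ^ j * x)) = 0) \<and>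
     (\<forall>g\<in>{g. g \<le> q \<and> coprime g q}. \<exists>z::complex. \<forall>x. f (g * x) = z * f x)"
    using assms(1) n_def by (intro common_eigenfunction[where ?f0.0 = f0]) auto
  then obtain f x0 where f: "f x0 \<noteq> (0::complex)" "\<And>x. f (x + q) = f x"
      "\<And>x. \<not> coprime x q \<Longrightarrow> f x = 0" "\<And>x. (\<Sum>j<n. f (a ^ j * x)) = 0"
      "\<And>g. g \<le> q \<Longrightarrow> coprime g q \<Longrightarrow> \<exists>z::complex. \<forall>x. f (g * x) = z * f x" by blast
  have per: "f x = f y" if "[x = y] (mod q)" for x y using periodic_cong[of f q, OF f(2)] that by blast
  have eig: "\<exists>z::complex. \<forall>x. f (g * x) = z * f x" if "coprime g q" for g
  proof -
    have "f ((g mod q) * x) = f (g * x)" for x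
      by (rule per) (simp add: cong_def mod_mult_left_eq)
    moreover have "coprime (g mod q) q" using that by (simp add: assms(1))
    ultimately show ?thesis using f(5)[of "g mod q"] assms(1)
      by (metis mod_less_divisor order_less_imp_le)
  qed
  \<comment> \<open>\<open>f\<close> vanishes off the residues coprime to \<open>q\<close>, so
    \<open>x0\<close> is coprime to \<open>q\<close> and \<open>f (x0 * 1)\<close> is a multiple of
    \<open>f 1\<close>.\<close>
  have f1: "f 1 \<noteq> 0" using eig[of x0] f(1,3)
    by (metis mult.right_neutral mult_zero_right)
  define chi where "chi g = f g / f 1" for g
  have chi: "f (g * x) = chi g * f x" if c: "coprime g q" for g x
  proof -
    obtain z where "\<forall>x. f (g * x) = z * f x" using eig[OF c] by metis
    from this[rule_format, of 1] this[rule_format, of x] show ?thesis using f1 by (simp add: chi_def)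
  qed
  have "dirichlet_char q chi"
    unfolding dirichlet_char_def
  proof (intro conjI allI)
    show "chi 1 = 1" using f1 by (simp add: chi_def)
    show "chi (m * n) = chi m * chi n" for m n
    proof (cases "coprime m q")
      case True
      then show ?thesis using chi[of m n] by (simp add: chi_def)
    next
      case False
      then show ?thesis using f(3) by (simp add: chi_def)
    qed
    show "chi (n + q) = chi n" for n using f(2) by (simp add: chi_def)
    show "chi m = 0 \<longleftrightarrow> \<not> coprime m q" for m
    proof
      assume "chi m = 0"
      show "\<not> coprime m q"
      proof
        assume c: "coprime m q"
        have "f (m ^ n) = f 1" using per euler_theorem[OF c] n_def by simp
        moreover have "m ^ n = m * m ^ (n - 1)" using n0 by (simp add: power_eq_if)
        ultimately show False using chi[OF c, of "m ^ (n - 1)"] \<open>chi m = 0\<close> f1 by simp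
      qed
    qed (use f(3) in \<open>auto simp: chi_def\<close>)
  qed
  moreover have "chi a \<noteq> 1"
  proof
    assume "chi a = 1"
    then have "f (a * x) = f x" for x using chi[OF assms(2)] by simp
    then have "f (a ^ j * 1) = f 1" for j by (induction j) (auto simp: mult.assoc)
    then have "(\<Sum>j<n. f (a ^ j * 1)) = of_nat n * f 1" by simp
    with f(4)[of 1] f1 n0 show False by (simp del: mult_1_right)
  qed
  ultimately show ?thesis by blast
qed

section \<open>Elementary properties and orthogonality of characters\<close>

lemma dirichlet_char_1: "dirichlet_char q chi \<Longrightarrow> chi 1 = 1"
  by (auto simp: dirichlet_char_def)

lemma dirichlet_char_power:
  "dirichlet_char q chi \<Longrightarrow> chi (m ^ n) = chi m ^ n"
  by (induction n) (auto simp: dirichlet_char_def)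

lemma dirichlet_char_cong:
  "dirichlet_char q chi \<Longrightarrow> [m = n] (mod q) \<Longrightarrow> chi m = chi n"
  by (rule periodic_cong[of chi q]) (auto simp: dirichlet_char_def)

lemma dirichlet_char_eq_0: "dirichlet_char q chi \<Longrightarrow> \<not> coprime n q \<Longrightarrow> chi n = 0"
  by (auto simp: dirichlet_char_def)

lemma dirichlet_char_mult: "dirichlet_char q chi \<Longrightarrow> chi (m * n) = chi m * chi n"
  by (auto simp: dirichlet_char_def)

lemma dirichlet_char_totient:
  assumes "dirichlet_char q chi" "coprime n q"
  shows "chi n ^ totient q = 1"
proof -
  have "chi (n ^ totient q) = chi 1"
    using dirichlet_char_cong[OF assms(1)] euler_theorem[OF assms(2)] by simp
  then show ?thesis using assms(1) dirichlet_char_power[OF assms(1)] by (simp add: dirichlet_char_def)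
qed

lemma norm_dirichlet_char:
  assumes "dirichlet_char q chi" "coprime n q" "q > 0"
  shows "norm (chi n) = 1"
proof -
  have "norm (chi n) ^ totient q = 1"
    using dirichlet_char_totient[OF assms(1,2)] by (metis norm_one norm_power)
  then show ?thesis using assms(3) power_eq_1_iff[of "norm (chi n)" "totient q"] by simp
qed

lemma norm_dirichlet_char_le:
  assumes "dirichlet_char q chi" "q > 0"
  shows "norm (chi n) \<le> 1"
  using norm_dirichlet_char[OF assms(1) _ assms(2), of n] dirichlet_char_eq_0[OF assms(1), of n]
  by (cases "coprime n q") auto

lemma finite_dirichlet_chars:
  assumes "q > 0"
  shows "finite {chi. dirichlet_char q chi}"
proof -
  define R where "R = insert 0 {z::complex. z ^ totient q = 1}"
  have "finite R" unfolding R_def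
    using finite_roots_unity[of "totient q"] assms by (simp add: Suc_le_eq)
  then have "finite (PiE {..<q} (\<lambda>_. R))" by (intro finite_PiE) auto
  moreover have "(\<lambda>chi. restrict chi {..<q}) ` {chi. dirichlet_char q chi} \<subseteq> PiE {..<q} (\<lambda>_. R)"
  proof (intro image_subsetI restrict_PiE_iff[THEN iffD2] ballI)
    fix chi n assume "chi \<in> {chi. dirichlet_char q chi}"
    then show "chi n \<in> R" unfolding R_def
      using dirichlet_char_totient[of q chi n] dirichlet_char_eq_0[of q chi n]
      by (cases "coprime n q") auto
  qed
  moreover have "inj_on (\<lambda>chi. restrict chi {..<q}) {chi. dirichlet_char q chi}"
  proof (intro inj_onI ext)
    fix c d :: "nat \<Rightarrow> complex" and n
    assume "c \<in> {chi. dirichlet_char q chi}" "d \<in> {chi. dirichlet_char q chi}"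
      and eq: "restrict c {..<q} = restrict d {..<q}"
    then have cd: "dirichlet_char q c" "dirichlet_char q d" by auto
    have "c n = c (n mod q)" "d n = d (n mod q)"
      by (rule dirichlet_char_cong[OF cd(1)], simp add: cong_def) (rule dirichlet_char_cong[OF cd(2)], simp add: cong_def)
    with fun_cong[OF eq, of "n mod q"] assms show "c n = d n" by simp
  qed
  ultimately show ?thesis by (meson finite_imageD finite_subset)
qed

lemma bij_betw_mult_mod:
  fixes q g :: nat
  assumes "q > 0" "coprime g q"
  shows "bij_betw (\<lambda>n. g * n mod q) {..<q} {..<q}"
proof -
  have "inj_on (\<lambda>n. g * n mod q) {..<q}"
  proof (intro inj_onI)
    fix x y assume "x \<in> {..<q}" "y \<in> {..<q}" "g * x mod q = g * y mod q"
    then have "[x = y] (mod q)" using cong_mult_lcancel_nat[OF assms(2)] by (simp add: cong_def)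
    with \<open>x \<in> {..<q}\<close> \<open>y \<in> {..<q}\<close> show "x = y" by (simp add: cong_def)
  qed
  moreover have "(\<lambda>n. g * n mod q) ` {..<q} \<subseteq> {..<q}" using assms by auto
  ultimately show ?thesis by (simp add: bij_betw_def endo_inj_surj)
qed

lemma sum_dirichlet_char:
  assumes "dirichlet_char q chi" "\<not> principal_char q chi" "q > 0"
  shows "(\<Sum>n<q. chi n) = 0"
proof -
  obtain g where g: "coprime g q" "chi g \<noteq> 1"
    using assms by (auto simp: principal_char_def)
  have "(\<Sum>n<q. chi n) = (\<Sum>n<q. chi (g * n mod q))"
    using sum.reindex_bij_betw[OF bij_betw_mult_mod[OF assms(3) g(1)], of chi] by simp
  also have "\<dots> = (\<Sum>n<q. chi g * chi n)"
  proof (intro sum.cong refl)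
    fix n
    have "chi (g * n mod q) = chi (g * n)"
      by (rule dirichlet_char_cong[OF assms(1)]) (simp add: cong_def)
    then show "chi (g * n mod q) = chi g * chi n" using dirichlet_char_mult[OF assms(1)] by simp
  qed
  also have "\<dots> = chi g * (\<Sum>n<q. chi n)" by (simp add: sum_distrib_left)
  finally show ?thesis using g by simp
qed

lemma dirichlet_char_prod:
  "dirichlet_char q c \<Longrightarrow> dirichlet_char q d \<Longrightarrow> dirichlet_char q (\<lambda>n. c n * d n)"
  by (auto simp: dirichlet_char_def)

text \<open>Multiplication by a character \<open>c\<close> with \<open>c a \<noteq> 1\<close>
  permutes the characters, so the sum equals itself times \<open>c a\<close>.\<close>

lemma sum_chars_eq_0:
  assumes "q > 0" "coprime a q" "\<not> [a = 1] (mod q)"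
  shows "(\<Sum>chi | dirichlet_char q chi. chi a) = 0"
proof -
  define X where "X = {chi. dirichlet_char q chi}"
  obtain c where c: "dirichlet_char q c" "c a \<noteq> 1" using dirichlet_char_separates[OF assms] by blast
  define T where "T chi = (\<lambda>n. c n * chi n)" for chi :: "nat \<Rightarrow> complex"
  have "inj_on T X"
  proof (intro inj_onI ext)
    fix d e n assume de: "d \<in> X" "e \<in> X" "T d = T e"
    show "d n = e n"
    proof (cases "coprime n q")
      case True
      then show ?thesis using fun_cong[OF de(3), of n] c(1) by (auto simp: T_def dirichlet_char_def)
    next
      case False
      then show ?thesis using de(1,2) by (simp add: X_def dirichlet_char_eq_0)
    qed
  qed
  moreover have "T ` X \<subseteq> X" using c dirichlet_char_prod by (auto simp: X_def T_def)
  moreover have "finite X" unfolding X_def using finite_dirichlet_chars assms by blast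
  ultimately have "bij_betw T X X" by (simp add: bij_betw_def endo_inj_surj)
  from sum.reindex_bij_betw[OF this, of "\<lambda>chi. chi a"]
  have "c a * (\<Sum>chi\<in>X. chi a) = (\<Sum>chi\<in>X. chi a)"
    by (simp add: T_def sum_distrib_left)
  then show ?thesis using c(2) by (simp add: X_def)
qed

lemma principal_char_iff:
  "principal_char q chi \<longleftrightarrow> chi = (\<lambda>n. of_bool (coprime n q))"
proof
  assume "principal_char q chi"
  then show "chi = (\<lambda>n. of_bool (coprime n q))"
    by (auto simp: principal_char_def dirichlet_char_def fun_eq_iff)
next
  assume *: "chi = (\<lambda>n. of_bool (coprime n q))"
  have "coprime (n + q) q \<longleftrightarrow> coprime n q" for n
    by (metis coprime_iff_gcd_eq_1 gcd_add1)
  then show "principal_char q chi"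
    unfolding principal_char_def dirichlet_char_def *
    by auto
qed

lemma sum_coprime_indicator: "q > 1 \<Longrightarrow> (\<Sum>n<q. of_bool (coprime n q)) = (of_nat (totient q) :: complex)"
proof -
  assume q: "q > 1"
  have "totatives q = {n\<in>{..<q}. coprime n q}"
    using q by (auto simp: totatives_def order.order_iff_strict intro!: Nat.gr0I)
  then show ?thesis by (simp add: totient_def sum.If_cases of_bool_def Int_def)
qed

text \<open>Double counting of the sum of \<open>chi n\<close> over all characters and all
  \<open>n < q\<close>: in one order only the principal character contributes, in the other only
  \<open>n = 1\<close>.\<close>

lemma card_dirichlet_chars:
  assumes "q > 1"
  shows "card {chi. dirichlet_char q chi} = totient q"
proof -
  define X where "X = {chi. dirichlet_char q chi}"
  define c0 :: "nat \<Rightarrow> complex" where "c0 = (\<lambda>n. of_bool (coprime n q))"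
  have fin: "finite X" unfolding X_def using finite_dirichlet_chars assms by simp
  have c0: "principal_char q c0" by (simp add: principal_char_iff c0_def)
  then have c0X: "c0 \<in> X" by (simp add: X_def principal_char_def)
  have "(\<Sum>chi\<in>X. \<Sum>n<q. chi n) = (\<Sum>chi\<in>X. if chi = c0 then of_nat (totient q) else 0)"
    using sum_dirichlet_char[of q] sum_coprime_indicator[OF assms] assms
    by (intro sum.cong) (auto simp: X_def c0_def principal_char_iff)
  also have "\<dots> = of_nat (totient q)" using fin c0X by simp
  finally have 1: "(\<Sum>n<q. \<Sum>chi\<in>X. chi n) = of_nat (totient q)"
    by (subst sum.swap) 
  have "(\<Sum>n<q. \<Sum>chi\<in>X. chi n) = (\<Sum>n<q. if n = 1 then of_nat (card X) else 0)"
  proof (intro sum.cong refl)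
    fix n assume "n \<in> {..<q}"
    then have "[n = 1] (mod q) \<longleftrightarrow> n = 1" using assms by (simp add: cong_def)
    moreover have "(\<Sum>chi\<in>X. chi 1) = of_nat (card X)" by (simp add: X_def dirichlet_char_1 del: One_nat_def)
    moreover have "(\<Sum>chi\<in>X. chi n) = 0" if "\<not> coprime n q"
      using that by (simp add: X_def dirichlet_char_eq_0)
    ultimately show "(\<Sum>chi\<in>X. chi n) = (if n = 1 then of_nat (card X) else 0)"
      using sum_chars_eq_0[of q n] assms by (cases "coprime n q") (auto simp: X_def)
  qed
  also have "\<dots> = of_nat (card X)" using assms by simp
  finally show ?thesis using 1 by (simp add: X_def)
qed

lemma sum_chars:
  assumes "q > 1" "coprime a q"
  shows "(\<Sum>chi | dirichlet_char q chi. chi a) = of_nat (totient q) * of_bool [a = 1] (mod q)"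
proof (cases "[a = 1] (mod q)")
  case True
  have "(\<Sum>chi | dirichlet_char q chi. chi a) = (\<Sum>chi | dirichlet_char q chi. 1)"
    using dirichlet_char_cong[of q _ a 1] True dirichlet_char_1 by (intro sum.cong refl) (metis mem_Collect_eq)
  then show ?thesis using True card_dirichlet_chars[OF assms(1)] by simp
qed (use sum_chars_eq_0[of q a] assms in auto)

text \<open>The factor (1 - \<open>chi (q - 1)\<close>) / 2 picks out the odd characters, and the
  conjugate of \<open>chi n\<close> is \<open>chi n'\<close> for an inverse \<open>n'\<close> of
  \<open>n\<close>. Two full character sums remain; \<open>q - 1\<close>, being -1 modulo
  \<open>q\<close>, turns the second congruence into divisibility of \<open>m + n\<close>. For
  \<open>q = 2\<close> there are no odd characters and the two indicators cancel.\<close>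

lemma sum_odd_chars:
  assumes "q > 1" "coprime m q" "coprime n q"
  shows "(\<Sum>chi | odd_char q chi. chi m * cnj (chi n)) =
    of_nat (totient q) / 2 * (of_bool [m = n] (mod q) - of_bool (q dvd m + n))"
proof -
  obtain n' where n': "[n * n' = 1] (mod q)"
    using cong_solve_coprime_nat[OF assms(3)] by auto
  have cn': "coprime n' q" using n' by (metis cong_imp_coprime cong_sym coprime_1_left coprime_mult_left_iff)
  have cq: "coprime (q - 1) q" using assms(1) coprime_diff_one_left_nat[of q] by simp
  have *: "chi n' = cnj (chi n)" if "dirichlet_char q chi" for chi
  proof -
    have "chi n * chi n' = 1"
      using dirichlet_char_cong[OF that n'] that by (simp add: dirichlet_char_def)
    moreover have "chi n * cnj (chi n) = 1"
      using norm_dirichlet_char[OF that assms(3)] assms(1)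
      by (simp flip: complex_norm_square)
    ultimately show ?thesis by (metis mult_left_cancel mult_zero_left zero_neq_one)
  qed
  have odd: "of_bool (odd_char q chi) = (1 - chi (q - 1)) / 2" if "dirichlet_char q chi" for chi
  proof -
    \<comment> \<open>That -1 squares to 1 becomes (q - 1)^2 = 1 + (q - 2) q over the natural
      numbers.\<close>
    define r where "r = q - 2"
    have "q = Suc (Suc r)" using assms(1) by (simp add: r_def)
    then have "(q - 1) * (q - 1) = 1 + r * q" by (simp add: algebra_simps)
    then have "[(q - 1) * (q - 1) = 1] (mod q)"
      by (simp only: cong_def mod_mult_self1)
    then have "chi ((q - 1) * (q - 1)) = chi 1" by (rule dirichlet_char_cong[OF that])
    then have "chi (q - 1) * chi (q - 1) = 1"
      by (simp only: dirichlet_char_mult[OF that] dirichlet_char_1[OF that])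
    then have "chi (q - 1) = 1 \<or> chi (q - 1) = -1"
      by (metis square_eq_1_iff)
    then show ?thesis using that by (auto simp: odd_char_def)
  qed
  have "(\<Sum>chi | odd_char q chi. chi m * cnj (chi n)) =
        (\<Sum>chi | dirichlet_char q chi. of_bool (odd_char q chi) * (chi m * cnj (chi n)))"
    using finite_dirichlet_chars[of q] assms
    by (intro sum.mono_neutral_cong_left) (auto simp: odd_char_def)
  also have "\<dots> = (\<Sum>chi | dirichlet_char q chi. (chi (m * n') - chi ((q - 1) * m * n')) / 2)"
  proof (intro sum.cong refl)
    fix chi assume "chi \<in> {chi. dirichlet_char q chi}"
    then have c: "dirichlet_char q chi" by simp
    show "of_bool (odd_char q chi) * (chi m * cnj (chi n)) = (chi (m * n') - chi ((q - 1) * m * n')) / 2"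
      unfolding odd[OF c] dirichlet_char_mult[OF c] *[OF c] by (simp add: field_simps)
  qed
  also have "\<dots> = (of_nat (totient q) * of_bool [m * n' = 1] (mod q)
      - of_nat (totient q) * of_bool [(q - 1) * m * n' = 1] (mod q)) / 2"
    unfolding sum_divide_distrib[symmetric] sum_subtractf
    using sum_chars[OF assms(1), of "m * n'"] sum_chars[OF assms(1), of "(q - 1) * m * n'"] assms(2) cn' cq
    by simp
  also have "[m * n' = 1] (mod q) \<longleftrightarrow> [m = n] (mod q)"
  proof -
    have "[m * n' = 1] (mod q) \<longleftrightarrow> [n' * m = n' * n] (mod q)"
      using n' by (simp add: cong_def mult.commute)
    then show ?thesis using cong_mult_lcancel_nat[OF cn'] by simp
  qed
  also have "[(q - 1) * m * n' = 1] (mod q) \<longleftrightarrow> q dvd m + n"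
  proof -
    have "[(q - 1) * m * n' = 1] (mod q) \<longleftrightarrow> [n' * ((q - 1) * m) = n' * n] (mod q)"
      using n' by (simp add: cong_def mult.commute)
    also have "\<dots> \<longleftrightarrow> [(q - 1) * m = n] (mod q)" using cong_mult_lcancel_nat[OF cn'] by simp
    also have "\<dots> \<longleftrightarrow> [(q - 1) * m + m = n + m] (mod q)" by (simp add: cong_add_rcancel_nat)
    also have "(q - 1) * m + m = q * m" using assms(1) by (cases q) auto
    also have "[q * m = n + m] (mod q) \<longleftrightarrow> q dvd m + n" 
      by (simp add: cong_def dvd_eq_mod_eq_0 add.commute eq_commute[of 0])
    finally show ?thesis .
  qed
  finally show ?thesis by (simp add: right_diff_distrib diff_divide_distrib)
qed

section \<open>Euler products\<close>

definition smooth_numbers :: "nat set \<Rightarrow> nat set" where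
  "smooth_numbers P = {n. n > 0 \<and> prime_factors n \<subseteq> P}"

lemma bij_betw_smooth_numbers_insert:
  assumes "prime p" "p \<notin> P"
  shows "bij_betw (\<lambda>(j, n). p ^ j * n) (UNIV \<times> smooth_numbers P) (smooth_numbers (insert p P))"
proof (rule bij_betwI)
  have p0: "p > 0" using assms(1) prime_gt_0_nat by blast
  have pow: "prime_factors (p ^ j) \<subseteq> {p}" for j
    using assms(1) by (cases "j = 0") (simp_all add: prime_factorization_prime_power)
  have notdvd: "\<not> p dvd n" if "n \<in> smooth_numbers P" for n
    using that assms by (auto simp: smooth_numbers_def prime_factors_dvd)
  have "prime_factors (p ^ j * n) \<subseteq> insert p P" if "n \<in> smooth_numbers P" for j n
    using that pow[of j] p0 by (auto simp: prime_factors_product smooth_numbers_def)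
  then show "(\<lambda>(j, n). p ^ j * n) \<in> UNIV \<times> smooth_numbers P \<rightarrow> smooth_numbers (insert p P)"
    using p0 by (auto simp: smooth_numbers_def)
  show "(\<lambda>m. (multiplicity p m, m div p ^ multiplicity p m)) \<in> smooth_numbers (insert p P) \<rightarrow> UNIV \<times> smooth_numbers P"
  proof (intro Pi_I)
    fix m assume m: "m \<in> smooth_numbers (insert p P)"
    define n where "n = m div p ^ multiplicity p m"
    have mn: "m = p ^ multiplicity p m * n" by (simp add: n_def multiplicity_dvd)
    have "m > 0" using m by (simp add: smooth_numbers_def)
    then have "n > 0" using mn by (metis gr0I mult_0_right)
    have "\<not> p dvd n" unfolding n_def
      by (rule multiplicity_decompose) (use \<open>m > 0\<close> assms(1) in auto)
    moreover have "n dvd m" using mn by (metis dvd_triv_right)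
    then have "prime_factors n \<subseteq> insert p P"
      using m \<open>m > 0\<close> dvd_prime_factors[of m n] by (auto simp: smooth_numbers_def)
    ultimately have "prime_factors n \<subseteq> P" by (auto simp: prime_factors_dvd)
    then show "(multiplicity p m, m div p ^ multiplicity p m) \<in> UNIV \<times> smooth_numbers P"
      using \<open>n > 0\<close> by (simp add: smooth_numbers_def n_def)
  qed
  show "(\<lambda>m. (multiplicity p m, m div p ^ multiplicity p m)) ((\<lambda>(j, n). p ^ j * n) x) = x"
    if "x \<in> UNIV \<times> smooth_numbers P" for x
  proof -
    obtain j n where x: "x = (j, n)" by force
    with that have n: "n \<in> smooth_numbers P" by simp
    have "multiplicity p (p ^ j * n) = j"
      using notdvd[OF n] assms(1) n p0
      by (simp add: prime_elem_multiplicity_mult_distrib not_dvd_imp_multiplicity_0 smooth_numbers_def)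
    then show ?thesis using p0 by (simp add: x)
  qed
  show "(\<lambda>(j, n). p ^ j * n) (multiplicity p m, m div p ^ multiplicity p m) = m"
    if "m \<in> smooth_numbers (insert p P)" for m
    by (simp add: multiplicity_dvd)
qed

text \<open>Each new prime multiplies the sum by its local series:
  \<open>bij_betw_smooth_numbers_insert\<close> splits the new index set into a product, and
  absolute convergence allows summing over one factor at a time.\<close>

lemma has_sum_smooth_numbers:
  fixes f :: "nat \<Rightarrow> 'a :: {real_normed_field, banach}"
  assumes "f 1 = 1" "\<And>m n. coprime m n \<Longrightarrow> f (m * n) = f m * f n"
    and sm: "(\<lambda>n. norm (f n)) summable_on UNIV"
    and "finite P" "\<And>p. p \<in> P \<Longrightarrow> prime p"
  shows "(f has_sum (\<Prod>p\<in>P. \<Sum>\<^sub>\<infinity>j. f (p ^ j))) (smooth_numbers P)"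
  using assms(4,5)
proof (induction P)
  case empty
  have "smooth_numbers {} = {1}"
    by (auto simp: smooth_numbers_def prime_factorization_empty_iff)
  then show ?case using assms(1) by (simp add: has_sum_finite_iff)
next
  case (insert p P)
  have p: "prime p" using insert by simp
  have sf: "f summable_on A" for A
    using abs_summable_summable[OF sm] summable_on_subset_banach by blast
  have cop: "coprime (p ^ j) n" if "n \<in> smooth_numbers P" for j n
    using that insert.hyps p by (auto simp: smooth_numbers_def prime_factors_dvd intro!: prime_imp_coprime)
  note bij = bij_betw_smooth_numbers_insert[OF p insert.hyps(2)]
  have s: "(\<lambda>x. f (case x of (j, n) \<Rightarrow> p ^ j * n)) summable_on (UNIV \<times> smooth_numbers P)"
    using summable_on_reindex_bij_betw[OF bij, of f] sf by simp
  have "inj (\<lambda>j. p ^ j)"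
    using prime_gt_1_nat[OF p] by (intro injI) simp
  then have sp: "(\<lambda>j. f (p ^ j)) summable_on UNIV"
    using summable_on_reindex[of "\<lambda>j. p ^ j" UNIV f] sf by (simp add: o_def)
  define X where "X = (\<Prod>p\<in>P. \<Sum>\<^sub>\<infinity>j. f (p ^ j))"
  have IH: "(f has_sum X) (smooth_numbers P)" unfolding X_def using insert by auto
  have "((\<lambda>x. f (case x of (j, n) \<Rightarrow> p ^ j * n)) has_sum ((\<Sum>\<^sub>\<infinity>j. f (p ^ j)) * X)) (UNIV \<times> smooth_numbers P)"
  proof (rule has_sum_SigmaI[where g = "\<lambda>j. f (p ^ j) * X"])
    show "((\<lambda>n. f (case (j, n) of (j, n) \<Rightarrow> p ^ j * n)) has_sum f (p ^ j) * X) (smooth_numbers P)" for j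
    proof -
      have "((\<lambda>n. f (p ^ j) * f n) has_sum f (p ^ j) * X) (smooth_numbers P)"
        by (rule has_sum_cmult_right[OF IH])
      then show ?thesis
        by (rule has_sum_cong[THEN iffD1, rotated]) (use assms(2) cop in auto)
    qed
    show "((\<lambda>j. f (p ^ j) * X) has_sum ((\<Sum>\<^sub>\<infinity>j. f (p ^ j)) * X)) UNIV"
      using sp by (intro has_sum_cmult_left has_sum_infsum)
  qed (use s in simp)
  then have "(f has_sum ((\<Sum>\<^sub>\<infinity>j. f (p ^ j)) * X)) (smooth_numbers (insert p P))"
    using has_sum_reindex_bij_betw[OF bij, of f] by simp
  then show ?case using insert.hyps by (simp add: X_def)
qed

text \<open>The numbers 1, ..., \<open>N\<close> have no prime factor above \<open>N\<close>, so the
  finite product differs from the full sum by at most the tail of the absolute series beyond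
  \<open>N\<close>. The condition at 0 is there because 0 is never a smooth number.\<close>

theorem euler_product:
  fixes f :: "nat \<Rightarrow> 'a :: {real_normed_field, banach}"
  assumes "f 0 = 0" "f 1 = 1" "\<And>m n. coprime m n \<Longrightarrow> f (m * n) = f m * f n"
    and sm: "(\<lambda>n. norm (f n)) summable_on UNIV"
  shows "(\<lambda>N. \<Prod>p | prime p \<and> p \<le> N. \<Sum>\<^sub>\<infinity>j. f (p ^ j)) \<longlonglongrightarrow> (\<Sum>\<^sub>\<infinity>n. f n)"
proof -
  define g where "g n = norm (f n)" for n
  have sg: "g summable_on A" for A
    using sm summable_on_subset_banach unfolding g_def by blast
  have sf: "f summable_on A" for A
    using abs_summable_summable[OF sm] summable_on_subset_banach by blast
  have "(\<lambda>N. \<Sum>n\<le>N. g n) \<longlonglongrightarrow> infsum g UNIV"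
    using has_sum_imp_sums[OF has_sum_infsum[OF sg]] by (simp add: sums_def_le)
  then have lim: "(\<lambda>N. infsum g UNIV - (\<Sum>n\<le>N. g n)) \<longlonglongrightarrow> 0"
    using tendsto_diff[OF tendsto_const[of "infsum g UNIV"]] by fastforce
  have bd: "norm ((\<Prod>p | prime p \<and> p \<le> N. \<Sum>\<^sub>\<infinity>j. f (p ^ j)) - (\<Sum>\<^sub>\<infinity>n. f n)) \<le> infsum g UNIV - (\<Sum>n\<le>N. g n)" for N
  proof -
    define S where "S = smooth_numbers {p. prime p \<and> p \<le> N}"
    have sub: "{1..N} \<subseteq> S"
      unfolding S_def smooth_numbers_def by (auto simp: prime_factors_dvd intro: order_trans[OF dvd_imp_le])
    have "infsum f S = (\<Prod>p | prime p \<and> p \<le> N. \<Sum>\<^sub>\<infinity>j. f (p ^ j))"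
      unfolding S_def 
      by (intro infsumI has_sum_smooth_numbers assms(2-3) sm) auto
    moreover have "infsum f UNIV = infsum f S + infsum f (- S)"
      using infsum_Un_disjoint[OF sf sf, of S "- S"] by simp
    ultimately have "norm ((\<Prod>p | prime p \<and> p \<le> N. \<Sum>\<^sub>\<infinity>j. f (p ^ j)) - (\<Sum>\<^sub>\<infinity>n. f n)) = norm (infsum f (- S))"
      by (simp add: norm_minus_commute)
    also have "\<dots> \<le> infsum g (- S)"
      using norm_infsum_bound[of f "- S"] sg[of "- S"] unfolding g_def by blast
    also have "\<dots> \<le> infsum g {N<..}"
      by (rule infsum_mono_neutral[OF sg sg])
         (use sub in \<open>auto simp: g_def not_less subset_iff assms(1) intro: Nat.gr0I, metis One_nat_def Suc_leI assms(1) gr0I norm_zero\<close>)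
    also have "infsum g UNIV = infsum g {..N} + infsum g {N<..}"
      using infsum_Un_disjoint[OF sg sg, of "{..N}" "{N<..}"]
      by (metis Compl_atMost Compl_disjoint Compl_partition)
    then have "infsum g {N<..} = infsum g UNIV - (\<Sum>n\<le>N. g n)" by simp
    finally show ?thesis .
  qed
  show ?thesis
    by (rule LIM_zero_cancel, rule Lim_null_comparison[OF _ lim]) (use bd in auto)
qed

text \<open>The Dirichlet coefficients of \<open>\<zeta>(s)\<^sup>-\<^sup>k\<close>.\<close>

definition zeta_inv_coeff :: "nat \<Rightarrow> nat \<Rightarrow> real" where
  "zeta_inv_coeff k n = (if n = 0 then 0 else
     \<Prod>p\<in>prime_factors n. (-1) ^ multiplicity p n * real (k choose multiplicity p n))"

lemma zeta_inv_coeff_0 [simp]: "zeta_inv_coeff k 0 = 0"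
  and zeta_inv_coeff_1 [simp]: "zeta_inv_coeff k (Suc 0) = 1"
  by (simp_all add: zeta_inv_coeff_def)

lemma zeta_inv_coeff_prime_power:
  assumes "prime p"
  shows "zeta_inv_coeff k (p ^ j) = (-1) ^ j * real (k choose j)"
proof (cases "j = 0")
  case False
  then have "prime_factors (p ^ j) = {p}"
    using assms by (simp add: prime_factorization_prime_power)
  then show ?thesis using assms prime_gt_0_nat[OF assms] by (simp add: zeta_inv_coeff_def)
qed simp

lemma zeta_inv_coeff_mult:
  assumes "coprime m n"
  shows "zeta_inv_coeff k (m * n) = zeta_inv_coeff k m * zeta_inv_coeff k n"
proof (cases "m = 0 \<or> n = 0")
  case False
  define F where "F l p = (-1) ^ multiplicity p l * real (k choose multiplicity p l)" for l p :: nat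
  have disj: "prime_factors m \<inter> prime_factors n = {}"
    using coprime_common_divisor[OF assms] not_prime_unit by (auto simp: prime_factors_dvd)
  have m: "F (m * n) p = F m p" if "p \<in> prime_factors m" for p
  proof -
    have "p \<notin> prime_factors n" "prime p" using that disj by auto
    then have "multiplicity p n = 0"
      using False by (auto simp: prime_factors_dvd not_dvd_imp_multiplicity_0)
    then show ?thesis using False \<open>prime p\<close>
      by (simp add: F_def prime_elem_multiplicity_mult_distrib)
  qed
  have n: "F (m * n) p = F n p" if "p \<in> prime_factors n" for p
  proof -
    have "p \<notin> prime_factors m" "prime p" using that disj by auto
    then have "multiplicity p m = 0"
      using False by (auto simp: prime_factors_dvd not_dvd_imp_multiplicity_0)
    then show ?thesis using False \<open>prime p\<close>
      by (simp add: F_def prime_elem_multiplicity_mult_distrib)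
  qed
  have "zeta_inv_coeff k (m * n) = (\<Prod>p\<in>prime_factors m \<union> prime_factors n. F (m * n) p)"
    using False by (simp add: zeta_inv_coeff_def F_def prime_factors_product)
  also have "\<dots> = (\<Prod>p\<in>prime_factors m. F m p) * (\<Prod>p\<in>prime_factors n. F n p)"
    using disj m n by (simp add: prod.union_disjoint)
  finally show ?thesis using False by (simp add: zeta_inv_coeff_def F_def)
qed auto

text \<open>A prime \<open>p\<close> with \<open>p powr a \<ge> B\<close> absorbs its own factor
  \<open>B\<close>; the remaining primes lie below \<open>P0\<close> and together cost at most
  \<open>B ^ P0\<close>.\<close>

lemma power_omega_bound:
  fixes B a :: real
  assumes "B \<ge> 1" "a > 0"
  shows "\<exists>C>0. \<forall>n>0. B ^ card (prime_factors n) \<le> C * real n powr a"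
proof -
  define P0 where "P0 = nat \<lceil>B powr (1 / a)\<rceil>"
  have big: "B \<le> real p powr a" if "p \<ge> P0" for p
  proof -
    have "B powr (1 / a) \<le> real p" using that unfolding P0_def by linarith
    then have "(B powr (1 / a)) powr a \<le> real p powr a"
      using assms by (intro powr_mono2) auto
    then show ?thesis using assms by (simp add: powr_powr)
  qed
  have "B ^ card (prime_factors n) \<le> B ^ P0 * real n powr a" if n: "n > 0" for n
  proof -
    have "B ^ card (prime_factors n) = (\<Prod>p\<in>prime_factors n. B)" by simp
    also have "\<dots> \<le> (\<Prod>p\<in>prime_factors n. (if p < P0 then B else 1) * real p powr a)"
    proof (intro prod_mono conjI)
      fix p assume "p \<in> prime_factors n"
      then have "prime p" by auto
      then have "1 \<le> real p powr a" using prime_ge_1_nat assms by (intro ge_one_powr_ge_zero) auto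
      then show "B \<le> (if p < P0 then B else 1) * real p powr a"
        using big[of p] assms mult_left_mono[of 1 "real p powr a" B] by auto
    qed (use assms in auto)
    also have "\<dots> = B ^ card {p\<in>prime_factors n. p < P0} * (\<Prod>p\<in>prime_factors n. real p powr a)"
      by (simp add: prod.distrib prod.If_cases Int_def)
    also have "(\<Prod>p\<in>prime_factors n. real p powr a) = (\<Prod>p\<in>prime_factors n. real p) powr a"
      by (rule prod_powr_distrib[symmetric])
    also have "B ^ card {p\<in>prime_factors n. p < P0} * \<dots> \<le> B ^ P0 * real n powr a"
    proof (intro mult_mono power_increasing powr_mono2)
      have "card {p\<in>prime_factors n. p < P0} \<le> card {..<P0}" by (intro card_mono) auto
      then show "card {p\<in>prime_factors n. p < P0} \<le> P0" by simp
      have "(\<Prod>p\<in>prime_factors n. p) \<le> (\<Prod>p\<in>prime_factors n. p ^ multiplicity p n)"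
        by (intro prod_mono conjI self_le_power) (auto simp: prime_factors_multiplicity dest: prime_ge_1_nat)
      also have "\<dots> = n" using n prime_factorization_nat[of n] by simp
      finally show "(\<Prod>p\<in>prime_factors n. real p) \<le> real n" by (simp flip: of_nat_prod)
    qed (use assms in \<open>auto intro!: prod_nonneg\<close>)
    finally show ?thesis .
  qed
  then show ?thesis using assms by (intro exI[of _ "B ^ P0"]) auto
qed

text \<open>Each prime factor of \<open>n\<close> contributes one binomial coefficient of
  \<open>k\<close>, hence at most \<open>2 ^ k\<close>.\<close>

lemma zeta_inv_coeff_bound:
  assumes "a > 0"
  shows "\<exists>C>0. \<forall>n. \<bar>zeta_inv_coeff k n\<bar> \<le> C * real n powr a"
proof -
  obtain C where C: "C > 0" "\<And>n. n > 0 \<Longrightarrow> (2 ^ k) ^ card (prime_factors n) \<le> C * real n powr a"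
    using power_omega_bound[of "2 ^ k" a] assms by (metis one_le_numeral one_le_power)
  have "\<bar>zeta_inv_coeff k n\<bar> \<le> C * real n powr a" if "n > 0" for n
  proof -
    have "\<bar>zeta_inv_coeff k n\<bar> = (\<Prod>p\<in>prime_factors n. real (k choose multiplicity p n))"
      using that by (simp add: zeta_inv_coeff_def abs_prod abs_mult power_abs)
    also have "\<dots> \<le> (\<Prod>p\<in>prime_factors n. 2 ^ k)"
    proof (intro prod_mono conjI)
      have "(k choose j) \<le> 2 ^ k" for j
        by (cases "j \<le> k") (auto simp: binomial_le_pow2 binomial_eq_0)
      then show "real (k choose multiplicity p n) \<le> 2 ^ k" for p
        by (metis of_nat_le_iff of_nat_numeral of_nat_power)
    qed auto
    finally show ?thesis using C(2)[OF that] by simp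
  qed
  then have "\<bar>zeta_inv_coeff k n\<bar> \<le> C * real n powr a" for n by (cases "n = 0") simp_all
  with C(1) show ?thesis by (intro exI[of _ C]) simp
qed

section \<open>Partial summation\<close>

lemma of_nat_powr_mult:
  "of_nat (m * n) powr (s :: complex) = of_nat m powr s * of_nat n powr s"
  using powr_times_real[of "of_nat m" "of_nat n" s] by simp

lemma norm_of_nat_powr: "norm (of_nat n powr (s :: complex)) = real n powr Re s"
  by (subst norm_powr_real_powr) auto

lemma has_field_derivative_powr_uminus:
  fixes z s :: complex
  assumes "z \<notin> \<real>\<^sub>\<le>\<^sub>0"
  shows "((\<lambda>z. z powr (-s)) has_field_derivative (-s * z powr (-s - 1))) (at z within A)"
  using has_field_derivative_at_within[OF has_field_derivative_powr[OF assms, of "-s"]] by simp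

lemma powr_uminus_diff_bound:
  fixes x y :: real and s :: complex
  assumes "x > 0" "x \<le> y" "y \<le> x + 1" "Re s \<ge> -1"
  shows "norm (of_real y powr (-s) - of_real x powr (-s)) \<le> norm s * x powr (-Re s - 1)"
proof -
  have "norm (of_real y powr (-s) - of_real x powr (-s)) \<le>
          (norm s * x powr (-Re s - 1)) * norm (of_real y - of_real x :: complex)"
  proof (rule field_differentiable_bound[where S = "of_real ` {x..y}"
        and f' = "\<lambda>z. -s * z powr (-s - 1)"])
    show "convex (of_real ` {x..y} :: complex set)"
      by (intro convex_linear_image) (auto intro: linear_of_real)
    show "((\<lambda>z. z powr (-s)) has_field_derivative (-s * z powr (-s - 1))) (at z within of_real ` {x..y})"
      if "z \<in> of_real ` {x..y}" for z :: complex
      using that assms by (intro has_field_derivative_powr_uminus) auto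
    show "norm (-s * z powr (-s - 1)) \<le> norm s * x powr (-Re s - 1)"
      if "z \<in> of_real ` {x..y}" for z
    proof -
      obtain u where u: "z = of_real u" "x \<le> u" using \<open>z \<in> _\<close> by auto
      have "norm (-s * z powr (-s - 1)) = norm s * u powr (-Re s - 1)"
        using u assms by (simp add: norm_mult norm_powr_real_powr)
      also have "\<dots> \<le> norm s * x powr (-Re s - 1)"
        using u assms by (intro mult_left_mono powr_mono2') auto
      finally show ?thesis .
    qed
  qed (use assms in auto)
  also have "norm (of_real y - of_real x :: complex) = y - x"
    using assms by (metis abs_of_nonneg diff_ge_0_iff_ge norm_of_real of_real_diff)
  also have "(norm s * x powr (-Re s - 1)) * (y - x) \<le> (norm s * x powr (-Re s - 1)) * 1"
    using assms by (intro mult_left_mono) auto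
  finally show ?thesis by simp
qed

lemma summation_by_parts_lessThan:
  fixes a u :: "nat \<Rightarrow> 'a :: comm_ring"
  shows "(\<Sum>n<N. a n * u n) = (\<Sum>n<N. a n) * u N + (\<Sum>n<N. (\<Sum>i\<le>n. a i) * (u n - u (Suc n)))"
  by (induction N) (auto simp: algebra_simps lessThan_Suc_atMost[symmetric])

text \<open>Coefficients are indexed from 1, hence the shifts.\<close>

definition parts_term :: "(nat \<Rightarrow> complex) \<Rightarrow> nat \<Rightarrow> complex \<Rightarrow> complex" where
  "parts_term a n s = (\<Sum>i\<le>n. a (Suc i)) * (of_nat (Suc n) powr (-s) - of_nat (Suc (Suc n)) powr (-s))"

lemma norm_parts_term:
  assumes "\<And>n. norm (\<Sum>i<n. a (Suc i)) \<le> B" "Re s \<ge> -1"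
  shows "norm (parts_term a n s) \<le> B * (norm s * real (Suc n) powr (-Re s - 1))"
proof -
  have "norm (of_nat (Suc (Suc n)) powr (-s) - of_nat (Suc n) powr (-s)) \<le>
        norm s * real (Suc n) powr (-Re s - 1)"
    using powr_uminus_diff_bound[of "real (Suc n)" "real (Suc (Suc n))" s] assms(2) by simp
  moreover have "norm (\<Sum>i\<le>n. a (Suc i)) \<le> B"
    using assms(1)[of "Suc n"] by (simp add: lessThan_Suc_atMost)
  moreover have "B \<ge> 0" using assms(1)[of 0] by simp
  ultimately show ?thesis unfolding parts_term_def norm_mult
    by (subst norm_minus_commute) (intro mult_mono, auto)
qed

lemma summable_Suc_powr: "s < -1 \<Longrightarrow> summable (\<lambda>n. real (Suc n) powr s)"
  by (subst summable_Suc_iff[of "\<lambda>n. real n powr s"]) (simp add: summable_real_powr_iff)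

text \<open>Abel summation turns bounded partial sums of the coefficients into an absolutely
  convergent series for Re s > 0. The bound is linear in \<open>B\<close>, which becomes
  \<open>q\<close> for a character; this is why L-functions grow only polynomially in
  \<open>q\<close>.\<close>

lemma dirichlet_series_by_parts:
  assumes B: "\<And>n. norm (\<Sum>i<n. a (Suc i)) \<le> B" and s: "Re s > 0"
  shows "(\<lambda>n. a (Suc n) * of_nat (Suc n) powr (-s)) sums (\<Sum>n. parts_term a n s)" (is ?A)
    and "norm (\<Sum>n. parts_term a n s) \<le> B * norm s * (\<Sum>n. real (Suc n) powr (-Re s - 1))" (is ?B)
proof -
  have S: "summable (\<lambda>n. real (Suc n) powr (-Re s - 1))"
    using s by (intro summable_Suc_powr) simp
  have sm: "summable (\<lambda>n. B * (norm s * real (Suc n) powr (-Re s - 1)))"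
    by (intro summable_mult S)
  have bd: "norm (parts_term a n s) \<le> B * (norm s * real (Suc n) powr (-Re s - 1))" for n
    using B s by (intro norm_parts_term) auto
  have sp: "summable (\<lambda>n. norm (parts_term a n s))"
    by (rule summable_comparison_test'[OF sm]) (use bd in simp)
  have L1: "(\<lambda>N. \<Sum>n<N. parts_term a n s) \<longlonglongrightarrow> (\<Sum>n. parts_term a n s)"
    by (intro summable_LIMSEQ summable_norm_cancel[OF sp])
  have L2: "(\<lambda>N. (\<Sum>i<N. a (Suc i)) * of_nat (Suc N) powr (-s)) \<longlonglongrightarrow> 0"
  proof (rule Lim_null_comparison)
    show "\<forall>\<^sub>F N in sequentially. norm ((\<Sum>i<N. a (Suc i)) * of_nat (Suc N) powr (-s)) \<le> B * real (Suc N) powr (-Re s)"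
      by (intro always_eventually allI, unfold norm_mult norm_of_nat_powr uminus_complex.sel, intro mult_right_mono B, simp)
    have "filterlim (\<lambda>N. real (Suc N)) at_top sequentially"
      by (rule filterlim_compose[OF filterlim_real_sequentially filterlim_Suc])
    then have "(\<lambda>N. real (Suc N) powr (-Re s)) \<longlonglongrightarrow> 0"
      using s by (intro tendsto_neg_powr) auto
    then show "(\<lambda>N. B * real (Suc N) powr (-Re s)) \<longlonglongrightarrow> 0"
      using tendsto_mult_right_zero by blast
  qed
  show ?A
    unfolding sums_def summation_by_parts_lessThan[of "\<lambda>n. a (Suc n)"]
    using tendsto_add[OF L2 L1] by (simp only: parts_term_def add_0)
  have "norm (\<Sum>n. parts_term a n s) \<le> (\<Sum>n. B * (norm s * real (Suc n) powr (-Re s - 1)))"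
    by (rule norm_suminf_le[OF bd sm])
  also have "\<dots> = B * norm s * (\<Sum>n. real (Suc n) powr (-Re s - 1))"
    by (simp only: suminf_mult[OF summable_mult[OF S]] suminf_mult[OF S] mult.assoc)
  finally show ?B .
qed

lemma holomorphic_by_parts:
  assumes B: "\<And>n. norm (\<Sum>i<n. a (Suc i)) \<le> B"
  shows "(\<lambda>s. \<Sum>n. parts_term a n s) holomorphic_on {s. Re s > 0}"
proof (rule holomorphic_uniform_sequence[where f = "\<lambda>N s. \<Sum>n<N. parts_term a n s"])
  show "open {s. Re s > 0}" by (rule open_halfspace_Re_gt)
  show "(\<lambda>s. \<Sum>n<N. parts_term a n s) holomorphic_on {s. Re s > 0}" for N
    unfolding parts_term_def by (intro holomorphic_intros)
  show "\<exists>d>0. cball x d \<subseteq> {s. Re s > 0} \<and>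
     uniform_limit (cball x d) (\<lambda>N s. \<Sum>n<N. parts_term a n s) (\<lambda>s. \<Sum>n. parts_term a n s) sequentially"
    if x: "x \<in> {s. Re s > 0}" for x
  \<comment> \<open>On this ball the real part stays at least \<open>Re x / 2\<close>, so a single
    summable majorant serves the whole ball.\<close>
  proof (intro exI[of _ "Re x / 2"] conjI)
    have B0: "B \<ge> 0" using B[of 0] by simp
    have Re: "Re s \<ge> Re x / 2" "norm s \<le> norm x + Re x / 2" if "s \<in> cball x (Re x / 2)" for s
    proof -
      have "norm (x - s) \<le> Re x / 2" using that by (simp add: dist_norm)
      then show "Re s \<ge> Re x / 2" using complex_Re_le_cmod[of "x - s"] by simp
      show "norm s \<le> norm x + Re x / 2"
        using \<open>norm (x - s) \<le> Re x / 2\<close> norm_triangle_ineq2[of s x] by (simp add: norm_minus_commute)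
    qed
    show "Re x / 2 > 0" using x by simp
    show "cball x (Re x / 2) \<subseteq> {s. Re s > 0}" using Re(1) x by force
    show "uniform_limit (cball x (Re x / 2)) (\<lambda>N s. \<Sum>n<N. parts_term a n s) (\<lambda>s. \<Sum>n. parts_term a n s) sequentially"
    proof (rule Weierstrass_m_test)
      show "norm (parts_term a n s) \<le> B * ((norm x + Re x / 2) * real (Suc n) powr (-(Re x / 2) - 1))"
        if "s \<in> cball x (Re x / 2)" for n s
      proof -
        have "norm (parts_term a n s) \<le> B * (norm s * real (Suc n) powr (-Re s - 1))"
          using B Re[OF that] x by (intro norm_parts_term) auto
        also have "\<dots> \<le> B * ((norm x + Re x / 2) * real (Suc n) powr (-(Re x / 2) - 1))"
          using Re[OF that] x by (intro mult_left_mono mult_mono powr_mono B0) auto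
        finally show ?thesis .
      qed
      show "summable (\<lambda>n. B * ((norm x + Re x / 2) * real (Suc n) powr (-(Re x / 2) - 1)))"
        using x by (intro summable_mult summable_Suc_powr) simp
    qed
  qed
qed

text \<open>Blocks of \<open>q\<close> consecutive terms sum to 0 wherever they start, so only an
  incomplete block of fewer than \<open>q\<close> terms is left.\<close>

lemma bounded_sums_periodic:
  fixes g :: "nat \<Rightarrow> complex"
  assumes "\<And>n. g (n + q) = g n" "(\<Sum>n<q. g n) = 0" "q > 0" "\<And>n. norm (g n) \<le> K"
  shows "norm (\<Sum>i<n. g (Suc i)) \<le> real q * K"
proof -
  have block: "(\<Sum>i<q. g (m + i)) = 0" for m
  proof (induction m)
    case (Suc m)
    have "(\<Sum>i<q. g (Suc m + i)) = (\<Sum>i<Suc q. g (m + i)) - g m"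
      by (subst sum.lessThan_Suc_shift) simp
    then show ?case using Suc assms(1)[of m] by simp
  qed (use assms in simp)
  have K: "K \<ge> 0" using assms(4)[of 0] norm_ge_zero order_trans by blast
  show ?thesis
  proof (induction n rule: less_induct)
    case (less n)
    show ?case
    proof (cases "n < q")
      case True
      have "norm (\<Sum>i<n. g (Suc i)) \<le> (\<Sum>i<n. K)"
        by (intro sum_norm_le assms)
      also have "\<dots> \<le> real q * K" using True K by (simp add: mult_right_mono)
      finally show ?thesis .
    next
      case False
      have split: "(\<Sum>i<m + r. g (Suc i)) = (\<Sum>i<m. g (Suc i)) + (\<Sum>i<r. g (Suc m + i))" for m r
        by (induction r) (auto simp: add_ac)
      have "(\<Sum>i<n. g (Suc i)) = (\<Sum>i<n - q. g (Suc i)) + (\<Sum>i<q. g (Suc (n - q) + i))"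
        using split[of "n - q" q] False by simp
      then have "(\<Sum>i<n. g (Suc i)) = (\<Sum>i<n - q. g (Suc i))" by (simp only: block) simp
      then show ?thesis using less[of "n - q"] False assms(3) by simp
    qed
  qed
qed

section \<open>Dirichlet L-functions\<close>

text \<open>\<open>F\<close> is an antiderivative of z^(-s). Its increments over unit intervals
  telescope to 1 / (s - 1), and each differs from the corresponding term n^(-s) by at most |s| /
  n^2.\<close>

lemma norm_zeta_minus_pole:
  assumes "Re s > 1"
  shows "norm ((\<Sum>n. of_nat (Suc n) powr (-s)) - 1 / (s - 1)) \<le> norm s * (\<Sum>n. real (Suc n) powr (-2))"
proof -
  define F :: "complex \<Rightarrow> complex" where "F z = z powr (-(s - 1)) / (1 - s)" for z
  have s1: "s \<noteq> 1" using assms by auto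
  have Fd: "(F has_field_derivative z powr (-s)) (at z within A)" if "z \<notin> \<real>\<^sub>\<le>\<^sub>0" for z A
    unfolding F_def
    using DERIV_cdivide[OF has_field_derivative_powr_uminus[OF that, of "s - 1" A], of "1 - s"] s1
    by (simp add: divide_simps)
  have step: "norm (of_nat (Suc n) powr (-s) - (F (of_nat (Suc (Suc n))) - F (of_nat (Suc n)))) \<le>
      norm s * real (Suc n) powr (-2)" for n
  proof -
    define a where "a = real (Suc n)"
    define c :: complex where "c = of_real a powr (-s)"
    have a: "a \<ge> 1" by (simp add: a_def)
    \<comment> \<open>Mean value inequality for F(z) - z c, whose derivative z^(-s) - a^(-s) is
      small on the unit interval starting at \<open>a\<close>.\<close>
    have "norm ((F (of_real (a + 1)) - of_real (a + 1) * c) - (F (of_real a) - of_real a * c)) \<le>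
          (norm s * a powr (-Re s - 1)) * norm (of_real (a + 1) - of_real a :: complex)"
    proof (rule field_differentiable_bound[where S = "of_real ` {a..a+1}" and f' = "\<lambda>z. z powr (-s) - c"])
      show "convex (of_real ` {a..a+1} :: complex set)"
        by (intro convex_linear_image) (auto intro: linear_of_real)
      show "((\<lambda>z. F z - z * c) has_field_derivative z powr (-s) - c) (at z within of_real ` {a..a+1})"
        if z: "z \<in> of_real ` {a..a+1}" for z
      proof -
        have "z \<notin> \<real>\<^sub>\<le>\<^sub>0" using z a by auto
        from Fd[OF this] show ?thesis by (auto intro!: derivative_eq_intros)
      qed
      show "norm (z powr (-s) - c) \<le> norm s * a powr (-Re s - 1)" if "z \<in> of_real ` {a..a+1}" for z
        using that a assms unfolding c_def by (auto intro!: powr_uminus_diff_bound)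
    qed (auto simp del: of_real_add)
    also have "norm (of_real (a + 1) - of_real a :: complex) = 1" by simp
    also have "norm s * a powr (-Re s - 1) * 1 \<le> norm s * a powr (-2)"
      using assms a by (simp add: mult_left_mono powr_mono)
    also have "(F (of_real (a + 1)) - of_real (a + 1) * c) - (F (of_real a) - of_real a * c) =
       - (of_nat (Suc n) powr (-s) - (F (of_nat (Suc (Suc n))) - F (of_nat (Suc n))))"
    proof -
      have "complex_of_real (a + 1) = of_nat (Suc (Suc n))" "complex_of_real a = of_nat (Suc n)"
        by (simp_all add: a_def)
      then show ?thesis unfolding c_def by (simp add: algebra_simps)
    qed
    finally show ?thesis by (simp only: norm_minus_cancel a_def)
  qed
  have tele: "(\<lambda>n. F (of_nat (Suc (Suc n))) - F (of_nat (Suc n))) sums (0 - F (of_nat (Suc 0)))"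
  proof (rule telescope_sums)
    have "filterlim (\<lambda>N. real (Suc N)) at_top sequentially"
      by (rule filterlim_compose[OF filterlim_real_sequentially filterlim_Suc])
    then have "(\<lambda>N. real (Suc N) powr (-(Re s - 1))) \<longlonglongrightarrow> 0"
      by (rule tendsto_neg_powr[rotated]) (use assms in simp)
    then have "(\<lambda>N. of_nat (Suc N) powr (-(s - 1)) :: complex) \<longlonglongrightarrow> 0"
      by (rule Lim_null_comparison[rotated]) (simp only: norm_of_nat_powr uminus_complex.sel minus_complex.sel one_complex.sel order_refl always_eventually simp_thms)
    then show "(\<lambda>N. F (of_nat (Suc N))) \<longlonglongrightarrow> 0"
      unfolding F_def using tendsto_divide_zero by blast
  qed
  have F1: "0 - F (of_nat (Suc 0)) = 1 / (s - 1)"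
    using s1 by (simp add: F_def divide_simps)
  have sm2: "summable (\<lambda>n. norm s * real (Suc n) powr (-2))"
    by (intro summable_mult summable_Suc_powr) simp
  have smz: "summable (\<lambda>n. of_nat (Suc n) powr (-s) :: complex)"
    by (rule summable_comparison_test'[OF summable_Suc_powr[of "-Re s"]])
       (use assms in \<open>auto simp: norm_of_nat_powr simp del: of_nat_Suc\<close>)
  have "(\<Sum>n. of_nat (Suc n) powr (-s)) - 1 / (s - 1) =
     (\<Sum>n. of_nat (Suc n) powr (-s) - (F (of_nat (Suc (Suc n))) - F (of_nat (Suc n))))"
    using sums_unique[OF sums_diff[OF summable_sums[OF smz] tele]] unfolding F1 .
  also have "norm \<dots> \<le> (\<Sum>n. norm s * real (Suc n) powr (-2))"
    by (rule norm_suminf_le[OF step sm2])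
  also have "\<dots> = norm s * (\<Sum>n. real (Suc n) powr (-2))"
    by (rule suminf_mult[OF summable_Suc_powr]) simp
  finally show ?thesis .
qed

text \<open>Subtracting the mean \<open>c\<close> leaves a function with bounded partial sums, whose
  series is harmless; the mean contributes \<open>c\<close> times zeta and hence the pole. One
  statement thus covers zeta and the square of a character, whether that square is principal
  (\<open>c \<noteq> 0\<close>) or not (\<open>c = 0\<close>).\<close>

lemma periodic_dirichlet_series_near_pole:
  fixes f :: "nat \<Rightarrow> complex"
  assumes per: "\<And>n. f (n + q) = f n" and q: "q > 0" and bd: "\<And>n. norm (f n) \<le> 1"
  defines "c \<equiv> (\<Sum>n<q. f n) / of_nat q"
  shows "\<exists>K. \<forall>s. Re s > 1 \<longrightarrow>
    norm ((\<Sum>n. f (Suc n) * of_nat (Suc n) powr (-s)) - c / (s - 1)) \<le> K * norm s"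
proof -
  define Z where "Z = (\<Sum>n. real (Suc n) powr (-2))"
  define g where "g n = f n - c" for n
  have c: "norm c \<le> 1"
  proof -
    have "norm (\<Sum>n<q. f n) \<le> (\<Sum>n<q. 1)" by (intro sum_norm_le bd)
    then show ?thesis using q by (simp add: c_def norm_divide)
  qed
  have gb: "norm (\<Sum>i<n. g (Suc i)) \<le> real q * 2" for n
  proof (rule bounded_sums_periodic)
    show "(\<Sum>n<q. g n) = 0" using q by (simp add: g_def sum_subtractf c_def)
    show "norm (g n) \<le> 2" for n
      using norm_triangle_ineq4[of "f n" c] bd[of n] c by (simp add: g_def)
  qed (use per q in \<open>auto simp: g_def\<close>)
  have "norm ((\<Sum>n. f (Suc n) * of_nat (Suc n) powr (-s)) - c / (s - 1)) \<le> (2 * q * Z + Z) * norm s"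
    if s: "Re s > 1" for s
  proof -
    note P = dirichlet_series_by_parts[of g, OF gb, of s]
    have G: "(\<lambda>n. g (Suc n) * of_nat (Suc n) powr (-s)) sums (\<Sum>n. parts_term g n s)" using P s by simp
    have smz: "summable (\<lambda>n. of_nat (Suc n) powr (-s) :: complex)"
      by (rule summable_comparison_test'[OF summable_Suc_powr[of "-Re s"]])
         (use s in \<open>auto simp: norm_of_nat_powr simp del: of_nat_Suc\<close>)
    have "(\<lambda>n. g (Suc n) * of_nat (Suc n) powr (-s) + c * of_nat (Suc n) powr (-s)) sums
       ((\<Sum>n. parts_term g n s) + c * (\<Sum>n. of_nat (Suc n) powr (-s)))"
      by (intro sums_add G sums_mult summable_sums smz)
    then have "(\<Sum>n. f (Suc n) * of_nat (Suc n) powr (-s)) =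
      (\<Sum>n. parts_term g n s) + c * (\<Sum>n. of_nat (Suc n) powr (-s))"
      by (subst sums_unique[symmetric]) (simp_all add: g_def algebra_simps del: of_nat_Suc)
    then have "(\<Sum>n. f (Suc n) * of_nat (Suc n) powr (-s)) - c / (s - 1) =
      (\<Sum>n. parts_term g n s) + c * ((\<Sum>n. of_nat (Suc n) powr (-s)) - 1 / (s - 1))"
      by (simp add: algebra_simps del: of_nat_Suc)
    also have "norm \<dots> \<le> norm (\<Sum>n. parts_term g n s) + norm c * norm ((\<Sum>n. of_nat (Suc n) powr (-s)) - 1 / (s - 1))"
      using norm_triangle_ineq norm_mult by metis
    also have "\<dots> \<le> real q * 2 * norm s * Z + 1 * (norm s * Z)"
    proof (intro add_mono mult_mono c norm_zeta_minus_pole[OF s, folded Z_def])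
      have "norm (\<Sum>n. parts_term g n s) \<le> real q * 2 * norm s * (\<Sum>n. real (Suc n) powr (-Re s - 1))"
        using P s by simp
      also have "\<dots> \<le> real q * 2 * norm s * Z" unfolding Z_def
        using s by (intro mult_left_mono suminf_le powr_mono summable_Suc_powr) auto
      finally show "norm (\<Sum>n. parts_term g n s) \<le> real q * 2 * norm s * Z" .
    qed auto
    finally show ?thesis by (simp add: algebra_simps)
  qed
  then show ?thesis by blast
qed

lemma dirichlet_L_altdef:
  "dirichlet_L chi s = (\<Sum>n. chi (Suc n) * of_nat (Suc n) powr (-s))"
  unfolding dirichlet_L_def by (simp only: powr_minus divide_inverse)

lemma dirichlet_L_by_parts:
  assumes "dirichlet_char q chi" "\<not> principal_char q chi" "q > 0"
  shows "Re s > 0 \<Longrightarrow> dirichlet_L chi s = (\<Sum>n. parts_term chi n s)"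
    and "Re s > 0 \<Longrightarrow> norm (dirichlet_L chi s) \<le> q * norm s * (\<Sum>n. real (Suc n) powr (-Re s - 1))"
    and "Re s > 0 \<Longrightarrow> (\<lambda>n. chi (Suc n) * of_nat (Suc n) powr (-s)) sums dirichlet_L chi s"
    and "dirichlet_L chi holomorphic_on {s. Re s > 0}"
proof -
  have B: "norm (\<Sum>i<n. chi (Suc i)) \<le> real q" for n
    using bounded_sums_periodic[of chi q 1 n] sum_dirichlet_char[OF assms] norm_dirichlet_char_le[OF assms(1,3)]
      assms by (auto simp: dirichlet_char_def)
  note P = dirichlet_series_by_parts[of chi, OF B]
  show 1: "dirichlet_L chi s = (\<Sum>n. parts_term chi n s)" if "Re s > 0" for s
    unfolding dirichlet_L_altdef using P(1)[OF that] by (simp only: sums_iff)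
  show "norm (dirichlet_L chi s) \<le> q * norm s * (\<Sum>n. real (Suc n) powr (-Re s - 1))" if "Re s > 0"
    using 1[OF that] P(2)[OF that] by simp
  show "(\<lambda>n. chi (Suc n) * of_nat (Suc n) powr (-s)) sums dirichlet_L chi s" if "Re s > 0"
    using P(1)[OF that] unfolding 1[OF that] .
  show "dirichlet_L chi holomorphic_on {s. Re s > 0}"
    using holomorphic_by_parts[of chi, OF B] by (rule holomorphic_transform) (use 1 in auto)
qed

section \<open>L-functions and their inverse powers for Re s > 1\<close>

lemma summable_dirichlet_terms:
  assumes "\<And>n. norm (a n :: complex) \<le> C * real n powr \<eta>" "Re s > 1 + \<eta>"
  shows "(\<lambda>n. norm (a n * of_nat n powr (-s))) summable_on UNIV"
proof (rule Infinite_Sum.abs_summable_on_comparison_test'[where g = "\<lambda>n. C * real n powr (\<eta> - Re s)"])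
  show "(\<lambda>n. C * real n powr (\<eta> - Re s)) summable_on UNIV"
    using assms(2) by (intro summable_on_cmult_right)
       (simp add: summable_on_UNIV_nonneg_real_iff summable_real_powr_iff)
  show "norm (a n * of_nat n powr (-s)) \<le> C * real n powr (\<eta> - Re s)" for n
    using mult_right_mono[OF assms(1)[of n], of "real n powr (-Re s)"]
    unfolding norm_mult norm_of_nat_powr uminus_complex.sel diff_conv_add_uminus powr_add
    by (simp add: mult.assoc)
qed

lemma dirichlet_L_infsum:
  assumes "dirichlet_char q chi" "q > 0" "Re s > 1"
  shows "(\<lambda>n. norm (chi n * of_nat n powr (-s))) summable_on UNIV"
    and "dirichlet_L chi s = (\<Sum>\<^sub>\<infinity>n. chi n * of_nat n powr (-s))"
proof -
  \<comment> \<open>For \<open>q = 1\<close> the value \<open>chi 0\<close> is 1, whereas the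
    comparison bound \<open>real 0 powr 0\<close> is 0. Resetting this value changes no term, since
    \<open>of_nat 0 powr (-s)\<close> is 0.\<close>
  have "(\<lambda>n. norm ((if n = 0 then 0 else chi n) * of_nat n powr (-s))) summable_on UNIV"
    by (rule summable_dirichlet_terms[where C = 1 and \<eta> = 0])
       (use norm_dirichlet_char_le[OF assms(1,2)] assms in auto)
  also have "(\<lambda>n. norm ((if n = 0 then 0 else chi n) * of_nat n powr (-s))) = (\<lambda>n. norm (chi n * of_nat n powr (-s)))"
    by auto
  finally show sm: "(\<lambda>n. norm (chi n * of_nat n powr (-s))) summable_on UNIV" .
  have "(\<lambda>n. chi n * of_nat n powr (-s)) sums (\<Sum>\<^sub>\<infinity>n. chi n * of_nat n powr (-s))"
    by (rule has_sum_imp_sums[OF has_sum_infsum[OF abs_summable_summable[OF sm]]])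
  then have "(\<lambda>n. chi (Suc n) * of_nat (Suc n) powr (-s)) sums (\<Sum>\<^sub>\<infinity>n. chi n * of_nat n powr (-s))"
    by (subst sums_Suc_iff) simp
  then show "dirichlet_L chi s = (\<Sum>\<^sub>\<infinity>n. chi n * of_nat n powr (-s))"
    unfolding dirichlet_L_altdef by (simp only: sums_iff)
qed

lemma of_nat_power_powr:
  assumes "p > 0"
  shows "of_nat (p ^ j) powr (s :: complex) = (of_nat p powr s) ^ j"
proof (induction j)
  case (Suc j)
  then show ?case using of_nat_powr_mult[of p "p ^ j" s] by simp
qed auto

lemma norm_prime_term_less_1:
  assumes "dirichlet_char q chi" "q > 0" "Re s > 0" "prime p"
  shows "norm (chi p * of_nat p powr (-s)) < 1"
proof -
  have "real p powr (-Re s) < 1"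
    using assms(3) prime_gt_1_nat[OF assms(4)] by (simp add: powr_less_one)
  moreover have "norm (chi p * of_nat p powr (-s)) \<le> 1 * real p powr (-Re s)"
    using norm_dirichlet_char_le[OF assms(1,2), of p] unfolding norm_mult norm_of_nat_powr uminus_complex.sel
    by (intro mult_right_mono) auto
  ultimately show ?thesis by linarith
qed

lemma euler_product_L:
  assumes "dirichlet_char q chi" "q > 0" "Re s > 1"
  shows "(\<lambda>N. \<Prod>p | prime p \<and> p \<le> N. 1 / (1 - chi p * of_nat p powr (-s))) \<longlonglongrightarrow> dirichlet_L chi s"
proof -
  have "(\<lambda>N. \<Prod>p | prime p \<and> p \<le> N. \<Sum>\<^sub>\<infinity>j. chi (p ^ j) * of_nat (p ^ j) powr (-s)) \<longlonglongrightarrow> dirichlet_L chi s"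
    unfolding dirichlet_L_infsum(2)[OF assms]
    by (rule euler_product[OF _ _ _ dirichlet_L_infsum(1)[OF assms]])
       (use dirichlet_char_1[OF assms(1)] dirichlet_char_mult[OF assms(1)] in
          \<open>auto simp: of_nat_powr_mult simp del: of_nat_mult\<close>)
  moreover have "(\<Sum>\<^sub>\<infinity>j. chi (p ^ j) * of_nat (p ^ j) powr (-s)) = 1 / (1 - chi p * of_nat p powr (-s))"
    if p: "prime p" for p
  proof (rule infsumI)
    have "norm (chi p * of_nat p powr (-s)) < 1"
      using norm_prime_term_less_1[OF assms(1,2) _ p] assms(3) by simp
    then have "((\<lambda>j. (chi p * of_nat p powr (-s)) ^ j) has_sum 1 / (1 - chi p * of_nat p powr (-s))) UNIV"
      by (intro norm_summable_imp_has_sum geometric_sums) (simp_all add: norm_power summable_geometric)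
    also have "(\<lambda>j. (chi p * of_nat p powr (-s)) ^ j) = (\<lambda>j. chi (p ^ j) * of_nat (p ^ j) powr (-s))"
      using prime_gt_0_nat[OF p]
      by (simp only: of_nat_power_powr dirichlet_char_power[OF assms(1)] power_mult_distrib)
    finally show "((\<lambda>j. chi (p ^ j) * of_nat (p ^ j) powr (-s)) has_sum 1 / (1 - chi p * of_nat p powr (-s))) UNIV" .
  qed
  ultimately show ?thesis by simp
qed

lemma summable_L_inverse:
  assumes "dirichlet_char q chi" "q > 0" "Re s > 1"
  shows "(\<lambda>n. norm (of_real (zeta_inv_coeff k n) * chi n * of_nat n powr (-s))) summable_on UNIV"
proof -
  define \<eta> where "\<eta> = (Re s - 1) / 2"
  have "\<eta> > 0" using assms by (simp add: \<eta>_def)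
  then obtain C where C: "C > 0" "\<forall>n. \<bar>zeta_inv_coeff k n\<bar> \<le> C * real n powr \<eta>"
    using zeta_inv_coeff_bound by blast
  show ?thesis
  proof (rule summable_dirichlet_terms)
    show "norm (of_real (zeta_inv_coeff k n) * chi n) \<le> C * real n powr \<eta>" for n
    proof -
      have "norm (of_real (zeta_inv_coeff k n) * chi n) \<le> \<bar>zeta_inv_coeff k n\<bar> * 1"
        unfolding norm_mult norm_of_real using norm_dirichlet_char_le[OF assms(1,2)] by (intro mult_left_mono) auto
      then show ?thesis using C(2) by (metis mult.right_neutral order_trans)
    qed
    show "Re s > 1 + \<eta>" using assms by (simp add: \<eta>_def field_simps)
  qed
qed

text \<open>By the binomial theorem the local series of the inverse coefficients is the
  \<open>k\<close>-th power of the reciprocal Euler factor, so the finite products multiply to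
  exactly 1 before any limit is taken. The equation also shows that L has no zeros for Re s >
  1.\<close>

lemma dirichlet_L_power_mult_inverse:
  assumes "dirichlet_char q chi" "q > 0" "Re s > 1"
  shows "dirichlet_L chi s ^ k * (\<Sum>\<^sub>\<infinity>n. of_real (zeta_inv_coeff k n) * chi n * of_nat n powr (-s)) = 1"
proof -
  have "(\<lambda>N. \<Prod>p | prime p \<and> p \<le> N. \<Sum>\<^sub>\<infinity>j. of_real (zeta_inv_coeff k (p ^ j)) * chi (p ^ j) * of_nat (p ^ j) powr (-s))
     \<longlonglongrightarrow> (\<Sum>\<^sub>\<infinity>n. of_real (zeta_inv_coeff k n) * chi n * of_nat n powr (-s))"
    by (rule euler_product[OF _ _ _ summable_L_inverse[OF assms]])
       (use dirichlet_char_1[OF assms(1)] dirichlet_char_mult[OF assms(1)] in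
          \<open>auto simp: of_nat_powr_mult zeta_inv_coeff_mult simp del: of_nat_mult\<close>)
  moreover have "(\<Sum>\<^sub>\<infinity>j. of_real (zeta_inv_coeff k (p ^ j)) * chi (p ^ j) * of_nat (p ^ j) powr (-s)) =
      (1 - chi p * of_nat p powr (-s)) ^ k" if p: "prime p" for p
  proof -
    define x where "x = chi p * of_nat p powr (-s)"
    have "(\<Sum>\<^sub>\<infinity>j. of_real (zeta_inv_coeff k (p ^ j)) * chi (p ^ j) * of_nat (p ^ j) powr (-s)) =
       (\<Sum>\<^sub>\<infinity>j. of_nat (k choose j) * (-x) ^ j)"
      using prime_gt_0_nat[OF p]
      by (intro infsum_cong, simp only: of_nat_power_powr dirichlet_char_power[OF assms(1)] zeta_inv_coeff_prime_power[OF p])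
         (simp add: x_def power_mult_distrib power_minus[of "_ * _"])
    also have "\<dots> = (\<Sum>\<^sub>\<infinity>j\<in>{..k}. of_nat (k choose j) * (-x) ^ j)"
      by (intro infsum_cong_neutral) (auto simp: binomial_eq_0)
    also have "\<dots> = (-x + 1) ^ k" unfolding binomial_ring by simp
    finally show ?thesis by (simp add: x_def)
  qed
  ultimately have M: "(\<lambda>N. \<Prod>p | prime p \<and> p \<le> N. (1 - chi p * of_nat p powr (-s)) ^ k)
     \<longlonglongrightarrow> (\<Sum>\<^sub>\<infinity>n. of_real (zeta_inv_coeff k n) * chi n * of_nat n powr (-s))"
    by simp
  have ne: "1 - chi p * of_nat p powr (-s) \<noteq> 0" if "prime p" for p
    using norm_prime_term_less_1[OF assms(1,2) _ that, of s] assms(3) by auto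
  have "(\<Prod>p | prime p \<and> p \<le> N. 1 / (1 - chi p * of_nat p powr (-s))) ^ k *
     (\<Prod>p | prime p \<and> p \<le> N. (1 - chi p * of_nat p powr (-s)) ^ k) = 1" for N
    using ne by (simp add: prod_power_distrib flip: prod.distrib power_mult_distrib)
  then have "(\<lambda>_::nat. 1) \<longlonglongrightarrow>
      dirichlet_L chi s ^ k * (\<Sum>\<^sub>\<infinity>n. of_real (zeta_inv_coeff k n) * chi n * of_nat n powr (-s))"
    using tendsto_mult[OF tendsto_power[OF euler_product_L[OF assms], of k] M] by simp
  from LIMSEQ_unique[OF this tendsto_const] show ?thesis .
qed

section \<open>Non-vanishing on the line Re s = 1\<close>

text \<open>Take logarithms and expand: with w = z^n on the unit circle, the coefficient of -r^n / n
  is 3 + 4 Re w + Re (w^2) = 2 (1 + Re w)^2, which is nonnegative.\<close>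

lemma norm_341_local:
  fixes r :: real and z :: complex
  assumes r: "0 \<le> r" "r < 1" and z: "norm z = 1"
  shows "norm (1 - of_real r :: complex) ^ 3 * norm (1 - of_real r * z) ^ 4 * norm (1 - of_real r * z ^ 2) \<le> 1"
proof -
  have series: "(\<lambda>n. - (r ^ n * Re (w ^ n) / real n)) sums ln (norm (1 - of_real r * w))"
    if w: "norm w = 1" for w :: complex
  proof -
    have n: "norm (- (of_real r * w)) < 1" using r w by (simp add: norm_mult)
    then have ne: "1 + - (of_real r * w) \<noteq> 0" by auto
    have "(\<lambda>n. Re (- ((- (- (of_real r * w))) ^ n) / of_nat n)) sums Re (Ln (1 + - (of_real r * w)))"
      by (rule sums_Re[OF Ln_series'[OF n]])
    moreover have "Re (- ((- (- (of_real r * w))) ^ n) / of_nat n) = - (r ^ n * Re (w ^ n) / real n)" for n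
      unfolding minus_minus power_mult_distrib
      by (simp add: Re_divide_of_nat flip: of_real_power)
    moreover have "Re (Ln (1 + - (of_real r * w))) = ln (norm (1 - of_real r * w))"
      using Re_Ln[OF ne] by simp
    ultimately show ?thesis by (simp only:)
  qed
  define A B C where "A = norm (1 - of_real r :: complex)" and "B = norm (1 - of_real r * z)"
    and "C = norm (1 - of_real r * z ^ 2)"
  have pos: "norm (1 - of_real r * w) > 0" if "norm w = 1" for w :: complex
  proof -
    have "norm (of_real r * w) < 1" using r that by (simp add: norm_mult)
    then show ?thesis by auto
  qed
  have "A > 0" "B > 0" "C > 0"
    using pos[of 1] pos[of z] pos[of "z ^ 2"] z by (simp_all add: A_def B_def C_def norm_power)
  have "(\<lambda>n. 3 * - (r ^ n * Re (1 ^ n) / real n) + 4 * - (r ^ n * Re (z ^ n) / real n)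
       + - (r ^ n * Re ((z ^ 2) ^ n) / real n)) sums (3 * ln A + 4 * ln B + ln C)"
    unfolding A_def B_def C_def
    using series[of 1] series[of z] series[of "z ^ 2"] z
    by (intro sums_add sums_mult) (simp_all add: norm_power)
  moreover have "3 * - (r ^ n * Re (1 ^ n) / real n) + 4 * - (r ^ n * Re (z ^ n) / real n)
       + - (r ^ n * Re ((z ^ 2) ^ n) / real n) \<le> 0" for n
  proof -
    define w where "w = z ^ n"
    have "(Re w)\<^sup>2 + (Im w)\<^sup>2 = 1"
      using z cmod_power2[of w] by (simp add: w_def norm_power)
    then have "3 + 4 * Re w + Re (w ^ 2) = 2 * (1 + Re w)\<^sup>2"
      by (simp add: Re_power2 power2_sum algebra_simps power2_eq_square)
    then have nn: "3 + 4 * Re w + Re (w ^ 2) \<ge> 0" by simp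
    have "3 * - (r ^ n * Re (1 ^ n) / real n) + 4 * - (r ^ n * Re (z ^ n) / real n)
       + - (r ^ n * Re ((z ^ 2) ^ n) / real n) = - (r ^ n / real n * (3 + 4 * Re w + Re (w ^ 2)))"
      by (simp add: w_def algebra_simps add_divide_distrib flip: power_mult)
    then show ?thesis using nn r by simp
  qed
  ultimately have "3 * ln A + 4 * ln B + ln C \<le> 0"
    by (rule sums_le[OF _ _ sums_zero, rotated])
  then have "ln (A ^ 3 * B ^ 4 * C) \<le> 0"
    using \<open>A > 0\<close> \<open>B > 0\<close> \<open>C > 0\<close> by (simp add: ln_mult ln_realpow)
  then show ?thesis
    using \<open>A > 0\<close> \<open>B > 0\<close> \<open>C > 0\<close> by (simp add: A_def B_def C_def)
qed

text \<open>Makes zeta the L-function of modulus 1, so that the Euler product of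
  \<open>euler_product_L\<close> applies to it.\<close>

lemma dirichlet_char_mod_1: "dirichlet_char 1 (\<lambda>_. 1)"
  by (auto simp: dirichlet_char_def)

text \<open>The local inequality holds factor by factor in the finite Euler products and survives
  the limit.\<close>

lemma norm_L_341:
  assumes chi: "dirichlet_char q chi" and q: "q > 0" and x: "x > 0"
  shows "1 \<le> norm (dirichlet_L (\<lambda>_. 1) (Complex (1 + x) 0)) ^ 3 * norm (dirichlet_L chi (Complex (1 + x) t)) ^ 4 *
         norm (dirichlet_L (\<lambda>n. chi n * chi n) (Complex (1 + x) (2 * t)))"
proof (rule LIMSEQ_le_const)
  have chi2: "dirichlet_char q (\<lambda>n. chi n * chi n)" by (rule dirichlet_char_prod[OF chi chi])
  define P where "P c s N = (\<Prod>p | prime p \<and> p \<le> N. 1 / (1 - c p * of_nat p powr (-s)))"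
    for c :: "nat \<Rightarrow> complex" and s and N :: nat
  show "(\<lambda>N. norm (P (\<lambda>_. 1) (Complex (1 + x) 0) N) ^ 3 * norm (P chi (Complex (1 + x) t) N) ^ 4 *
      norm (P (\<lambda>n. chi n * chi n) (Complex (1 + x) (2 * t)) N)) \<longlonglongrightarrow>
      norm (dirichlet_L (\<lambda>_. 1) (Complex (1 + x) 0)) ^ 3 * norm (dirichlet_L chi (Complex (1 + x) t)) ^ 4 *
         norm (dirichlet_L (\<lambda>n. chi n * chi n) (Complex (1 + x) (2 * t)))"
    unfolding P_def
    by (intro tendsto_mult tendsto_power tendsto_norm euler_product_L[OF dirichlet_char_mod_1]
        euler_product_L[OF chi q] euler_product_L[OF chi2 q]) (use x in auto)
  have local: "1 \<le> norm (1 / (1 - 1 * of_nat p powr (-Complex (1 + x) 0)) :: complex) ^ 3 *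
      norm (1 / (1 - chi p * of_nat p powr (-Complex (1 + x) t))) ^ 4 *
      norm (1 / (1 - chi p * chi p * of_nat p powr (-Complex (1 + x) (2 * t))))" if p: "prime p" for p
  proof -
    define r where "r = real p powr (-(1 + x))"
    define y :: complex where "y = of_nat p powr (-Complex 0 t)"
    have p0: "p > 0" using prime_gt_0_nat[OF p] .
    have r: "0 < r" "r < 1" using prime_gt_1_nat[OF p] x by (auto simp: r_def powr_less_one)
    have pr: "of_nat p powr (of_real (-(1 + x))) = (of_real r :: complex)"
      using powr_of_real[of "real p" "-(1 + x)"] by (simp add: r_def)
    have e: "-Complex (1 + x) 0 = of_real (-(1 + x))" "-Complex (1 + x) t = of_real (-(1 + x)) + (-Complex 0 t)"
      "-Complex (1 + x) (2 * t) = of_real (-(1 + x)) + (-Complex 0 t + -Complex 0 t)"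
      by (simp_all add: complex_eq_iff)
    have E: "of_nat p powr (-Complex (1 + x) 0) = (of_real r :: complex)"
      "of_nat p powr (-Complex (1 + x) t) = of_real r * y"
      "of_nat p powr (-Complex (1 + x) (2 * t)) = of_real r * (y * y)"
      unfolding e powr_add pr y_def by simp_all
    have ny: "norm y = 1" using p0 by (simp add: y_def norm_of_nat_powr)
    have tr: "chi p * (of_real r * y) = of_real r * (chi p * y)"
       "chi p * chi p * (of_real r * (y * y)) = of_real r * (chi p * y) ^ 2"
      by (simp_all add: power2_eq_square)
    have le: "norm (1 - of_real r :: complex) ^ 3 * norm (1 - of_real r * (chi p * y)) ^ 4 *
        norm (1 - of_real r * (chi p * y) ^ 2) \<le> 1"
    proof (cases "coprime p q")
      case True
      then show ?thesis using norm_341_local[of r "chi p * y"] r ny norm_dirichlet_char[OF chi True q]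
        by (simp add: norm_mult)
    next
      case False
      \<comment> \<open>At primes dividing \<open>q\<close> only the factor coming from zeta is
        left, and \<open>1 - r\<close> has norm at most 1.\<close>
      then have "chi p = 0" using dirichlet_char_eq_0[OF chi] by simp
      moreover have "norm (1 - of_real r :: complex) \<le> 1"
        using r by (metis abs_of_nonneg diff_ge_0_iff_ge diff_le_eq le_add_same_cancel1 less_imp_le norm_of_real of_real_1 of_real_diff)
      ultimately show ?thesis by (simp add: power_le_one)
    qed
    have ne: "1 - of_real r * (chi p * y) \<noteq> 0" "1 - of_real r * (chi p * y) ^ 2 \<noteq> 0" "1 - of_real r \<noteq> (0 :: complex)"
      using norm_prime_term_less_1[OF chi q _ p, of "Complex (1 + x) t"]
        norm_prime_term_less_1[OF chi2 q _ p, of "Complex (1 + x) (2 * t)"] x r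
      unfolding E tr by auto
    show ?thesis unfolding E tr mult_1 norm_divide norm_one power_divide power_one
      using le ne by (simp add: field_simps)
  qed
  have "1 \<le> (\<Prod>p | prime p \<and> p \<le> N. norm (1 / (1 - 1 * of_nat p powr (-Complex (1 + x) 0)) :: complex) ^ 3 *
      norm (1 / (1 - chi p * of_nat p powr (-Complex (1 + x) t))) ^ 4 *
      norm (1 / (1 - chi p * chi p * of_nat p powr (-Complex (1 + x) (2 * t)))))" for N
    by (rule prod_ge_1) (use local in auto)
  then show "\<exists>N. \<forall>n\<ge>N. 1 \<le> norm (P (\<lambda>_. 1) (Complex (1 + x) 0) n) ^ 3 * norm (P chi (Complex (1 + x) t) n) ^ 4 *
      norm (P (\<lambda>n. chi n * chi n) (Complex (1 + x) (2 * t)) n)"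
    unfolding P_def prod_norm[symmetric] prod_power_distrib prod.distrib[symmetric] by blast
qed

text \<open>A zero at 1 + it would make the product in \<open>norm_L_341\<close> of order x^(-3) x^4
  = x as x tends to 0, although it is at least 1. The third factor stays bounded because 1 + 2it is
  no pole: either \<open>t \<noteq> 0\<close>, or the square of the character is not principal and
  its mean \<open>c\<close> is 0.\<close>

lemma dirichlet_L_nonzero_line:
  assumes chi: "dirichlet_char q chi" "\<not> principal_char q chi" and q: "q > 0"
    and t: "t \<noteq> 0 \<or> \<not> principal_char q (\<lambda>n. chi n * chi n)"
  shows "dirichlet_L chi (Complex 1 t) \<noteq> 0"
proof
  assume zero: "dirichlet_L chi (Complex 1 t) = 0"
  have chi2: "dirichlet_char q (\<lambda>n. chi n * chi n)" by (rule dirichlet_char_prod[OF chi(1) chi(1)])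
  define c where "c = (\<Sum>n<q. chi n * chi n) / of_nat q"
  have ct: "c = 0 \<or> t \<noteq> 0"
    using t sum_dirichlet_char[OF chi2 _ q] by (auto simp: c_def)
  have "\<exists>K. \<forall>s. Re s > 1 \<longrightarrow> norm (dirichlet_L (\<lambda>_. 1) s - ((\<Sum>n<1::nat. 1) / of_nat 1) / (s - 1)) \<le> K * norm s"
    unfolding dirichlet_L_altdef using periodic_dirichlet_series_near_pole[of "\<lambda>_. 1" 1] by simp
  then obtain K1 where K1: "\<And>s. Re s > 1 \<Longrightarrow> norm (dirichlet_L (\<lambda>_. 1) s - 1 / (s - 1)) \<le> K1 * norm s"
    by auto
  have "\<exists>K. \<forall>s. Re s > 1 \<longrightarrow> norm (dirichlet_L (\<lambda>n. chi n * chi n) s - c / (s - 1)) \<le> K * norm s"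
    unfolding dirichlet_L_altdef c_def
  proof (rule periodic_dirichlet_series_near_pole[OF _ q norm_dirichlet_char_le[OF chi2 q]])
    show "chi (n + q) * chi (n + q) = chi n * chi n" for n
      using chi(1) by (simp add: dirichlet_char_def)
  qed
  then obtain K2 where K2: "\<And>s. Re s > 1 \<Longrightarrow> norm (dirichlet_L (\<lambda>n. chi n * chi n) s - c / (s - 1)) \<le> K2 * norm s"
    by blast
  have K1': "K1 \<ge> 0" using order_trans[OF norm_ge_zero K1[of 2]] by simp
  have K2': "K2 \<ge> 0" using order_trans[OF norm_ge_zero K2[of 2]] by simp
  have b1: "norm (dirichlet_L (\<lambda>_. 1) (Complex (1 + x) 0)) \<le> (1 + 2 * K1) / x" if "0 < x" "x < 1" for x
  proof -
    have "Complex (1 + x) 0 - 1 = of_real x" "norm (Complex (1 + x) 0) = 1 + x"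
      using that by (auto simp: complex_eq_iff cmod_def)
    then have "norm (dirichlet_L (\<lambda>_. 1) (Complex (1 + x) 0) - 1 / of_real x) \<le> K1 * (1 + x)"
      using K1[of "Complex (1 + x) 0"] that by simp
    moreover have "norm (1 / of_real x :: complex) = 1 / x" using that by (simp add: norm_divide)
    ultimately have "norm (dirichlet_L (\<lambda>_. 1) (Complex (1 + x) 0)) \<le> K1 * (1 + x) + 1 / x"
      using norm_triangle_sub[of "dirichlet_L (\<lambda>_. 1) (Complex (1 + x) 0)" "1 / of_real x"] by linarith
    also have "1 + x \<le> 2 / x"
      using that mult_mono[of "1 + x" 2 x 1] by (simp add: field_simps)
    then have "K1 * (1 + x) + 1 / x \<le> K1 * (2 / x) + 1 / x"
      using K1' by (intro add_right_mono mult_left_mono)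
    finally show ?thesis by (simp add: add_divide_distrib mult.commute)
  qed
  \<comment> \<open>For \<open>t = 0\<close> the second summand is a division by zero with value 0,
    which is the right bound because \<open>c = 0\<close> in that case.\<close>
  define M where "M = K2 * (2 + 2 * \<bar>t\<bar>) + norm c / (2 * \<bar>t\<bar>)"
  have b2: "norm (dirichlet_L (\<lambda>n. chi n * chi n) (Complex (1 + x) (2 * t))) \<le> M" if "0 < x" "x < 1" for x
  proof -
    have "norm (Complex (1 + x) (2 * t)) \<le> (1 + x) + 2 * \<bar>t\<bar>"
      using cmod_le[of "Complex (1 + x) (2 * t)"] that by (simp add: abs_mult)
    then have "norm (dirichlet_L (\<lambda>n. chi n * chi n) (Complex (1 + x) (2 * t)) - c / (Complex (1 + x) (2 * t) - 1)) \<le> K2 * (2 + 2 * \<bar>t\<bar>)"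
      using K2[of "Complex (1 + x) (2 * t)"] K2' that mult_left_mono[of "norm (Complex (1 + x) (2 * t))" "2 + 2 * \<bar>t\<bar>" K2] by simp
    moreover have "norm (c / (Complex (1 + x) (2 * t) - 1)) \<le> norm c / (2 * \<bar>t\<bar>)"
    proof (cases "t = 0")
      case False
      have "2 * \<bar>t\<bar> \<le> norm (Complex (1 + x) (2 * t) - 1)"
        using abs_Im_le_cmod[of "Complex (1 + x) (2 * t) - 1"] by (simp add: abs_mult)
      then show ?thesis unfolding norm_divide using False by (intro divide_left_mono mult_pos_pos) auto
    qed (use ct in auto)
    ultimately show ?thesis unfolding M_def
      using norm_triangle_sub[of "dirichlet_L (\<lambda>n. chi n * chi n) (Complex (1 + x) (2 * t))"
          "c / (Complex (1 + x) (2 * t) - 1)"] by linarith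
  qed
  have M0: "M \<ge> 0" using order_trans[OF norm_ge_zero b2[of "1/2"]] by simp
  have "dirichlet_L chi field_differentiable at (Complex 1 t)"
    using dirichlet_L_by_parts(4)[OF chi q] open_halfspace_Re_gt[of 0]
    by (auto simp: holomorphic_on_open field_differentiable_def)
  then obtain D where "(dirichlet_L chi has_field_derivative D) (at (Complex 1 t))"
    by (auto simp: field_differentiable_def)
  then have "(\<lambda>h. dirichlet_L chi (Complex 1 t + h) / h) \<midarrow>0\<rightarrow> D"
    using zero by (simp add: DERIV_def)
  from LIM_D[OF this zero_less_one] obtain d where d: "d > 0" "\<And>h. h \<noteq> 0 \<Longrightarrow> norm h < d \<Longrightarrow> norm (dirichlet_L chi (Complex 1 t + h) / h - D) < 1"
    by (metis diff_zero)
  define K where "K = norm D + 1"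
  have b3: "norm (dirichlet_L chi (Complex (1 + x) t)) \<le> K * x" if "0 < x" "x < d" for x
  proof -
    have "norm (dirichlet_L chi (Complex 1 t + of_real x) / of_real x - D) < 1"
      using d(2)[of "of_real x"] that by simp
    also have "Complex 1 t + of_real x = Complex (1 + x) t" by (simp add: complex_eq_iff)
    finally have "norm (dirichlet_L chi (Complex (1 + x) t) / of_real x) \<le> K"
      unfolding K_def
      using norm_triangle_sub[of "dirichlet_L chi (Complex (1 + x) t) / of_real x" D] by linarith
    then show ?thesis using that by (simp add: norm_divide field_simps)
  qed
  define G where "G = (1 + 2 * K1) ^ 3 * K ^ 4 * M"
  have G0: "G \<ge> 0" unfolding G_def K_def using K1' M0 by simp
  have "1 \<le> G * x" if x: "0 < x" "x < min 1 d" for x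
  proof -
    have "1 \<le> norm (dirichlet_L (\<lambda>_. 1) (Complex (1 + x) 0)) ^ 3 * norm (dirichlet_L chi (Complex (1 + x) t)) ^ 4 *
         norm (dirichlet_L (\<lambda>n. chi n * chi n) (Complex (1 + x) (2 * t)))"
      by (rule norm_L_341[OF chi(1) q]) (use x in simp)
    also have "\<dots> \<le> ((1 + 2 * K1) / x) ^ 3 * (K * x) ^ 4 * M"
      using x M0 K1' by (intro mult_mono power_mono b1 b2 b3 mult_nonneg_nonneg zero_le_power norm_ge_zero) (auto simp: K_def)
    also have "\<dots> = G * x" using x by (simp add: G_def field_simps power3_eq_cube power4_eq_xxxx)
    finally show ?thesis .
  qed
  \<comment> \<open>Small enough for the estimates above, and such that \<open>G * x\<close> is at
    most G / (2 (G + 1)) < 1.\<close>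
  moreover define x where "x = min (min 1 d / 2) (1 / (2 * (G + 1)))"
  moreover have "0 < x" using d(1) G0 by (simp add: x_def)
  moreover have "x < min 1 d"
  proof -
    have "x \<le> min 1 d / 2" unfolding x_def by (rule min.cobounded1)
    also have "\<dots> < min 1 d" using d(1) by auto
    finally show ?thesis .
  qed
  ultimately have "1 \<le> G * x" by blast
  also have "\<dots> \<le> G * (1 / (2 * (G + 1)))" unfolding x_def using G0 by (intro mult_left_mono) auto
  also have "\<dots> < 1" using G0 by (simp add: field_simps)
  finally show False by simp
qed

text \<open>Monsky's argument for real \<open>\<chi>\<close>: if \<open>L(1,\<chi>) = 0\<close>, then the Lambert series
  \<open>\<Sum>n. \<chi>(n) t\<^sup>n / (1 - t\<^sup>n)\<close> stays bounded as \<open>t\<close> tends to 1, since subtracting a multiple of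
  \<open>L(1,\<chi>)\<close> makes the weights monotone. But as a power series it has nonnegative coefficients
  which are at least 1 at the squares.\<close>

lemma sum_divisors_prime_power_mult:
  fixes c :: "nat \<Rightarrow> real"
  assumes p: "prime p" "\<not> p dvd m" and m: "m > 0" and c: "\<And>a b. c (a * b) = c a * c b" "c 1 = 1"
  shows "(\<Sum>d | d dvd p ^ a * m. c d) = (\<Sum>i\<le>a. c p ^ i) * (\<Sum>d | d dvd m. c d)"
proof -
  have p0: "p > 0" using prime_gt_0_nat[OF p(1)] .
  have cp: "c (p ^ i) = c p ^ i" for i using c by (induction i) auto
  have "(\<Sum>d | d dvd p ^ a * m. c d) = (\<Sum>(i, d)\<in>{..a} \<times> {d. d dvd m}. c (p ^ i * d))"
  proof (rule sum.reindex_bij_witness[where i = "\<lambda>(i, d). p ^ i * d"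
        and j = "\<lambda>d. (multiplicity p d, d div p ^ multiplicity p d)"])
    fix d assume "d \<in> {d. d dvd p ^ a * m}"
    then have d: "d dvd p ^ a * m" by simp
    then have d0: "d > 0" using p0 m by (metis dvd_pos_nat nat_0_less_mult_iff zero_less_power)
    define e where "e = d div p ^ multiplicity p d"
    have de: "d = p ^ multiplicity p d * e" by (simp add: e_def multiplicity_dvd)
    have "multiplicity p d \<le> multiplicity p (p ^ a * m)"
      using d p0 m by (intro dvd_imp_multiplicity_le) auto
    also have "\<dots> = a"
      using p m by (simp add: prime_elem_multiplicity_mult_distrib not_dvd_imp_multiplicity_0)
    finally have le: "multiplicity p d \<le> a" .
    have "\<not> p dvd e" unfolding e_def using d0 p(1) by (intro multiplicity_decompose) auto
    then have "coprime e (p ^ a)" using p(1) by (metis coprime_commute coprime_power_right_iff prime_imp_coprime)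
    moreover have "e dvd p ^ a * m" using d de by (metis dvd_mult_right)
    ultimately have "e dvd m" by (simp add: coprime_dvd_mult_right_iff)
    then show "(\<lambda>d. (multiplicity p d, d div p ^ multiplicity p d)) d \<in> {..a} \<times> {d. d dvd m}"
      using le by (simp add: e_def)
    show "(\<lambda>(i, d). p ^ i * d) ((\<lambda>d. (multiplicity p d, d div p ^ multiplicity p d)) d) = d"
      by (simp add: multiplicity_dvd)
    show "(case (multiplicity p d, d div p ^ multiplicity p d) of (i, d) \<Rightarrow> c (p ^ i * d)) = c d"
      by (simp add: multiplicity_dvd)
  next
    fix x assume "x \<in> {..a} \<times> {d. d dvd m}"
    then obtain i d where x: "x = (i, d)" "i \<le> a" "d dvd m" by auto
    then have "d > 0" "\<not> p dvd d" using m p dvd_trans by (auto intro: dvd_pos_nat)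
    then have "multiplicity p (p ^ i * d) = i"
      using p by (simp add: prime_elem_multiplicity_mult_distrib not_dvd_imp_multiplicity_0)
    then show "(\<lambda>d. (multiplicity p d, d div p ^ multiplicity p d)) ((\<lambda>(i, d). p ^ i * d) x) = x"
      using x p0 by simp
    show "(\<lambda>(i, d). p ^ i * d) x \<in> {d. d dvd p ^ a * m}"
      using x by (auto intro!: mult_dvd_mono le_imp_power_dvd)
  qed
  also have "\<dots> = (\<Sum>i\<le>a. \<Sum>d | d dvd m. c p ^ i * c d)"
    by (simp add: sum.cartesian_product c cp)
  finally show ?thesis by (simp add: sum_product)
qed

text \<open>The sum is \<open>a + 1\<close> at 1, it is 1 at 0, and at -1 it alternates between 1
  and 0. This gives both the nonnegativity of the divisor sums and their lower bound at
  squares.\<close>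

lemma sum_powers_real_char:
  fixes x :: real
  assumes "x \<in> {0, 1, -1}"
  shows "(\<Sum>i\<le>a. x ^ i) \<ge> 0" "even a \<Longrightarrow> (\<Sum>i\<le>a. x ^ i) \<ge> 1"
proof -
  have "(\<Sum>i\<le>a. (-1) ^ i :: real) = of_bool (even a)" by (induction a) auto
  moreover have "(\<Sum>i\<le>a. 0 ^ i :: real) = 1" by (induction a) auto
  ultimately show "(\<Sum>i\<le>a. x ^ i) \<ge> 0" "even a \<Longrightarrow> (\<Sum>i\<le>a. x ^ i) \<ge> 1"
    using assms by auto
qed

lemma sum_divisors_real_char_nonneg:
  fixes c :: "nat \<Rightarrow> real"
  assumes c: "\<And>a b. c (a * b) = c a * c b" "c 1 = 1" "\<And>n. c n \<in> {0, 1, -1}" and "m > 0"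
  shows "(\<Sum>d | d dvd m. c d) \<ge> 0"
  using \<open>m > 0\<close>
proof (induction m rule: less_induct)
  case (less m)
  show ?case
  proof (cases "m = 1")
    case False
    then obtain p where p: "prime p" "p dvd m" using prime_factor_nat by blast
    obtain k where k: "m = p ^ multiplicity p m * k" "\<not> p dvd k"
      using multiplicity_decompose'[of m p] less.prems p(1) by (metis not_prime_unit not_gr0)
    have "k > 0" using k(1) less.prems by (metis gr0I mult_0_right)
    have "k \<noteq> m" using k(2) p(2) by auto
    moreover have "k \<le> m" using k(1) less.prems by (metis dvd_imp_le dvd_triv_right)
    ultimately have "(\<Sum>d | d dvd k. c d) \<ge> 0" using less.IH \<open>k > 0\<close> by simp
    then show ?thesis
      by (subst k(1), subst sum_divisors_prime_power_mult[OF p(1) k(2) \<open>k > 0\<close> c(1,2)])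
         (intro mult_nonneg_nonneg sum_powers_real_char c)
  qed (use c in simp)
qed

text \<open>In a square every prime has even exponent, so by multiplicativity the divisor sum is a
  product of local sums that are all at least 1.\<close>

lemma sum_divisors_real_char_square:
  fixes c :: "nat \<Rightarrow> real"
  assumes c: "\<And>a b. c (a * b) = c a * c b" "c 1 = 1" "\<And>n. c n \<in> {0, 1, -1}" and "m > 0"
  shows "(\<Sum>d | d dvd m ^ 2. c d) \<ge> 1"
  using \<open>m > 0\<close>
proof (induction m rule: less_induct)
  case (less m)
  show ?case
  proof (cases "m = 1")
    case False
    then obtain p where p: "prime p" "p dvd m" using prime_factor_nat by blast
    obtain k where k: "m = p ^ multiplicity p m * k" "\<not> p dvd k"
      using multiplicity_decompose'[of m p] less.prems p(1) by (metis not_prime_unit not_gr0)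
    have "k > 0" using k(1) less.prems by (metis gr0I mult_0_right)
    have "k \<noteq> m" using k(2) p(2) by auto
    moreover have "k \<le> m" using k(1) less.prems by (metis dvd_imp_le dvd_triv_right)
    ultimately have 1: "(\<Sum>d | d dvd k ^ 2. c d) \<ge> 1" using less.IH \<open>k > 0\<close> by simp
    have k2: "\<not> p dvd k ^ 2" "k ^ 2 > 0" using k(2) p(1) \<open>k > 0\<close> prime_dvd_power by auto
    have m2: "m ^ 2 = p ^ (2 * multiplicity p m) * k ^ 2"
      using k(1) by (metis power_mult_distrib power_mult mult.commute)
    have "(\<Sum>i\<le>2 * multiplicity p m. c p ^ i) \<ge> 1" by (intro sum_powers_real_char c) simp
    then show ?thesis unfolding m2 sum_divisors_prime_power_mult[OF p(1) k2 c(1,2)]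
      using 1 mult_mono[of 1 _ 1] by fastforce
  qed (use c in simp)
qed

text \<open>The Lambert weight is subtracted from 1 / (n (1 - t)), which cancels its simple pole at
  t = 1. Summed against the character, the first part gives L(1,chi) / (1 - t), which is 0 under the
  assumption to be refuted.\<close>

definition monsky :: "real \<Rightarrow> nat \<Rightarrow> real" where
  "monsky t n = 1 / (real n * (1 - t)) - t ^ n / (1 - t ^ n)"

text \<open>The arithmetic-geometric mean inequality for the terms \<open>i\<close> and
  \<open>n - 1 - i\<close>, whose geometric mean is \<open>u ^ (n - 1)\<close> for every
  \<open>i\<close>. Writing the ratio as a square avoids half-integral exponents.\<close>

lemma geometric_sum_ge:
  fixes u :: real
  assumes "0 \<le> u"
  shows "real n * u ^ (n - 1) \<le> (\<Sum>i<n. (u\<^sup>2) ^ i)"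
proof -
  have "(\<Sum>i<n. (u\<^sup>2) ^ (n - Suc i)) = (\<Sum>i<n. (u\<^sup>2) ^ i)"
    by (rule sum.nat_diff_reindex)
  then have "2 * (\<Sum>i<n. (u\<^sup>2) ^ i) = (\<Sum>i<n. (u\<^sup>2) ^ i + (u\<^sup>2) ^ (n - Suc i))"
    by (simp add: sum.distrib)
  also have "\<dots> \<ge> (\<Sum>i<n. 2 * u ^ (n - 1))"
  proof (rule sum_mono)
    fix i assume "i \<in> {..<n}"
    then have "u ^ (n - 1) = u ^ i * u ^ (n - Suc i)"
      by (simp flip: power_add)
    moreover have "2 * (u ^ i * u ^ (n - Suc i)) \<le> (u ^ i)\<^sup>2 + (u ^ (n - Suc i))\<^sup>2"
      using sum_squares_bound[of "u ^ i" "u ^ (n - Suc i)"] by simp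
    ultimately show "2 * u ^ (n - 1) \<le> (u\<^sup>2) ^ i + (u\<^sup>2) ^ (n - Suc i)"
      by (simp add: power_mult[symmetric] mult.commute)
  qed
  finally show ?thesis by simp
qed

text \<open>After clearing denominators the claim is n (n + 1) t^n (1 - t)^2 \<le> (1 - t^n) (1 -
  t^(n+1)). Dividing by (1 - t)^2 leaves a product of two geometric sums, and
  \<open>geometric_sum_ge\<close> bounds it below by n (n + 1) t^(n - 1/2).\<close>

lemma monsky_antimono:
  assumes t: "0 < t" "t < 1" and n: "n \<ge> 1"
  shows "monsky t (Suc n) \<le> monsky t n"
proof -
  define u where "u = sqrt t"
  have u: "0 < u" "u < 1" "u\<^sup>2 = t" using t by (auto simp: u_def)
  define A B where "A = 1 - t ^ n" and "B = 1 - t ^ Suc n"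
  have AB: "A > 0" "B > 0" using t n by (auto simp: A_def B_def power_less_one_iff simp del: power_Suc)
  have A: "A = (1 - t) * (\<Sum>i<n. t ^ i)" unfolding A_def by (rule one_diff_power_eq)
  have B: "B = (1 - t) * (\<Sum>i<Suc n. t ^ i)" unfolding B_def by (rule one_diff_power_eq)
  have "real n * real (Suc n) * t ^ n = (real n * real (Suc n)) * u ^ (2 * n)"
    using u by (simp add: power_mult)
  also have "\<dots> \<le> (real n * real (Suc n)) * u ^ ((n - 1) + n)"
    using u by (intro mult_left_mono power_decreasing) auto
  also have "\<dots> = (real n * u ^ (n - 1)) * (real (Suc n) * u ^ (Suc n - 1))"
    by (simp add: power_add)
  also have "\<dots> \<le> (\<Sum>i<n. t ^ i) * (\<Sum>i<Suc n. t ^ i)"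
    using geometric_sum_ge[of u n] geometric_sum_ge[of u "Suc n"] u t
    by (intro mult_mono) (auto intro!: sum_nonneg)
  finally have "(1 - t)\<^sup>2 * (real n * real (Suc n) * t ^ n) \<le> (1 - t)\<^sup>2 * ((\<Sum>i<n. t ^ i) * (\<Sum>i<Suc n. t ^ i))"
    by (intro mult_left_mono) auto
  also have "\<dots> = A * B" unfolding A B by (simp add: power2_eq_square mult_ac)
  finally have key: "(1 - t)\<^sup>2 * (real n * real (Suc n) * t ^ n) \<le> A * B" .
  have "t ^ n / A - t ^ Suc n / B = t ^ n * (1 - t) / (A * B)"
    using AB by (simp add: diff_frac_eq) (simp add: A_def B_def algebra_simps)
  also have "\<dots> \<le> 1 / (real n * real (Suc n) * (1 - t))"
  proof -
    have "(t ^ n * (1 - t)) * (real n * real (Suc n) * (1 - t)) \<le> 1 * (A * B)"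
      using key by (simp add: power2_eq_square mult_ac)
    then show ?thesis using AB t n by (subst frac_le_eq[THEN iffD2] | simp add: divide_simps mult_ac)+
  qed
  also have "\<dots> = 1 / (real n * (1 - t)) - 1 / (real (Suc n) * (1 - t))"
    using t n by (simp add: divide_simps) (simp add: algebra_simps)?
  finally show ?thesis by (simp add: monsky_def A_def B_def)
qed

lemma monsky_nonneg:
  assumes t: "0 < t" "t < 1" and n: "n \<ge> 1"
  shows "monsky t n \<ge> 0"
proof -
  have "real n * t ^ n \<le> (\<Sum>i<n. t ^ i)"
  proof -
    have "(\<Sum>i<n. t ^ n) \<le> (\<Sum>i<n. t ^ i)"
      using t by (intro sum_mono power_decreasing) auto
    then show ?thesis by simp
  qed
  then have "(1 - t) * (real n * t ^ n) \<le> 1 - t ^ n"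
    unfolding one_diff_power_eq[of t n] using t by (intro mult_left_mono) auto
  moreover have "1 - t ^ n > 0" using t n by (simp add: power_less_one_iff)
  moreover have "real n * (1 - t) > 0" using t n by simp
  ultimately have "t ^ n / (1 - t ^ n) \<le> 1 / (real n * (1 - t))"
    by (subst pos_divide_le_eq) (simp_all add: pos_le_divide_eq mult_ac)
  then show ?thesis by (simp add: monsky_def)
qed

text \<open>Expanding each t^n / (1 - t^n) as a geometric series and collecting the terms with
  exponent m gives the power series with coefficients the divisor sums \<open>r m\<close>. These are
  nonnegative, so dropping all exponents but finitely many squares can only decrease the
  sum.\<close>

lemma lambert_sum_ge:
  fixes c :: "nat \<Rightarrow> real"
  assumes c: "\<And>a b. c (a * b) = c a * c b" "c 1 = 1" "\<And>n. c n \<in> {0, 1, -1}" and t: "0 < t" "t < 1"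
  shows "\<exists>F. (\<lambda>n. c (Suc n) * (t ^ Suc n / (1 - t ^ Suc n))) sums F \<and> (\<Sum>j=1..J. t ^ (j ^ 2)) \<le> F"
proof -
  define G where "G = (\<lambda>(n, k). c (Suc n) * t ^ (Suc n * Suc k))"
  \<comment> \<open>A majorant for \<open>G\<close>, since (n + 1) (k + 1) \<ge> n + k.\<close>
  have "(\<lambda>(n::nat, k::nat). t ^ n * t ^ k) summable_on UNIV \<times> UNIV"
  proof (rule summable_on_SigmaI)
    have geo: "((\<lambda>k. t ^ k) has_sum 1 / (1 - t)) UNIV"
      using t by (intro norm_summable_imp_has_sum geometric_sums) (auto simp: summable_geometric)
    show "((\<lambda>k. case (n, k) of (n, k) \<Rightarrow> t ^ n * t ^ k) has_sum t ^ n * (1 / (1 - t))) UNIV" for n :: nat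
      using has_sum_cmult_right[OF geo] by simp
    show "(\<lambda>n. t ^ n * (1 / (1 - t))) summable_on (UNIV :: nat set)"
      using has_sum_cmult_left[OF geo] has_sum_imp_summable by blast
  qed (use t in auto)
  then have "(\<lambda>x. norm (G x)) summable_on UNIV \<times> UNIV"
  proof (rule Infinite_Sum.abs_summable_on_comparison_test')
    fix x :: "nat \<times> nat"
    obtain n k where x: "x = (n, k)" by force
    have "norm (G x) \<le> t ^ (Suc n * Suc k)"
      using c(3)[of "Suc n"] t by (auto simp: G_def x abs_mult simp del: power_Suc)
    also have "\<dots> \<le> t ^ (n + k)" using t by (intro power_decreasing) auto
    finally show "norm (G x) \<le> (case x of (n, k) \<Rightarrow> t ^ n * t ^ k)" by (simp add: x power_add)
  qed
  then have sG: "G summable_on UNIV \<times> UNIV" by (rule abs_summable_summable)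
  define F where "F = infsum G (UNIV \<times> UNIV)"
  have hG: "(G has_sum F) (UNIV \<times> UNIV)" using sG by (simp add: F_def)
  have inner: "((\<lambda>k. G (n, k)) has_sum c (Suc n) * (t ^ Suc n / (1 - t ^ Suc n))) UNIV" for n
  proof -
    define x where "x = t ^ Suc n"
    have x: "0 < x" "x < 1" using t by (auto simp: x_def power_less_one_iff simp del: power_Suc)
    have "((\<lambda>k. x ^ k) has_sum 1 / (1 - x)) UNIV"
      using x by (intro norm_summable_imp_has_sum geometric_sums) (auto simp: summable_geometric)
    then have "((\<lambda>k. c (Suc n) * x * x ^ k) has_sum c (Suc n) * x * (1 / (1 - x))) UNIV"
      by (rule has_sum_cmult_right)
    then show ?thesis by (simp add: G_def x_def power_mult[symmetric] power_add[symmetric] mult.assoc flip: power_Suc)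
  qed
  have "((\<lambda>n. c (Suc n) * (t ^ Suc n / (1 - t ^ Suc n))) has_sum F) UNIV"
    by (rule has_sum_SigmaD[OF hG inner])
  then have sums: "(\<lambda>n. c (Suc n) * (t ^ Suc n / (1 - t ^ Suc n))) sums F" by (rule has_sum_imp_sums)
  define H where "H = (\<lambda>(m, d). c d * t ^ m)"
  \<comment> \<open>The pair \<open>(n, k)\<close> corresponds to the exponent m = (n + 1) (k + 1)
    together with its divisor n + 1.\<close>
  have "(H has_sum F) (Sigma {1..} (\<lambda>m. {d. d dvd m})) \<longleftrightarrow> (G has_sum F) (UNIV \<times> UNIV)"
    by (rule has_sum_reindex_bij_witness[where i = "\<lambda>(n, k). (Suc n * Suc k, Suc n)"
          and j = "\<lambda>(m, d). (d - 1, m div d - 1)"])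
       (auto simp: H_def G_def dvd_def simp del: power_Suc mult_Suc mult_Suc_right)
  with hG have hH: "(H has_sum F) (Sigma {1..} (\<lambda>m. {d. d dvd m}))" by blast
  define r where "r m = (\<Sum>d | d dvd m. c d)" for m
  have H1: "((\<lambda>m. r m * t ^ m) has_sum F) {1..}"
  proof (rule has_sum_SigmaD[OF hH])
    show "((\<lambda>d. H (m, d)) has_sum r m * t ^ m) {d. d dvd m}" if "m \<in> {1..}" for m
      using that by (intro has_sum_finiteI) (auto simp: H_def r_def sum_distrib_right)
  qed
  have H2: "((\<lambda>m. r m * t ^ m) has_sum (\<Sum>j=1..J. r (j ^ 2) * t ^ (j ^ 2))) ((\<lambda>j. j ^ 2) ` {1..J})"
    by (intro has_sum_finiteI) (auto simp: sum.reindex inj_on_def)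
  have "(\<Sum>j=1..J. r (j ^ 2) * t ^ (j ^ 2)) \<le> F"
    by (rule has_sum_mono2[OF H2 H1])
       (use t c in \<open>auto simp: r_def intro!: mult_nonneg_nonneg sum_divisors_real_char_nonneg\<close>)
  moreover have "(\<Sum>j=1..J. t ^ (j ^ 2)) \<le> (\<Sum>j=1..J. r (j ^ 2) * t ^ (j ^ 2))"
  proof (rule sum_mono)
    fix j assume "j \<in> {1..J}"
    then have "r (j ^ 2) \<ge> 1" unfolding r_def by (intro sum_divisors_real_char_square c) auto
    then show "t ^ (j ^ 2) \<le> r (j ^ 2) * t ^ (j ^ 2)" using t mult_right_mono[of 1 "r (j ^ 2)" "t ^ (j ^ 2)"] by simp
  qed
  ultimately show ?thesis using sums by (intro exI[of _ F]) auto
qed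

lemma real_char_L1_nonzero:
  assumes chi: "dirichlet_char q chi" "\<not> principal_char q chi" and q: "q > 0"
    and chi2: "principal_char q (\<lambda>n. chi n * chi n)"
  shows "dirichlet_L chi 1 \<noteq> 0"
proof
  assume zero: "dirichlet_L chi 1 = 0"
  define c where "c n = Re (chi n)" for n
  have val: "chi n = 0 \<or> chi n = 1 \<or> chi n = -1" for n
  proof (cases "coprime n q")
    case True
    then have "chi n * chi n = 1" using chi2 by (auto simp: principal_char_def)
    then show ?thesis by (metis square_eq_1_iff)
  qed (use dirichlet_char_eq_0[OF chi(1)] in auto)
  have c3: "c n \<in> {0, 1, -1}" for n using val[of n] by (auto simp: c_def)
  have cc: "chi n = of_real (c n)" for n using val[of n] by (auto simp: c_def)
  have c1: "c (a * b) = c a * c b" for a b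
    using dirichlet_char_mult[OF chi(1), of a b] unfolding cc by (metis of_real_eq_iff of_real_mult)
  have c2: "c 1 = 1" using dirichlet_char_1[OF chi(1)] by (simp add: c_def)
  have B: "\<bar>\<Sum>i<n. c (Suc i)\<bar> \<le> real q" for n
  proof -
    have "norm (\<Sum>i<n. chi (Suc i)) \<le> real q * 1"
      using bounded_sums_periodic[of chi q 1 n] sum_dirichlet_char[OF chi q] norm_dirichlet_char_le[OF chi(1) q]
        chi(1) q by (auto simp: dirichlet_char_def)
    also have "(\<Sum>i<n. chi (Suc i)) = of_real (\<Sum>i<n. c (Suc i))" by (simp add: cc)
    finally show ?thesis by (simp only: norm_of_real mult_1_right)
  qed
  have "(\<lambda>n. chi (Suc n) * of_nat (Suc n) powr (-1)) sums 0"
    using dirichlet_L_by_parts(3)[OF chi q, of 1] zero by simp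
  then have "(\<lambda>n. Re (chi (Suc n) * of_nat (Suc n) powr (-1))) sums Re 0" by (rule sums_Re)
  moreover have "Re (chi (Suc n) * of_nat (Suc n) powr (-1)) = c (Suc n) / real (Suc n)" for n
    using powr_of_real[of "real (Suc n)" "-1"]
    by (simp add: cc powr_minus_divide del: of_nat_Suc)
  ultimately have zero': "(\<lambda>n. c (Suc n) / real (Suc n)) sums 0" by simp
  \<comment> \<open>With this \<open>t\<close>, Bernoulli's inequality gives t^(j^2) \<ge> 1 - J^2 /
    (2 J^3) = 1 - 1 / (2 J) for all j \<le> J, so the \<open>J = q + 1\<close> squares contribute at
    least q + 1/2. This exceeds the upper bound \<open>q\<close> from partial summation.\<close>
  define J where "J = q + 1"
  define t where "t = 1 - 1 / (2 * real J ^ 3)"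
  have "J > 0" and J: "real J \<ge> 1" by (simp_all add: J_def)
  have J3: "real J ^ 3 \<ge> 1" using J by (rule one_le_power)
  have "1 / (2 * real J ^ 3) \<le> 1 / 2" using J3 \<open>J > 0\<close> by (intro divide_left_mono) auto
  moreover have "1 / (2 * real J ^ 3) > 0" using J3 by (intro divide_pos_pos) linarith+
  ultimately have t: "0 < t" "t < 1" unfolding t_def by linarith+
  obtain F where F: "(\<lambda>n. c (Suc n) * (t ^ Suc n / (1 - t ^ Suc n))) sums F" "(\<Sum>j=1..J. t ^ (j ^ 2)) \<le> F"
    using lambert_sum_ge[of c t J, OF c1 c2 c3 t] by auto
  have "(\<lambda>n. c (Suc n) / real (Suc n) * (1 / (1 - t)) - c (Suc n) * (t ^ Suc n / (1 - t ^ Suc n))) sums (0 * (1 / (1 - t)) - F)"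
    by (intro sums_diff sums_mult2 zero' F(1))
  also have "(\<lambda>n. c (Suc n) / real (Suc n) * (1 / (1 - t)) - c (Suc n) * (t ^ Suc n / (1 - t ^ Suc n))) =
     (\<lambda>n. c (Suc n) * monsky t (Suc n))"
    by (simp add: monsky_def fun_eq_iff right_diff_distrib)
  finally have M: "(\<lambda>N. \<Sum>n<N. c (Suc n) * monsky t (Suc n)) \<longlonglongrightarrow> -F" by (simp add: sums_def)
  \<comment> \<open>As the weights decrease and stay nonnegative, Abel summation bounds everything
    by \<open>q\<close> times the first weight \<open>monsky t 1\<close>, which is 1 for every
    \<open>t\<close>.\<close>
  have "\<bar>\<Sum>n<N. c (Suc n) * monsky t (Suc n)\<bar> \<le> real q" for N
  proof -
    have "\<bar>\<Sum>n<N. c (Suc n) * monsky t (Suc n)\<bar> \<le> \<bar>(\<Sum>n<N. c (Suc n)) * monsky t (Suc N)\<bar> +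
        (\<Sum>n<N. \<bar>(\<Sum>i\<le>n. c (Suc i)) * (monsky t (Suc n) - monsky t (Suc (Suc n)))\<bar>)"
      unfolding summation_by_parts_lessThan[of "\<lambda>n. c (Suc n)" "\<lambda>n. monsky t (Suc n)"]
      by (intro order_trans[OF abs_triangle_ineq] add_left_mono sum_abs)
    also have "\<dots> \<le> real q * monsky t (Suc N) + (\<Sum>n<N. real q * (monsky t (Suc n) - monsky t (Suc (Suc n))))"
      unfolding abs_mult
    proof (intro add_mono mult_mono sum_mono)
      show "\<bar>\<Sum>i\<le>n. c (Suc i)\<bar> \<le> real q" for n using B[of "Suc n"] by (simp add: lessThan_Suc_atMost)
      show "\<bar>monsky t (Suc n) - monsky t (Suc (Suc n))\<bar> \<le> monsky t (Suc n) - monsky t (Suc (Suc n))" for n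
        using monsky_antimono[OF t, of "Suc n"] by simp
    qed (use B monsky_nonneg[OF t] in auto)
    also have "\<dots> = real q * monsky t 1"
      using sum_lessThan_telescope'[of "\<lambda>n. monsky t (Suc n)" N]
      by (simp only: sum_distrib_left[symmetric]) (simp add: right_diff_distrib)
    also have "monsky t 1 = 1" using t by (simp add: monsky_def diff_divide_distrib[symmetric])
    finally show ?thesis by simp
  qed
  then have "\<bar>-F\<bar> \<le> real q"
    using tendsto_rabs[OF M] by (intro LIMSEQ_le_const2[of _ "\<bar>-F\<bar>"]) auto
  then have "F \<le> real q" by simp
  moreover have "(\<Sum>j=1..J. t ^ (j ^ 2)) \<ge> real q + 1 / 2"
  proof -
    have "real J - 1 / 2 = (\<Sum>j=1..J. 1 - real (J ^ 2) * (1 / (2 * real J ^ 3)))"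
      using J by (simp add: field_simps power2_eq_square power3_eq_cube)
    also have "\<dots> \<le> (\<Sum>j=1..J. t ^ (j ^ 2))"
    proof (rule sum_mono)
      fix j assume "j \<in> {1..J}"
      have "1 - real (J ^ 2) * (1 / (2 * real J ^ 3)) \<le> t ^ (J ^ 2)"
        using Bernoulli_inequality[of "- (1 / (2 * real J ^ 3))" "J ^ 2"] t by (simp add: t_def)
      also have "\<dots> \<le> t ^ (j ^ 2)" using t \<open>j \<in> {1..J}\<close> by (intro power_decreasing power_mono) auto
      finally show "1 - real (J ^ 2) * (1 / (2 * real J ^ 3)) \<le> t ^ (j ^ 2)" .
    qed
    finally show ?thesis by (simp add: J_def)
  qed
  ultimately show False using F(2) by simp
qed

text \<open>\<open>GRH\<close> settles Re s < 1 only. On the line Re s = 1 the 3-4-1 argument fails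
  just at s = 1 for characters with principal square, which are the real ones; for Re s > 1 the
  inverse series is available.\<close>

theorem dirichlet_L_nonzero:
  assumes "GRH" and chi: "dirichlet_char q chi" "\<not> principal_char q chi" and q: "q > 0" and s: "Re s > 1 / 2"
  shows "dirichlet_L chi s \<noteq> 0"
proof -
  consider "Re s < 1" | "Re s = 1" | "Re s > 1" by linarith
  then show ?thesis
  proof cases
    case 1
    show ?thesis
    proof
      assume "dirichlet_L chi s = 0"
      with 1 assms have "Re s = 1 / 2" unfolding GRH_def by (auto simp: Suc_le_eq)
      with s show False by simp
    qed
  next
    case 2
    then have e: "s = Complex 1 (Im s)" by (simp add: complex_eq_iff)
    show ?thesis
    proof (cases "Im s \<noteq> 0 \<or> \<not> principal_char q (\<lambda>n. chi n * chi n)")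
      case True
      from dirichlet_L_nonzero_line[OF chi q this] e show ?thesis by simp
    next
      case False
      then have "s = 1" using e by (simp add: complex_eq_iff)
      then show ?thesis using real_char_L1_nonzero[OF chi q] False by simp
    qed
  next
    case 3
    then show ?thesis using dirichlet_L_power_mult_inverse[OF chi(1) q 3, of 1] by auto
  qed
qed

section \<open>Taylor approximation of Dirichlet series\<close>

text \<open>Borel--Caratheodory: Schwarz's lemma applied to \<open>h / (2 ln M - h)\<close> with \<open>h = log g\<close>.\<close>

lemma inverse_bound_from_upper_bound:
  assumes hol: "g holomorphic_on ball a R" and ne: "\<And>z. z \<in> ball a R \<Longrightarrow> g z \<noteq> 0" and ga: "g a = 1"
    and M: "\<And>z. z \<in> ball a R \<Longrightarrow> norm (g z) < M" and r: "0 < r" "r < R" and z: "norm (z - a) \<le> r"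
  shows "norm (1 / g z) \<le> M powr (2 * r / (R - r))"
proof -
  have R: "R > 0" using r by simp
  have M1: "M > 1" using M[of a] ga R by simp
  define A where "A = ln M"
  have A: "A > 0" using M1 by (simp add: A_def)
  obtain h0 where h0: "h0 holomorphic_on ball a R" "\<And>z. z \<in> ball a R \<Longrightarrow> g z = exp (h0 z)"
    using contractible_imp_holomorphic_log[OF hol _ ne] by (metis convex_ball convex_imp_contractible)
  \<comment> \<open>Normalised to vanish at the centre, as Schwarz's lemma requires.\<close>
  define h where "h z = h0 z - h0 a" for z
  have h: "h holomorphic_on ball a R" unfolding h_def by (intro holomorphic_intros h0)
  have gh: "g z = exp (h z)" if "z \<in> ball a R" for z
    using h0(2)[OF that] h0(2)[of a] ga R by (simp add: h_def exp_diff)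
  have Reh: "Re (h z) < A" if "z \<in> ball a R" for z
  proof -
    have "exp (Re (h z)) < M" using M[OF that] gh[OF that] by simp
    then have "ln (exp (Re (h z))) < ln M" using M1 by (intro ln_less_cancel_iff[THEN iffD2]) auto
    then show ?thesis by (simp add: A_def)
  qed
  define \<phi> where "\<phi> w = h (a + of_real R * w) / (2 * of_real A - h (a + of_real R * w))" for w
  have inb: "a + of_real R * w \<in> ball a R" if "norm w < 1" for w
    using that R by (simp add: dist_norm norm_mult)
  \<comment> \<open>Since Re h < A, the value of \<open>h\<close> is closer to 0 than to the
    reflected point 2 A; this puts \<open>\<phi>\<close> inside the unit disc.\<close>
  have lt: "norm (h u) < norm (2 * of_real A - h u)" if "u \<in> ball a R" for u
  proof -
    have "(Re (h u))\<^sup>2 + (Im (h u))\<^sup>2 < (2 * A - Re (h u))\<^sup>2 + (Im (h u))\<^sup>2"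
      using Reh[OF that] A mult_pos_pos[of "4 * A" "A - Re (h u)"] by (simp add: power2_eq_square algebra_simps)
    then have "(norm (h u))\<^sup>2 < (norm (2 * of_real A - h u))\<^sup>2"
      by (simp add: cmod_power2)
    then show ?thesis by (rule power2_less_imp_less) simp
  qed
  define w where "w = (z - a) / of_real R"
  have nw: "norm w \<le> r / R" "norm w < 1"
  proof -
    show "norm w \<le> r / R" using z R by (simp add: w_def norm_divide divide_right_mono)
    also have "\<dots> < 1" using r by simp
    finally show "norm w < 1" .
  qed
  have "norm (\<phi> w) \<le> norm w"
  proof (rule Schwarz_Lemma(1))
    show "\<phi> holomorphic_on ball 0 1"
      unfolding \<phi>_def
    proof (intro holomorphic_intros)
      have *: "(h \<circ> (\<lambda>w. a + of_real R * w)) holomorphic_on ball 0 1"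
        by (rule holomorphic_on_compose_gen[OF _ h]) (use inb in \<open>auto intro!: holomorphic_intros\<close>)
      then show "(\<lambda>w. h (a + of_real R * w)) holomorphic_on ball 0 1"
        and "(\<lambda>w. h (a + of_real R * w)) holomorphic_on ball 0 1" by (simp_all add: o_def)
      show "2 * of_real A - h (a + of_real R * w) \<noteq> 0" if "w \<in> ball 0 1" for w
        using lt[OF inb[of w]] that by auto
    qed
    show "\<phi> 0 = 0" by (simp add: \<phi>_def h_def)
    show "norm (\<phi> w) < 1" if "norm w < 1" for w
      using lt[OF inb[OF that]] unfolding \<phi>_def norm_divide
      by (subst divide_less_eq_1_pos) (use le_less_trans[OF norm_ge_zero] in auto)
    show "norm w < 1" by (rule nw)
  qed
  have zw: "a + of_real R * w = z" using R by (simp add: w_def)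
  have zb: "z \<in> ball a R" using inb[OF nw(2)] zw by simp
  have pos: "norm (2 * of_real A - h z) > 0" using lt[OF zb] le_less_trans[OF norm_ge_zero] by blast
  have "norm (h z) \<le> norm w * norm (2 * of_real A - h z)"
    using \<open>norm (\<phi> w) \<le> norm w\<close> pos unfolding \<phi>_def zw norm_divide by (simp add: pos_divide_le_eq)
  also have "\<dots> \<le> r / R * (2 * A + norm (h z))"
  proof (intro mult_mono nw)
    show "norm (2 * of_real A - h z) \<le> 2 * A + norm (h z)"
      using norm_triangle_ineq4[of "2 * of_real A" "h z"] A by (simp add: norm_mult)
  qed (use r R in auto)
  \<comment> \<open>The unknown \<open>norm (h z)\<close> occurs on both sides; solving for it
    produces the factor 2 r / (R - r).\<close>
  finally have "norm (h z) * (R - r) \<le> 2 * r * A" using R by (simp add: field_simps)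
  then have hz: "norm (h z) \<le> 2 * r / (R - r) * A" using r by (simp add: field_simps)
  have "norm (1 / g z) = exp (- Re (h z))" using gh[OF zb] by (simp add: norm_divide norm_inverse exp_minus divide_inverse norm_exp_eq_Re)
  also have "\<dots> \<le> exp (2 * r / (R - r) * A)"
    using hz abs_Re_le_cmod[of "h z"] by (intro exp_le_cancel_iff[THEN iffD2]) linarith
  also have "\<dots> = M powr (2 * r / (R - r))" using M1 by (simp add: powr_def A_def)
  finally show ?thesis .
qed

lemma power_series_coeff_unique:
  fixes f :: "complex \<Rightarrow> complex"
  assumes r: "r > 0" and "\<And>u. norm u < r \<Longrightarrow> (\<lambda>n. a n * u ^ n) sums f u" "\<And>u. norm u < r \<Longrightarrow> (\<lambda>n. b n * u ^ n) sums f u"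
  shows "a n = b n"
proof -
  have ev: "eventually (\<lambda>u. norm u < r) (nhds (0::complex))"
    using r eventually_nhds_in_open[of "ball 0 r" "0::complex"] by simp
  have "f has_fps_expansion Abs_fps a" "f has_fps_expansion Abs_fps b"
    by (rule has_fps_expansionI, rule eventually_mono[OF ev], simp add: assms)+
  then have "Abs_fps a = Abs_fps b" by (rule fps_expansion_unique_complex)
  then show ?thesis by (metis fps_nth_Abs_fps)
qed

text \<open>An approximation to \<open>1/n = n\<^sup>-\<^sup>2 exp (ln n)\<close>.\<close>

definition taylor_weight :: "nat \<Rightarrow> nat \<Rightarrow> real" where
  "taylor_weight J n = real n powr (-2) * (\<Sum>j<J. ln (real n) ^ j / fact j)"

lemma has_sum_exp:
  "((\<lambda>j. (z :: 'a :: {real_normed_field, banach}) ^ j / fact j) has_sum exp z) UNIV"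
proof (rule norm_summable_imp_has_sum)
  show "summable (\<lambda>j. norm (z ^ j / fact j))"
  proof -
    have "(\<lambda>j. norm (z ^ j / fact j)) = (\<lambda>j. norm (z ^ j /\<^sub>R fact j))"
      by (simp add: fun_eq_iff norm_mult norm_inverse norm_power divide_inverse mult.commute)
    then show ?thesis using summable_norm_exp[of z] by simp
  qed
  show "(\<lambda>j. z ^ j / fact j) sums exp z"
    using exp_converges[of z] by (simp add: scaleR_conv_of_real divide_inverse mult.commute)
qed

text \<open>Expand n^(-x) = exp(-x ln n) in every term and interchange the sums. For |x| < 1 the
  absolute values of the double series sum to the series of absolute values at 2 - |x| > 1, so the
  interchange is legitimate.\<close>

lemma dirichlet_series_taylor_coeff:
  fixes a :: "nat \<Rightarrow> complex"
  assumes sm: "\<And>s. Re s > 1 \<Longrightarrow> (\<lambda>n. norm (a n * of_nat n powr (-s))) summable_on UNIV"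
    and x: "norm (x :: complex) < 1"
  shows "(\<lambda>n. a n * of_real (real n powr (-2) * (ln (real n) ^ j / fact j))) summable_on UNIV" (is ?A)
    and "(\<lambda>j. (- x) ^ j * (\<Sum>\<^sub>\<infinity>n. a n * of_real (real n powr (-2) * (ln (real n) ^ j / fact j)))) sums
      (\<Sum>\<^sub>\<infinity>n. a n * of_nat n powr (-(2 + x)))" (is ?B)
proof -
  define c where "c n = a n * of_nat n powr (-2)" for n
  have c2: "of_nat n powr (-2 :: complex) = of_real (real n powr (-2))" for n
    using powr_of_real[of "real n" "-2"] by simp
  define G where "G y = (\<lambda>(n, j). c n * ((- y * of_real (ln (real n))) ^ j / fact j))" for y :: complex
  have inner: "((\<lambda>j. G y (n, j)) has_sum (a n * of_nat n powr (-(2 + y)))) UNIV" for n y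
  proof (cases "n = 0")
    case False
    have "((\<lambda>j. c n * ((- y * of_real (ln (real n))) ^ j / fact j)) has_sum (c n * exp (- y * of_real (ln (real n))))) UNIV"
      by (intro has_sum_cmult_right has_sum_exp)
    moreover have "exp (- y * of_real (ln (real n))) = of_nat n powr (-y)"
      using False Ln_of_real[of "real n"] by (simp add: powr_def)
    moreover have "-(2 + y) = -2 + -y" by simp
    then have "of_nat n powr (-(2 + y)) = of_nat n powr (-2) * of_nat n powr (-y)"
      by (simp only: powr_add)
    ultimately show ?thesis by (simp add: G_def c_def mult.assoc)
  qed (simp add: G_def c_def)
  have abs: "(\<lambda>p. norm (G y p)) summable_on UNIV \<times> UNIV" if y: "norm y < 1" for y
  proof (rule summable_on_SigmaI)
    define b where "b = norm y"
    have nc: "norm (c n) = norm (a n) * real n powr (-2)" for n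
      by (simp add: c_def norm_mult c2)
    show "((\<lambda>j. norm (G y (n, j))) has_sum (norm (a n * of_nat n powr (-(2 - of_real b))))) UNIV" for n
    proof (cases "n = 0")
      case False
      have "((\<lambda>j. norm (c n) * ((b * ln (real n)) ^ j / fact j)) has_sum (norm (c n) * exp (b * ln (real n)))) UNIV"
        by (intro has_sum_cmult_right has_sum_exp)
      moreover have "norm (G y (n, j)) = norm (c n) * ((b * ln (real n)) ^ j / fact j)" for j
        using False by (simp add: G_def norm_mult norm_divide norm_power b_def power_mult_distrib)
      moreover have "norm (c n) * exp (b * ln (real n)) = norm (a n * of_nat n powr (-(2 - of_real b)))"
        using False by (simp add: nc norm_mult norm_powr_real_powr powr_def mult_exp_exp algebra_simps)
      ultimately show ?thesis by simp
    qed (simp add: G_def c_def)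
    show "(\<lambda>n. norm (a n * of_nat n powr (-(2 - of_real b)))) summable_on UNIV"
      using sm[of "2 - of_real b"] y by (simp add: b_def)
  qed auto
  have sG: "G y summable_on UNIV \<times> UNIV" if "norm y < 1" for y
    using abs_summable_summable[OF abs[OF that]] .
  have sG': "(\<lambda>(j, n). G y (n, j)) summable_on UNIV \<times> UNIV" if "norm y < 1" for y
    using sG[OF that] by (subst (asm) summable_on_swap) (simp add: case_prod_unfold)
  have A: "(\<lambda>n. a n * of_real (real n powr (-2) * (ln (real n) ^ j / fact j))) summable_on UNIV" for j :: nat
  proof -
    \<comment> \<open>Any nonzero point of the unit disc would do; the power of -1/2 is cancelled by
      the factor \<open>(-2) ^ j\<close>.\<close>
    have "(\<lambda>n. G (1/2) (n, j)) summable_on UNIV"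
      using summable_on_SigmaD1[OF sG'[of "1/2"], of j] by simp
    then have "(\<lambda>n. G (1/2) (n, j) * (-2) ^ j) summable_on UNIV"
      by (rule summable_on_cmult_left)
    also have "(\<lambda>n. G (1/2) (n, j) * (-2) ^ j) = (\<lambda>n. a n * of_real (real n powr (-2) * (ln (real n) ^ j / fact j)))"
    proof
      fix n
      have "(- (1/2) * of_real (ln (real n)) :: complex) ^ j * (-2) ^ j = of_real (ln (real n)) ^ j"
        unfolding power_mult_distrib[symmetric] by simp
      then show "G (1/2) (n, j) * (-2) ^ j = a n * of_real (real n powr (-2) * (ln (real n) ^ j / fact j))"
        by (simp add: G_def c_def c2 mult_ac)
    qed
    finally show ?thesis .
  qed
  show ?A by (rule A)
  define T where "T = (\<Sum>\<^sub>\<infinity>n. a n * of_nat n powr (-(2 + x)))"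
  have "(G x has_sum (infsum (G x) (UNIV \<times> UNIV))) (UNIV \<times> UNIV)" using sG[OF x] by simp
  moreover from has_sum_SigmaD[OF this inner]
  have "infsum (G x) (UNIV \<times> UNIV) = T" by (simp add: T_def infsumI)
  ultimately have "(G x has_sum T) (UNIV \<times> UNIV)" by simp
  then have "((\<lambda>(j, n). G x (n, j)) has_sum T) (UNIV \<times> UNIV)"
    by (subst (asm) has_sum_swap) (simp add: case_prod_unfold)
  then have "((\<lambda>j. (- x) ^ j * (\<Sum>\<^sub>\<infinity>n. a n * of_real (real n powr (-2) * (ln (real n) ^ j / fact j)))) has_sum T) UNIV"
  proof (rule has_sum_SigmaD)
    fix j
    have "((\<lambda>n. (- x) ^ j * (a n * of_real (real n powr (-2) * (ln (real n) ^ j / fact j)))) has_sum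
       (- x) ^ j * (\<Sum>\<^sub>\<infinity>n. a n * of_real (real n powr (-2) * (ln (real n) ^ j / fact j)))) UNIV"
      by (intro has_sum_cmult_right has_sum_infsum A)
    also have "(\<lambda>n. (- x) ^ j * (a n * of_real (real n powr (-2) * (ln (real n) ^ j / fact j)))) =
       (\<lambda>n. case (j, n) of (j, n) \<Rightarrow> G x (n, j))"
      by (rule ext) (simp only: G_def c_def c2 prod.case power_mult_distrib of_real_mult of_real_divide of_real_power of_real_fact times_divide_eq_right mult_ac)
    finally show "((\<lambda>n. case (j, n) of (j, n) \<Rightarrow> G x (n, j)) has_sum
       (- x) ^ j * (\<Sum>\<^sub>\<infinity>n. a n * of_real (real n powr (-2) * (ln (real n) ^ j / fact j)))) UNIV" .
  qed
  then show ?B unfolding T_def by (rule has_sum_imp_sums)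
qed

text \<open>Uniqueness of power series identifies the Taylor coefficients of \<open>F\<close> at 2
  with those read off from the Dirichlet series on the unit disc. Cauchy's inequality on the circle
  of radius 5/4 bounds them by M (4/5)^j, and 1 is at distance 1 from 2, so the tail from
  \<open>J\<close> on is geometric with sum 5 M (4/5)^J.\<close>

theorem dirichlet_series_taylor_truncation:
  fixes a :: "nat \<Rightarrow> complex"
  assumes sm: "\<And>s. Re s > 1 \<Longrightarrow> (\<lambda>n. norm (a n * of_nat n powr (-s))) summable_on UNIV"
    and F: "\<And>s. Re s > 1 \<Longrightarrow> F s = (\<Sum>\<^sub>\<infinity>n. a n * of_nat n powr (-s))"
    and hol: "F holomorphic_on ball 2 (3 / 2)" and M: "\<And>s. norm (s - 2) = 5 / 4 \<Longrightarrow> norm (F s) \<le> M"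
  shows "(\<lambda>n. a n * of_real (taylor_weight J n)) summable_on UNIV"
    and "norm (F 1 - (\<Sum>\<^sub>\<infinity>n. a n * of_real (taylor_weight J n))) \<le> 5 * M * (4 / 5) ^ J"
proof -
  define c where "c j = (\<Sum>\<^sub>\<infinity>n. a n * of_real (real n powr (-2) * (ln (real n) ^ j / fact j)))" for j
  define d where "d j = (deriv ^^ j) F 2 / fact j" for j
  note P = dirichlet_series_taylor_coeff[OF sm]
  have cd: "d j = (-1) ^ j * c j" for j
  proof (rule power_series_coeff_unique[where r = 1 and f = "\<lambda>u. F (2 + u)"])
    fix u :: complex assume u: "norm u < 1"
    have "2 + u \<in> ball 2 (3 / 2)" using u by (simp add: dist_norm)
    from holomorphic_power_series[OF hol this] show "(\<lambda>n. d n * u ^ n) sums F (2 + u)" by (simp add: d_def)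
    have "Re (2 + u) > 1" using u abs_Re_le_cmod[of u] by simp
    then have "F (2 + u) = (\<Sum>\<^sub>\<infinity>n. a n * of_nat n powr (-(2 + u)))" by (rule F)
    then show "(\<lambda>j. (-1) ^ j * c j * u ^ j) sums F (2 + u)"
      using P(2)[OF _ u] by (simp add: c_def power_minus[of u] mult_ac)
  qed simp
  have M0: "M \<ge> 0" using order_trans[OF norm_ge_zero M[of "2 + 5 / 4"]] by simp
  have dj: "norm (d j) \<le> M * (4 / 5) ^ j" for j
  proof -
    have "norm ((deriv ^^ j) F 2) \<le> fact j * M / (5 / 4) ^ j"
    proof (rule Cauchy_inequality)
      show "F holomorphic_on ball 2 (5 / 4)" by (rule holomorphic_on_subset[OF hol]) auto
      show "continuous_on (cball 2 (5 / 4)) F"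
        by (rule holomorphic_on_imp_continuous_on, rule holomorphic_on_subset[OF hol]) auto
    qed (auto intro!: M simp: norm_minus_commute)
    then show ?thesis by (simp add: d_def norm_divide field_simps)
  qed
  have "(\<lambda>n. d n * (1 - 2) ^ n) sums F 1"
    unfolding d_def by (rule holomorphic_power_series[OF hol]) (simp add: dist_norm)
  \<comment> \<open>The sign in the Taylor coefficients cancels against 1 - 2 = -1, so that the
    weight consists of nonnegative terms.\<close>
  moreover have "d n * (1 - 2) ^ n = c n" for n
  proof -
    have "d n * (1 - 2) ^ n = ((-1) ^ n * (-1) ^ n) * c n" by (simp add: cd)
    then show ?thesis by (simp only: minus_one_mult_self mult_1)
  qed
  ultimately have cs: "c sums F 1" by simp
  have w: "a n * of_real (taylor_weight J n) = (\<Sum>j<J. a n * of_real (real n powr (-2) * (ln (real n) ^ j / fact j)))" for n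
    by (simp add: taylor_weight_def sum_distrib_left)
  have "((\<lambda>n. a n * of_real (taylor_weight J n)) has_sum (\<Sum>j<J. c j)) UNIV"
    unfolding w
  proof (induction J)
    case (Suc J)
    have "((\<lambda>n. a n * of_real (real n powr (-2) * (ln (real n) ^ J / fact J))) has_sum c J) UNIV"
      unfolding c_def by (intro has_sum_infsum P(1)[of 0]) auto
    from has_sum_add[OF Suc this] show ?case by simp
  qed simp
  then show "(\<lambda>n. a n * of_real (taylor_weight J n)) summable_on UNIV"
    and W: "norm (F 1 - (\<Sum>\<^sub>\<infinity>n. a n * of_real (taylor_weight J n))) \<le> 5 * M * (4 / 5) ^ J"
  proof -
    assume H: "((\<lambda>n. a n * of_real (taylor_weight J n)) has_sum (\<Sum>j<J. c j)) UNIV"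
    show "(\<lambda>n. a n * of_real (taylor_weight J n)) summable_on UNIV" using H has_sum_imp_summable by blast
    have "(\<lambda>j. c (j + J)) sums (F 1 - (\<Sum>j<J. c j))" using cs by (simp add: sums_iff_shift)
    then have "F 1 - (\<Sum>j<J. c j) = (\<Sum>j. c (j + J))" by (simp add: sums_iff)
    also have "norm \<dots> \<le> (\<Sum>j. M * (4 / 5) ^ J * (4 / 5) ^ j)"
    proof (rule norm_suminf_le)
      show "norm (c (j + J)) \<le> M * (4 / 5) ^ J * (4 / 5) ^ j" for j
        using dj[of "j + J"] by (simp add: cd norm_mult norm_power power_add mult_ac)
      show "summable (\<lambda>j. M * (4 / 5) ^ J * (4 / 5 :: real) ^ j)" by (intro summable_mult summable_geometric) simp
    qed
    also have "\<dots> = M * (4 / 5) ^ J * (1 / (1 - 4 / 5))"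
      by (subst suminf_mult) (auto simp: summable_geometric suminf_geometric)
    finally show "norm (F 1 - (\<Sum>\<^sub>\<infinity>n. a n * of_real (taylor_weight J n))) \<le> 5 * M * (4 / 5) ^ J"
      using infsumI[OF H] by simp
  qed
qed

section \<open>The diagonal and the size of 1/L\<close>

text \<open>Rankin's trick with a free parameter \<open>b\<close>: below \<open>J\<close> the factor
  b^(J - j) is at least 1, and from \<open>J\<close> on b^(j - J) is, so inserting it may be charged
  to the full exponential series.\<close>

lemma exp_partial_sum_le:
  fixes x b :: real
  assumes x: "x \<ge> 0" and b: "b \<ge> 1"
  shows "(\<Sum>j<J. x ^ j / fact j) \<le> b ^ J * exp (x / b)"
    and "b ^ J * (exp x - (\<Sum>j<J. x ^ j / fact j)) \<le> exp (b * x)"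
proof -
  have S: "(\<lambda>j. y ^ j / fact j) sums exp y" for y :: real
    by (rule has_sum_imp_sums[OF has_sum_exp])
  have "(\<Sum>j<J. x ^ j / fact j) \<le> (\<Sum>j<J. b ^ J * ((x / b) ^ j / fact j))"
  proof (rule sum_mono)
    fix j assume "j \<in> {..<J}"
    then have "b ^ j \<le> b ^ J" using b by (intro power_increasing) auto
    then have "b ^ j * ((x / b) ^ j / fact j) \<le> b ^ J * ((x / b) ^ j / fact j)"
      using x b by (intro mult_right_mono) auto
    then show "x ^ j / fact j \<le> b ^ J * ((x / b) ^ j / fact j)"
      using b by (simp add: power_divide)
  qed
  also have "\<dots> = b ^ J * (\<Sum>j<J. (x / b) ^ j / fact j)" by (simp add: sum_distrib_left)
  also have "\<dots> \<le> b ^ J * (\<Sum>j. (x / b) ^ j / fact j)"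
    using S[of "x / b"] x b by (intro mult_left_mono sum_le_suminf) (auto simp: sums_iff)
  finally show "(\<Sum>j<J. x ^ j / fact j) \<le> b ^ J * exp (x / b)" using S[of "x / b"] by (simp add: sums_iff)
  have sm: "summable (\<lambda>j. y ^ j / fact j)" for y :: real using S[of y] by (simp add: sums_iff)
  have tail: "(\<Sum>j. y ^ (j + J) / fact (j + J)) = exp y - (\<Sum>j<J. y ^ j / fact j)" for y :: real
    using suminf_minus_initial_segment[OF sm[of y], of J] S[of y] by (simp add: sums_iff)
  have sJ: "summable (\<lambda>j. y ^ (j + J) / fact (j + J))" for y :: real
    by (rule summable_ignore_initial_segment[OF sm])
  have "b ^ J * (exp x - (\<Sum>j<J. x ^ j / fact j)) = (\<Sum>j. b ^ J * (x ^ (j + J) / fact (j + J)))"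
    unfolding tail[symmetric] by (rule suminf_mult[OF sJ, symmetric])
  also have "\<dots> \<le> (\<Sum>j. (b * x) ^ (j + J) / fact (j + J))"
  proof (rule suminf_le)
    fix j
    have "b ^ J * x ^ (j + J) \<le> b ^ (j + J) * x ^ (j + J)"
      using x b by (intro mult_right_mono power_increasing) auto
    then show "b ^ J * (x ^ (j + J) / fact (j + J)) \<le> (b * x) ^ (j + J) / fact (j + J)"
      by (simp add: power_mult_distrib divide_right_mono)
  qed (intro summable_mult sJ)+
  also have "\<dots> = exp (b * x) - (\<Sum>j<J. (b * x) ^ j / fact j)" by (rule tail)
  also have "\<dots> \<le> exp (b * x)" using x b by (simp add: sum_nonneg)
  finally show "b ^ J * (exp x - (\<Sum>j<J. x ^ j / fact j)) \<le> exp (b * x)" .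
qed

text \<open>The third bound, for \<open>b > 1\<close>, is decay faster than 1/n at the cost of
  \<open>b ^ J\<close>, and makes absolute convergence possible; it is applied with \<open>b\<close>
  just above 1. The fourth says that the weight is close to 1/n when \<open>n\<close> is small
  compared with the cutoff; it is applied with \<open>b = 5/4\<close>.\<close>

lemma taylor_weight_bounds:
  assumes n: "n > 0" and b: "b \<ge> 1"
  shows "taylor_weight J n \<ge> 0" "taylor_weight J n \<le> 1 / real n"
    and "taylor_weight J n \<le> b ^ J * real n powr (-2 + 1 / b)"
    and "b ^ J * (1 / real n - taylor_weight J n) \<le> real n powr (-2 + b)"
proof -
  define x where "x = ln (real n)"
  have x: "x \<ge> 0" using n by (simp add: x_def)
  have e: "exp (c * x) = real n powr c" for c using n by (simp add: x_def powr_def)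
  have en: "exp x = real n" using n by (simp add: x_def)
  have n2: "real n powr (-2) * real n = 1 / real n"
    using n by (simp add: powr_minus power2_eq_square field_simps)
  define S where "S = (\<Sum>j<J. x ^ j / fact j)"
  have w: "taylor_weight J n = real n powr (-2) * S" by (simp add: taylor_weight_def x_def S_def)
  show "taylor_weight J n \<ge> 0" using x by (simp add: w S_def sum_nonneg)
  have "S \<le> real n" using exp_partial_sum_le(1)[OF x, of 1 J] by (simp add: en S_def)
  then show "taylor_weight J n \<le> 1 / real n" unfolding w n2[symmetric] by (intro mult_left_mono) auto
  have "S \<le> b ^ J * real n powr (1 / b)" using exp_partial_sum_le(1)[OF x b, of J] e[of "1 / b"] by (simp add: S_def)
  then have "real n powr (-2) * S \<le> real n powr (-2) * (b ^ J * real n powr (1 / b))" by (intro mult_left_mono) auto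
  then show "taylor_weight J n \<le> b ^ J * real n powr (-2 + 1 / b)" unfolding w powr_add by (simp add: mult_ac)
  have "b ^ J * (real n - S) \<le> real n powr b" using exp_partial_sum_le(2)[OF x b, of J] e[of b] by (simp add: S_def en)
  then have "real n powr (-2) * (b ^ J * (real n - S)) \<le> real n powr (-2) * real n powr b" by (intro mult_left_mono) auto
  then show "b ^ J * (1 / real n - taylor_weight J n) \<le> real n powr (-2 + b)"
    unfolding w powr_add n2[symmetric] by (simp add: algebra_simps)
qed

section \<open>The diagonal sum and its Euler product\<close>

lemma summable_on_powr: "\<sigma> > 1 \<Longrightarrow> (\<lambda>n. real n powr (-\<sigma>)) summable_on UNIV"
  by (simp add: summable_on_UNIV_nonneg_real_iff summable_real_powr_iff)

lemma summable_zeta_inv_coeff_square: "(\<lambda>n. (zeta_inv_coeff k n)\<^sup>2 / (real n)\<^sup>2) summable_on UNIV"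
proof -
  obtain C where C: "C > 0" "\<forall>n. \<bar>zeta_inv_coeff k n\<bar> \<le> C * real n powr (1/4)"
    using zeta_inv_coeff_bound[of "1/4" k] by auto
  show ?thesis
  proof (rule summable_on_comparison_test)
    show "(\<lambda>n. C\<^sup>2 * real n powr (-(3/2))) summable_on UNIV"
      by (intro summable_on_cmult_right summable_on_powr) simp
    show "(zeta_inv_coeff k n)\<^sup>2 / (real n)\<^sup>2 \<le> C\<^sup>2 * real n powr (-(3/2))" for n
    proof (cases "n = 0")
      case False
      have "\<bar>zeta_inv_coeff k n\<bar>\<^sup>2 \<le> (C * real n powr (1/4))\<^sup>2" using C by (intro power_mono) auto
      then have "(zeta_inv_coeff k n)\<^sup>2 / (real n)\<^sup>2 \<le> (C * real n powr (1/4))\<^sup>2 / (real n)\<^sup>2"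
        by (simp add: divide_right_mono)
      also have "(C * real n powr (1/4))\<^sup>2 / (real n)\<^sup>2 = C\<^sup>2 * real n powr (-(3/2))"
      proof -
        have "(real n powr (1/4))\<^sup>2 = real n powr (1/2)" by (simp add: power2_eq_square flip: powr_add)
        moreover have "(real n)\<^sup>2 = real n powr 2" using False by simp
        moreover have "real n powr (1/2) / real n powr 2 = real n powr (-(3/2))"
          by (simp only: powr_diff[symmetric]) simp
        ultimately show ?thesis by (simp only: power_mult_distrib times_divide_eq_right[symmetric])
      qed
      finally show ?thesis .
    qed simp
  qed auto
qed

text \<open>The diagonal of the mean square with the weight replaced by its limit 1/n. As an Euler
  product it is \<open>C_const k\<close> without the factors at the primes dividing
  \<open>q\<close>.\<close>

definition coprime_square_sum :: "nat \<Rightarrow> nat \<Rightarrow> real" where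
  "coprime_square_sum k q = (\<Sum>\<^sub>\<infinity>n. of_bool (coprime n q) * ((zeta_inv_coeff k n)\<^sup>2 / (real n)\<^sup>2))"

lemma summable_coprime_square:
  "(\<lambda>n. of_bool (coprime n q) * ((zeta_inv_coeff k n)\<^sup>2 / (real n)\<^sup>2)) summable_on UNIV"
  by (rule summable_on_comparison_test[OF summable_zeta_inv_coeff_square[of k]]) auto

lemma coprime_square_sum_ge_1: "coprime_square_sum k q \<ge> 1"
proof -
  let ?f = "\<lambda>n. of_bool (coprime n q) * ((zeta_inv_coeff k n)\<^sup>2 / (real n)\<^sup>2) :: real"
  have "(?f has_sum ?f 1) {1}" by (rule has_sum_finiteI) auto
  moreover have "(?f has_sum coprime_square_sum k q) UNIV"
    unfolding coprime_square_sum_def by (rule has_sum_infsum[OF summable_coprime_square])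
  ultimately have "?f 1 \<le> coprime_square_sum k q" by (rule has_sum_mono2) auto
  then show ?thesis by simp
qed

lemma local_factor_ge_1: "local_factor k p \<ge> 1"
proof -
  have "(\<Sum>j\<in>{0}. real (k choose j) ^ 2 / real p ^ (2 * j)) \<le> local_factor k p"
    unfolding local_factor_def by (rule sum_mono2) auto
  then show ?thesis by simp
qed

text \<open>Squaring removes the signs of the coefficients, so the local series is
  \<open>local_factor k p\<close>; at primes dividing \<open>q\<close> coprimality leaves only the
  exponent 0.\<close>

lemma euler_product_coprime_square:
  assumes "q > 0"
  shows "(\<lambda>N. \<Prod>p | prime p \<and> p \<le> N. if p dvd q then 1 else local_factor k p) \<longlonglongrightarrow> coprime_square_sum k q"
proof -
  define f where "f n = of_bool (coprime n q) * ((zeta_inv_coeff k n)\<^sup>2 / (real n)\<^sup>2)" for n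
  have "(\<lambda>N. \<Prod>p | prime p \<and> p \<le> N. \<Sum>\<^sub>\<infinity>j. f (p ^ j)) \<longlonglongrightarrow> (\<Sum>\<^sub>\<infinity>n. f n)"
  proof (rule euler_product)
    show "f (m * n) = f m * f n" if "coprime m n" for m n
      using zeta_inv_coeff_mult[OF that, of k] by (simp add: f_def power_mult_distrib)
    have "(\<lambda>n. norm (f n)) = f" by (auto simp: f_def)
    then show "(\<lambda>n. norm (f n)) summable_on UNIV"
      unfolding f_def using summable_coprime_square by simp
  qed (auto simp: f_def)
  moreover have "(\<Sum>\<^sub>\<infinity>j. f (p ^ j)) = (if p dvd q then 1 else local_factor k p)" if p: "prime p" for p
  proof -
    have fp: "f (p ^ j) = of_bool (j = 0 \<or> \<not> p dvd q) * (real (k choose j) ^ 2 / real p ^ (2 * j))" for j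
    proof -
      have "coprime p q \<longleftrightarrow> \<not> p dvd q"
        using p by (metis coprime_absorb_left not_prime_unit prime_imp_coprime)
      then have "coprime (p ^ j) q \<longleftrightarrow> j = 0 \<or> \<not> p dvd q"
        by (cases "j = 0") (simp_all add: coprime_power_left_iff)
      moreover have "((-1) ^ j)\<^sup>2 = (1 :: real)" by (simp flip: power_mult add: mult.commute)
      ultimately show ?thesis
        by (simp add: f_def zeta_inv_coeff_prime_power[OF p] power_mult_distrib mult.commute[of 2] power_mult)
    qed
    show ?thesis
    proof (cases "p dvd q")
      case True
      have "(\<Sum>\<^sub>\<infinity>j. f (p ^ j)) = (\<Sum>\<^sub>\<infinity>j\<in>{0}. f (p ^ j))"
        by (intro infsum_cong_neutral) (auto simp: fp True)
      then show ?thesis using True by (simp add: fp)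
    next
      case False
      have "(\<Sum>\<^sub>\<infinity>j. f (p ^ j)) = (\<Sum>\<^sub>\<infinity>j\<in>{0..k}. f (p ^ j))"
        by (intro infsum_cong_neutral) (auto simp: fp binomial_eq_0)
      then show ?thesis using False by (simp add: fp local_factor_def)
    qed
  qed
  ultimately show ?thesis by (simp add: f_def coprime_square_sum_def)
qed

text \<open>\<open>C_const\<close> is an infinite product over all natural numbers with the value 1
  off the primes. Its value is the limit of the partial products only because that limit is nonzero,
  whence \<open>coprime_square_sum_ge_1\<close>.\<close>

lemma C_const_eq: "C_const k = coprime_square_sum k 1"
proof -
  define f where "f p = (if prime p then local_factor k p else 1)" for p
  have "(\<Prod>p\<le>N. f p) = (\<Prod>p | prime p \<and> p \<le> N. if p dvd 1 then 1 else local_factor k p)" for N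
    by (rule prod.mono_neutral_cong_right) (auto simp: f_def)
  then have "(\<lambda>N. \<Prod>p\<le>N. f p) \<longlonglongrightarrow> coprime_square_sum k 1"
    using euler_product_coprime_square[of 1 k] by simp
  then have "f has_prod coprime_square_sum k 1"
    using coprime_square_sum_ge_1[of k 1] by (auto simp: has_prod_def raw_has_prod_def)
  then show ?thesis
    unfolding C_const_def f_def using has_prod_unique by metis
qed

text \<open>Once \<open>N \<ge> q\<close>, all primes dividing \<open>q\<close> occur in the finite
  product, and their factors can be divided out exactly.\<close>

lemma coprime_square_sum_eq:
  assumes q: "q > 0"
  shows "coprime_square_sum k q = C_const k * (\<Prod>p\<in>prime_factors q. 1 / local_factor k p)"
proof -
  define R where "R = (\<Prod>p\<in>prime_factors q. 1 / local_factor k p)"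
  have "(\<lambda>N. (\<Prod>p | prime p \<and> p \<le> N. if p dvd 1 then 1 else local_factor k p) * R) \<longlonglongrightarrow> coprime_square_sum k 1 * R"
    by (intro tendsto_mult euler_product_coprime_square tendsto_const) simp
  moreover have "(\<Prod>p | prime p \<and> p \<le> N. if p dvd 1 then 1 else local_factor k p) * R =
     (\<Prod>p | prime p \<and> p \<le> N. if p dvd q then 1 else local_factor k p)" if N: "N \<ge> q" for N
  proof -
    define X where "X = {p. prime p \<and> p \<le> N}"
    have fin: "finite X" by (simp add: X_def)
    have sub: "prime_factors q \<subseteq> X"
      using q N by (auto simp: X_def prime_factors_dvd dest: dvd_imp_le)
    have "(\<Prod>p\<in>X. if p dvd 1 then 1 else local_factor k p) = (\<Prod>p\<in>X. local_factor k p)"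
      by (intro prod.cong) (auto simp: X_def)
    also have "\<dots> = (\<Prod>p\<in>X - prime_factors q. local_factor k p) * (\<Prod>p\<in>prime_factors q. local_factor k p)"
      by (rule prod.subset_diff[OF sub fin])
    also have "\<dots> * R = (\<Prod>p\<in>X - prime_factors q. local_factor k p) * 1"
    proof -
      have "local_factor k p \<noteq> 0" for p using local_factor_ge_1[of k p] by simp
      then have "(\<Prod>p\<in>prime_factors q. local_factor k p) * R = 1"
        unfolding R_def prod.distrib[symmetric] by simp
      then show ?thesis by (simp only: mult.assoc)
    qed
    also have "(\<Prod>p\<in>X - prime_factors q. local_factor k p) * 1 = (\<Prod>p\<in>X. if p dvd q then 1 else local_factor k p)"
      unfolding mult_1_right using fin q
      by (intro prod.mono_neutral_cong_left) (auto simp: X_def prime_factors_dvd)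
    finally show ?thesis by (simp add: X_def)
  qed
  then have "eventually (\<lambda>N. (\<Prod>p | prime p \<and> p \<le> N. if p dvd 1 then 1 else local_factor k p) * R =
     (\<Prod>p | prime p \<and> p \<le> N. if p dvd q then 1 else local_factor k p)) sequentially"
    using eventually_sequentially by blast
  ultimately have "(\<lambda>N. \<Prod>p | prime p \<and> p \<le> N. if p dvd q then 1 else local_factor k p) \<longlonglongrightarrow> coprime_square_sum k 1 * R"
    by (rule Lim_transform_eventually)
  from LIMSEQ_unique[OF euler_product_coprime_square[OF q, of k] this] show ?thesis
    by (simp only: C_const_eq R_def)
qed

text \<open>On the disc of radius 3/2 the values of L are linear in \<open>q\<close>, and 1/L(2,chi)
  is bounded uniformly by the absolutely convergent series \<open>Y\<close>. So L(s)/L(2) satisfies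
  the hypotheses of Borel--Caratheodory with a bound linear in \<open>q\<close>, and the radii 5/4
  and 3/2 turn this into the exponent 10.\<close>

lemma L_inverse_bound:
  assumes "GRH"
  shows "\<exists>C>0. \<forall>q chi s. q > 0 \<longrightarrow> dirichlet_char q chi \<longrightarrow> \<not> principal_char q chi \<longrightarrow>
     norm (s - 2) \<le> 5 / 4 \<longrightarrow> norm (1 / dirichlet_L chi s) \<le> C * real q ^ 10"
proof -
  \<comment> \<open>The exponent comes from Re z > 1/2 on the disc, as the majorant for L has
    exponent -Re z - 1.\<close>
  define Z where "Z = (\<Sum>n. real (Suc n) powr (-(3/2)))"
  define Y where "Y = (\<Sum>\<^sub>\<infinity>n. \<bar>zeta_inv_coeff 1 n\<bar> * real n powr (-2))"
  have sY: "(\<lambda>n. \<bar>zeta_inv_coeff 1 n\<bar> * real n powr (-2)) summable_on UNIV"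
    using summable_L_inverse[OF dirichlet_char_mod_1, of 2 1] by (simp add: norm_mult norm_of_nat_powr)
  have Y: "Y \<ge> 0" unfolding Y_def by (rule infsum_nonneg) auto
  have Z: "Z \<ge> 0" unfolding Z_def by (intro suminf_nonneg summable_Suc_powr) auto
  \<comment> \<open>The 4 rounds up 7/2, the maximal norm on the disc; adding 1 gives the strict
    inequality that Borel--Caratheodory asks for.\<close>
  define K where "K = 4 * Z * Y + 1"
  have K: "K \<ge> 1" using Y Z by (simp add: K_def)
  have "norm (1 / dirichlet_L chi s) \<le> (K ^ 10 * Y) * real q ^ 10"
    if q: "q > 0" and chi: "dirichlet_char q chi" "\<not> principal_char q chi" and s: "norm (s - 2) \<le> 5 / 4" for q chi s
  proof -
    note L = dirichlet_L_by_parts[OF chi q]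
    have ball: "Re z > 1 / 2" "norm z \<le> 7 / 2" if "z \<in> ball 2 (3 / 2)" for z :: complex
    proof -
      have n: "norm (2 - z) < 3 / 2" using that by (simp add: dist_norm)
      then show "Re z > 1 / 2" using complex_Re_le_cmod[of "2 - z"] by simp
      show "norm z \<le> 7 / 2" using n norm_triangle_ineq4[of 2 "2 - z"] by simp
    qed
    have nz: "dirichlet_L chi z \<noteq> 0" if "z \<in> ball 2 (3 / 2)" for z
      using dirichlet_L_nonzero[OF assms chi q ball(1)[OF that]] .
    have Lbd: "norm (dirichlet_L chi z) \<le> real q * (7 / 2) * Z" if "z \<in> ball 2 (3 / 2)" for z
    proof -
      have "norm (dirichlet_L chi z) \<le> real q * norm z * (\<Sum>n. real (Suc n) powr (-Re z - 1))"
        using L(2)[of z] ball(1)[OF that] by simp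
      also have "\<dots> \<le> real q * (7 / 2) * Z" unfolding Z_def
        using ball[OF that] by (intro mult_mono suminf_le powr_mono summable_Suc_powr suminf_nonneg) auto
      finally show ?thesis .
    qed
    have inv2: "norm (1 / dirichlet_L chi 2) \<le> Y"
    proof -
      have 2: "Re 2 > (1 :: real)" by simp
      define T where "T = (\<Sum>\<^sub>\<infinity>n. of_real (zeta_inv_coeff 1 n) * chi n * of_nat n powr (-2 :: complex))"
      have "dirichlet_L chi 2 * T = 1"
        using dirichlet_L_power_mult_inverse[OF chi(1) q, of 2 1] by (simp add: T_def)
      then have "1 / dirichlet_L chi 2 = T" using nz[of 2] by (simp add: field_simps)
      moreover have "norm T \<le> (\<Sum>\<^sub>\<infinity>n. norm (of_real (zeta_inv_coeff 1 n) * chi n * of_nat n powr (-2 :: complex)))"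
        unfolding T_def using summable_L_inverse[OF chi(1) q, of 2 1] by (intro norm_infsum_bound) simp
      moreover have "\<dots> \<le> Y" unfolding Y_def
      proof (rule infsum_mono[OF _ sY])
        show "(\<lambda>n. norm (of_real (zeta_inv_coeff 1 n) * chi n * of_nat n powr (-2 :: complex))) summable_on UNIV"
          using summable_L_inverse[OF chi(1) q, of 2 1] by simp
        show "norm (of_real (zeta_inv_coeff 1 n) * chi n * of_nat n powr (-2 :: complex)) \<le> \<bar>zeta_inv_coeff 1 n\<bar> * real n powr (-2)" for n
          using norm_dirichlet_char_le[OF chi(1) q, of n]
          by (simp add: norm_mult norm_of_nat_powr mult_right_mono mult_left_le)
      qed
      ultimately show ?thesis by simp
    qed
    define g where "g z = dirichlet_L chi z / dirichlet_L chi 2" for z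
    have "norm (1 / g s) \<le> (real q * K) powr (2 * (5 / 4) / (3 / 2 - 5 / 4))"
    proof (rule inverse_bound_from_upper_bound[where a = 2 and g = g and z = s and R = "3 / 2" and r = "5 / 4"])
      show "g holomorphic_on ball 2 (3 / 2)"
        unfolding g_def using nz[of 2]
        by (intro holomorphic_intros holomorphic_on_subset[OF L(4)]) (use ball in force)+
      show "g z \<noteq> 0" if "z \<in> ball 2 (3 / 2)" for z using nz[OF that] nz[of 2] by (simp add: g_def)
      show "g 2 = 1" using nz[of 2] by (simp add: g_def)
      show "norm (g z) < real q * K" if "z \<in> ball 2 (3 / 2)" for z
      proof -
        have "norm (g z) = norm (dirichlet_L chi z) * norm (1 / dirichlet_L chi 2)"
          by (simp add: g_def norm_divide)
        also have "\<dots> \<le> (real q * (7 / 2) * Z) * Y"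
          using Z by (intro mult_mono Lbd[OF that] inv2) auto
        also have "\<dots> \<le> real q * (4 * Z * Y)" using Y Z by (simp add: mult_left_mono)
        also have "\<dots> < real q * K" using q by (simp add: K_def)
        finally show ?thesis .
      qed
    qed (use s in auto)
    also have "\<dots> = (real q * K) ^ 10" using q K powr_realpow[of "real q * K" 10] by simp
    finally have g: "norm (1 / g s) \<le> (real q * K) ^ 10" .
    have "1 / dirichlet_L chi s = 1 / g s * (1 / dirichlet_L chi 2)" using nz[of 2] by (simp add: g_def)
    then have "norm (1 / dirichlet_L chi s) = norm (1 / g s) * norm (1 / dirichlet_L chi 2)" by (metis norm_mult)
    also have "\<dots> \<le> (real q * K) ^ 10 * Y" using K by (intro mult_mono g inv2) auto
    finally show ?thesis by (simp add: power_mult_distrib mult_ac)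
  qed
  then have "\<forall>q chi s. q > 0 \<longrightarrow> dirichlet_char q chi \<longrightarrow> \<not> principal_char q chi \<longrightarrow>
     norm (s - 2) \<le> 5 / 4 \<longrightarrow> norm (1 / dirichlet_L chi s) \<le> (K ^ 10 * Y + 1) * real q ^ 10"
    by (intro allI impI order_trans[OF _ mult_right_mono[of "K ^ 10 * Y" "K ^ 10 * Y + 1"]]) auto
  moreover have "K ^ 10 * Y + 1 > 0" using K Y by (intro add_nonneg_pos) auto
  ultimately show ?thesis by blast
qed

section \<open>The mean square\<close>

lemma infsum_le_injective:
  fixes f :: "'a \<Rightarrow> real" and g :: "'b \<Rightarrow> real"
  assumes j: "inj_on j S" "j ` S \<subseteq> A" and g: "g summable_on A" "\<And>x. x \<in> A \<Longrightarrow> g x \<ge> 0"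
    and f: "\<And>x. x \<in> S \<Longrightarrow> 0 \<le> f x" "\<And>x. x \<in> S \<Longrightarrow> f x \<le> g (j x)"
  shows "f summable_on S" "infsum f S \<le> infsum g A"
proof -
  have gj: "g summable_on j ` S" using summable_on_subset_banach[OF g(1) j(2)] .
  then have "(\<lambda>x. g (j x)) summable_on S" using summable_on_reindex[OF j(1), of g] by (simp add: o_def)
  then show s: "f summable_on S" by (rule summable_on_comparison_test) (use f in auto)
  have "infsum f S \<le> infsum (\<lambda>x. g (j x)) S" by (rule infsum_mono[OF s \<open>(\<lambda>x. g (j x)) summable_on S\<close> f(2)])
  also have "\<dots> = infsum g (j ` S)" using infsum_reindex[OF j(1), of g] by (simp add: o_def)
  also have "\<dots> \<le> infsum g A" by (rule infsum_mono_neutral[OF gj g(1)]) (use j g in auto)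
  finally show "infsum f S \<le> infsum g A" .
qed

lemma has_sum_product:
  fixes f g :: "nat \<Rightarrow> 'a :: {real_normed_field, banach}"
  assumes f: "(\<lambda>n. norm (f n)) summable_on UNIV" and g: "(\<lambda>n. norm (g n)) summable_on UNIV"
  shows "((\<lambda>(m, n). f m * g n) has_sum (infsum f UNIV * infsum g UNIV)) (UNIV \<times> UNIV)"
proof (rule has_sum_SigmaI)
  show "((\<lambda>n. case (m, n) of (m, n) \<Rightarrow> f m * g n) has_sum f m * infsum g UNIV) UNIV" for m
    using has_sum_cmult_right[OF has_sum_infsum[OF abs_summable_summable[OF g]], of "f m"] by simp
  show "((\<lambda>m. f m * infsum g UNIV) has_sum infsum f UNIV * infsum g UNIV) UNIV"
    by (rule has_sum_cmult_left[OF has_sum_infsum[OF abs_summable_summable[OF f]]])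
  have "(\<lambda>p. norm (case p of (m, n) \<Rightarrow> f m * g n)) summable_on UNIV \<times> UNIV"
  proof (rule summable_on_SigmaI)
    show "((\<lambda>n. norm (case (m, n) of (m, n) \<Rightarrow> f m * g n)) has_sum norm (f m) * infsum (\<lambda>n. norm (g n)) UNIV) UNIV" for m
      using has_sum_cmult_right[OF has_sum_infsum[OF g], of "norm (f m)"] by (simp add: norm_mult)
    show "(\<lambda>m. norm (f m) * infsum (\<lambda>n. norm (g n)) UNIV) summable_on UNIV"
      by (rule summable_on_cmult_left[OF f])
  qed auto
  then show "(\<lambda>(m, n). f m * g n) summable_on UNIV \<times> UNIV"
    by (rule abs_summable_summable)
qed

lemma has_sum_finite_sum:
  fixes f :: "'b \<Rightarrow> 'a \<Rightarrow> complex"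
  assumes "finite X" "\<And>x. x \<in> X \<Longrightarrow> (f x has_sum s x) A"
  shows "((\<lambda>a. \<Sum>x\<in>X. f x a) has_sum (\<Sum>x\<in>X. s x)) A"
  using assms by (induction X) (auto intro!: has_sum_add)

lemma binary_flags_eq:
  assumes "4 * x + 2 * of_bool a + of_bool b = 4 * y + 2 * of_bool c + (of_bool d :: nat)"
  shows "x = y \<and> (a \<longleftrightarrow> c) \<and> (b \<longleftrightarrow> d)"
  using assms by (cases a; cases b; cases c; cases d; simp; presburger)

text \<open>The pairs that orthogonality over the odd characters leaves beside the main diagonal
  term. They include \<open>(m, m)\<close> when \<open>q\<close> divides 2 m, where the negative
  indicator is an error term even on the diagonal.\<close>

definition offdiagonal_pairs :: "nat \<Rightarrow> (nat \<times> nat) set" where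
  "offdiagonal_pairs q = {(m, n). m > 0 \<and> n > 0 \<and> (m \<noteq> n \<and> [m = n] (mod q) \<or> q dvd m + n)}"

text \<open>An off-diagonal pair is determined by its minimum, a quotient \<open>l \<ge> 1\<close> with
  \<open>max \<ge> l q / 2\<close>, and two binary flags, which are packed into the last two binary digits
  of the second component.\<close>

lemma offdiagonal_sum_bound:
  assumes \<sigma>: "\<sigma> > 1"
  shows "\<exists>C\<ge>0. \<forall>q>0. (\<lambda>(m, n). real m powr (-\<sigma>) * real n powr (-\<sigma>)) summable_on offdiagonal_pairs q \<and>
    (\<Sum>\<^sub>\<infinity>(m, n)\<in>offdiagonal_pairs q. real m powr (-\<sigma>) * real n powr (-\<sigma>)) \<le> C * real q powr (-\<sigma>)"
proof -
  define Z where "Z = (\<Sum>\<^sub>\<infinity>n. real n powr (-\<sigma>))"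
  define C where "C = 16 powr \<sigma> * Z\<^sup>2"
  have C0: "C \<ge> 0" by (simp add: C_def)
  have ZZ: "((\<lambda>(m, n). real m powr (-\<sigma>) * real n powr (-\<sigma>)) has_sum Z * Z) (UNIV \<times> UNIV)"
    unfolding Z_def by (rule has_sum_product) (use summable_on_powr[OF \<sigma>] in auto)
  have main: "(\<lambda>(m, n). real m powr (-\<sigma>) * real n powr (-\<sigma>)) summable_on offdiagonal_pairs q \<and>
    (\<Sum>\<^sub>\<infinity>(m, n)\<in>offdiagonal_pairs q. real m powr (-\<sigma>) * real n powr (-\<sigma>)) \<le> C * real q powr (-\<sigma>)"
    if q: "q > 0" for q
  proof -
    define kind where "kind m n \<longleftrightarrow> m \<noteq> n \<and> [m = n] (mod q)" for m n :: nat
    \<comment> \<open>The maximum is min + l q if \<open>kind\<close> holds and l q - min otherwise.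
      Hence it is determined by the minimum, \<open>l\<close> and \<open>kind\<close>, and the flag
      \<open>m < n\<close> tells which entry it is.\<close>
    define l where "l m n = (if kind m n then (max m n - min m n) div q else (max m n + min m n) div q)" for m n :: nat
    define j where "j = (\<lambda>(m, n). (min m n, 4 * l m n + 2 * of_bool (m < n) + of_bool (kind m n)))"
    define g where "g = (\<lambda>(n, l'). real n powr (-\<sigma>) * ((real q / 16) powr (-\<sigma>) * real l' powr (-\<sigma>)))"
    have mx: "max m n = (if kind m n then min m n + l m n * q else l m n * q - min m n)"
        "l m n * q \<le> 2 * max m n" "l m n \<ge> 1" if mn: "(m, n) \<in> offdiagonal_pairs q" for m n
    proof -
      have pos: "m > 0" "n > 0" using mn by (auto simp: offdiagonal_pairs_def)
      have "max m n = (if kind m n then min m n + l m n * q else l m n * q - min m n) \<and> l m n * q \<le> 2 * max m n \<and> l m n \<ge> 1"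
      proof (cases "kind m n")
        case True
        then have "q dvd max m n - min m n"
        proof -
          have "[max m n = min m n] (mod q)"
            using True by (auto simp: kind_def max_def min_def cong_sym_eq)
          then show ?thesis by (simp add: cong_def mod_eq_dvd_iff_nat)
        qed
        then have e: "l m n * q = max m n - min m n" using True by (simp add: l_def)
        moreover have "max m n > min m n" using True by (auto simp: kind_def max_def min_def)
        ultimately have "l m n \<noteq> 0" by (intro notI) simp
        then show ?thesis using e True \<open>max m n > min m n\<close> by auto
      next
        case False
        then have "q dvd max m n + min m n"
          using mn unfolding kind_def offdiagonal_pairs_def by (auto simp: max_def min_def add.commute)
        then have e: "l m n * q = max m n + min m n" using False by (simp add: l_def)
        have "max m n > 0" using pos by (simp add: max_def)
        with e have "l m n \<noteq> 0" by (intro notI) simp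
        moreover have "min m n \<le> max m n" by simp
        ultimately show ?thesis using e False by auto
      qed
      then show "max m n = (if kind m n then min m n + l m n * q else l m n * q - min m n)"
        "l m n * q \<le> 2 * max m n" "l m n \<ge> 1" by blast+
    qed
    have inj: "inj_on j (offdiagonal_pairs q)"
    proof (rule inj_onI, clarify)
      fix m n m' n' assume mn: "(m, n) \<in> offdiagonal_pairs q" and mn': "(m', n') \<in> offdiagonal_pairs q"
        and eq: "j (m, n) = j (m', n')"
      have mi: "min m n = min m' n'" using eq by (simp add: j_def)
      have code: "4 * l m n + 2 * of_bool (m < n) + of_bool (kind m n) =
          4 * l m' n' + 2 * of_bool (m' < n') + (of_bool (kind m' n') :: nat)"
        using eq by (simp add: j_def)
      from binary_flags_eq[OF this]
      have l: "l m n = l m' n'" and fl: "m < n \<longleftrightarrow> m' < n'" and kd: "kind m n \<longleftrightarrow> kind m' n'" by auto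
      have "max m n = max m' n'" using mx(1)[OF mn] mx(1)[OF mn'] mi l kd by simp
      with mi fl show "m = m' \<and> n = n'" by (auto simp: max_def min_def split: if_splits)
    qed
    have gs: "(g has_sum ((real q / 16) powr (-\<sigma>) * (Z * Z))) UNIV"
      using has_sum_cmult_right[OF ZZ, of "(real q / 16) powr (-\<sigma>)"]
      by (simp add: g_def case_prod_unfold mult_ac)
    have le: "(case x of (m, n) \<Rightarrow> real m powr (-\<sigma>) * real n powr (-\<sigma>)) \<le> g (j x)"
      if x: "x \<in> offdiagonal_pairs q" for x
    proof -
      obtain m n where mn: "x = (m, n)" by force
      note M = mx[OF x[unfolded mn]]
      \<comment> \<open>Because \<open>l m n \<ge> 1\<close>, the packed number is at most 8 times
        \<open>l m n\<close>; together with l q \<le> 2 max this produces the 16 in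
        \<open>C\<close>.\<close>
      define l' where "l' = 4 * l m n + 2 * of_bool (m < n) + (of_bool (kind m n) :: nat)"
      have l': "l' \<ge> 1" "l' \<le> 8 * l m n" using M(3) by (auto simp: l'_def of_bool_def)
      have "q * l' \<le> 8 * (l m n * q)" using l'(2) by (simp add: mult.commute)
      also have "\<dots> \<le> 16 * max m n" using M(2) by (simp add: mult.commute)
      finally have "real q * real l' \<le> 16 * real (max m n)" by (metis of_nat_le_iff of_nat_mult of_nat_numeral)
      then have "real q / 16 * real l' \<le> real (max m n)" by simp
      then have "real (max m n) powr (-\<sigma>) \<le> (real q / 16 * real l') powr (-\<sigma>)"
        using q l' \<sigma> by (intro powr_mono2') auto
      also have "\<dots> = (real q / 16) powr (-\<sigma>) * real l' powr (-\<sigma>)" by (rule powr_mult) 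
      finally have "real (min m n) powr (-\<sigma>) * real (max m n) powr (-\<sigma>) \<le> g (j x)"
        unfolding mn j_def g_def prod.case l'_def[symmetric] by (intro mult_left_mono) auto
      moreover have "real (min m n) powr (-\<sigma>) * real (max m n) powr (-\<sigma>) = real m powr (-\<sigma>) * real n powr (-\<sigma>)"
        by (auto simp: min_def max_def)
      ultimately show ?thesis by (simp add: mn)
    qed
    have g0: "g x \<ge> 0" for x by (auto simp: g_def split: prod.split)
    have f0: "0 \<le> (case x of (m, n) \<Rightarrow> real m powr (-\<sigma>) * real n powr (-\<sigma>))" for x
      by (cases x) simp
    note I = infsum_le_injective[OF inj subset_UNIV has_sum_imp_summable[OF gs] g0 f0 le]
    have "infsum g UNIV = (real q / 16) powr (-\<sigma>) * (Z * Z)" using gs by (rule infsumI)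
    also have "\<dots> = C * real q powr (-\<sigma>)"
    proof -
      have "(real q / 16) powr (-\<sigma>) = real q powr (-\<sigma>) / 16 powr (-\<sigma>)"
        by (simp add: powr_divide)
      also have "\<dots> = real q powr (-\<sigma>) * 16 powr \<sigma>"
        by (simp only: powr_minus[of 16] divide_inverse inverse_inverse_eq)
      finally have "(real q / 16) powr (-\<sigma>) = real q powr (-\<sigma>) * 16 powr \<sigma>" .
      then show ?thesis by (simp add: C_def power2_eq_square)
    qed
    finally show ?thesis using I by (simp only: simp_thms)
  qed
  show ?thesis by (intro exI[of _ C] conjI C0 allI impI main[THEN conjunct1] main[THEN conjunct2])
qed

section \<open>Odd characters: non-principality and number\<close>

lemma coprime_pred: "q > 1 \<Longrightarrow> coprime (q - 1) (q::nat)"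
  using coprime_diff_one_left_nat[of q] by simp

lemma odd_char_nonprincipal:
  assumes "odd_char q chi" "q > 1"
  shows "dirichlet_char q chi" "\<not> principal_char q chi"
  using assms coprime_pred[of q] by (auto simp: odd_char_def principal_char_def)

lemma finite_odd_chars: "q > 0 \<Longrightarrow> finite {chi. odd_char q chi}"
  by (rule finite_subset[OF _ finite_dirichlet_chars]) (auto simp: odd_char_def)

lemma card_odd_chars: "q > 1 \<Longrightarrow> card {chi. odd_char q chi} \<le> totient q"
  using card_mono[OF finite_dirichlet_chars[of q], of "{chi. odd_char q chi}"] card_dirichlet_chars[of q]
  by (auto simp: odd_char_def)

text \<open>Expand the squares into a double sum over pairs, sum over the characters first, and
  split off the diagonal \<open>D1\<close>. The remainder \<open>D2\<close> is supported on
  \<open>offdiagonal_pairs q\<close>, where the majorant for \<open>a\<close> reduces everything to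
  the sum already bounded by \<open>C\<close>.\<close>

lemma odd_chars_mean_square:
  assumes \<sigma>: "\<sigma> > 1" and C: "\<And>q. q > 0 \<Longrightarrow> (\<lambda>(m, n). real m powr (-\<sigma>) * real n powr (-\<sigma>)) summable_on offdiagonal_pairs q"
     "\<And>q. q > 0 \<Longrightarrow> (\<Sum>\<^sub>\<infinity>(m, n)\<in>offdiagonal_pairs q. real m powr (-\<sigma>) * real n powr (-\<sigma>)) \<le> C * real q powr (-\<sigma>)"
    and q: "q > 1" and K: "K \<ge> 0" and a: "\<And>n. \<bar>a n\<bar> \<le> K * real n powr (-\<sigma>)"
  shows "\<bar>(\<Sum>chi | odd_char q chi. (norm (\<Sum>\<^sub>\<infinity>n. of_real (a n) * chi n))\<^sup>2)
      - real (totient q) / 2 * (\<Sum>\<^sub>\<infinity>n. of_bool (coprime n q) * (a n)\<^sup>2)\<bar>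
    \<le> real (totient q) / 2 * (K\<^sup>2 * (C * real q powr (-\<sigma>)))"
proof -
  define X where "X = {chi. odd_char q chi}"
  define \<phi> where "\<phi> = real (totient q)"
  define T where "T chi = (\<Sum>\<^sub>\<infinity>n. of_real (a n) * chi n)" for chi :: "nat \<Rightarrow> complex"
  define S where "S m n = (\<Sum>chi\<in>X. chi m * cnj (chi n))" for m n :: nat
  define P where "P = offdiagonal_pairs q"
  have q0: "q > 0" using q by simp
  have fin: "finite X" unfolding X_def by (rule finite_odd_chars[OF q0])
  have a0: "a 0 = 0" using a[of 0] by simp
  have sa: "(\<lambda>n. norm (of_real (a n) * chi n)) summable_on UNIV" if "dirichlet_char q chi" for chi
  proof (rule Infinite_Sum.abs_summable_on_comparison_test'[where g = "\<lambda>n. K * real n powr (-\<sigma>)"])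
    show "(\<lambda>n. K * real n powr (-\<sigma>)) summable_on UNIV" by (intro summable_on_cmult_right summable_on_powr \<sigma>)
    show "norm (of_real (a n) * chi n) \<le> K * real n powr (-\<sigma>)" for n
    proof -
      have "norm (of_real (a n) * chi n) \<le> \<bar>a n\<bar> * 1"
        unfolding norm_mult norm_of_real using norm_dirichlet_char_le[OF that q0] by (intro mult_left_mono) auto
      with a[of n] show ?thesis by simp
    qed
  qed
  have "((\<lambda>p. \<Sum>chi\<in>X. case p of (m, n) \<Rightarrow> (of_real (a m) * chi m) * cnj (of_real (a n) * chi n)) has_sum
     (\<Sum>chi\<in>X. T chi * cnj (T chi))) (UNIV \<times> UNIV)"
  proof (rule has_sum_finite_sum[OF fin])
    fix chi assume "chi \<in> X"
    then have chi: "dirichlet_char q chi" by (simp add: X_def odd_char_def)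
    have "((\<lambda>(m, n). (of_real (a m) * chi m) * cnj (of_real (a n) * chi n)) has_sum
       (T chi * infsum (\<lambda>n. cnj (of_real (a n) * chi n)) UNIV)) (UNIV \<times> UNIV)"
      unfolding T_def by (rule has_sum_product[OF sa[OF chi]]) (use sa[OF chi] in \<open>simp only: complex_mod_cnj\<close>)
    then show "((\<lambda>(m, n). (of_real (a m) * chi m) * cnj (of_real (a n) * chi n)) has_sum (T chi * cnj (T chi))) (UNIV \<times> UNIV)"
      unfolding infsum_cnj T_def .
  qed
  also have "(\<lambda>p. \<Sum>chi\<in>X. case p of (m, n) \<Rightarrow> (of_real (a m) * chi m) * cnj (of_real (a n) * chi n)) =
     (\<lambda>(m, n). of_real (a m * a n) * S m n)"
    by (auto simp: fun_eq_iff S_def sum_distrib_left mult_ac)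
  finally have D: "((\<lambda>(m, n). of_real (a m * a n) * S m n) has_sum (\<Sum>chi\<in>X. T chi * cnj (T chi))) (UNIV \<times> UNIV)" .
  define D1 :: "nat \<times> nat \<Rightarrow> complex" where
    "D1 = (\<lambda>(m, n). of_bool (m = n \<and> coprime n q) * of_real (\<phi> / 2 * (a n)\<^sup>2))"
  define W where "W = (\<Sum>\<^sub>\<infinity>n. of_bool (coprime n q) * (a n)\<^sup>2)"
  have sW: "(\<lambda>n. of_bool (coprime n q) * (a n)\<^sup>2) summable_on UNIV"
  proof (rule summable_on_comparison_test)
    show "(\<lambda>n. K\<^sup>2 * real n powr (-(2 * \<sigma>))) summable_on UNIV"
      using \<sigma> by (intro summable_on_cmult_right summable_on_powr) simp
    show "of_bool (coprime n q) * (a n)\<^sup>2 \<le> K\<^sup>2 * real n powr (-(2 * \<sigma>))" for n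
    proof -
      have "\<bar>a n\<bar>\<^sup>2 \<le> (K * real n powr (-\<sigma>))\<^sup>2" using a[of n] by (intro power_mono) auto
      also have "\<dots> = K\<^sup>2 * real n powr (-(2 * \<sigma>))"
        by (simp add: power_mult_distrib power2_eq_square flip: powr_add)
      finally show ?thesis by (auto simp: of_bool_def)
    qed
  qed auto
  have "((\<lambda>n. D1 (n, n)) has_sum of_real (\<phi> / 2 * W)) UNIV"
  proof -
    have "((\<lambda>n. of_real (\<phi> / 2 * (of_bool (coprime n q) * (a n)\<^sup>2)) :: complex) has_sum of_real (\<phi> / 2 * W)) UNIV"
      unfolding W_def by (intro has_sum_of_real has_sum_cmult_right has_sum_infsum sW)
    also have "(\<lambda>n. of_real (\<phi> / 2 * (of_bool (coprime n q) * (a n)\<^sup>2)) :: complex) = (\<lambda>n. D1 (n, n))"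
      by (auto simp: D1_def fun_eq_iff of_bool_def)
    finally show ?thesis .
  qed
  then have "(D1 has_sum of_real (\<phi> / 2 * W)) (range (\<lambda>n. (n, n)))"
    by (subst has_sum_reindex) (auto simp: inj_on_def o_def)
  then have D1s: "(D1 has_sum of_real (\<phi> / 2 * W)) (UNIV \<times> UNIV)"
    by (rule has_sum_cong_neutral[THEN iffD1, rotated 3]) (auto simp: D1_def)
  define D2 where "D2 p = (case p of (m, n) \<Rightarrow> of_real (a m * a n) * S m n) - D1 p" for p
  have D2s: "(D2 has_sum ((\<Sum>chi\<in>X. T chi * cnj (T chi)) - of_real (\<phi> / 2 * W))) (UNIV \<times> UNIV)"
    unfolding D2_def diff_conv_add_uminus by (intro has_sum_add D has_sum_uminusI D1s)
  have D2: "norm (D2 (m, n)) \<le> (if (m, n) \<in> P then \<phi> / 2 * K\<^sup>2 * (real m powr (-\<sigma>) * real n powr (-\<sigma>)) else 0)" for m n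
  proof (cases "m > 0 \<and> n > 0 \<and> coprime m q \<and> coprime n q")
    case False
    have "of_real (a m * a n) * S m n = 0"
    proof (cases "coprime m q \<and> coprime n q")
      case True
      with False have "m = 0 \<or> n = 0" by auto
      then show ?thesis using a0 by auto
    next
      case nc: False
      then have "chi m * cnj (chi n) = 0" if "chi \<in> X" for chi
        using that dirichlet_char_eq_0[of q chi] by (auto simp: X_def odd_char_def)
      then have "S m n = 0" unfolding S_def by (intro sum.neutral) auto
      then show ?thesis by simp
    qed
    moreover have "D1 (m, n) = 0" using False a0 by (auto simp: D1_def)
    ultimately show ?thesis using K by (auto simp: D2_def \<phi>_def)
  next
    case True
    \<comment> \<open>This takes only the values -1, 0 and 1, and it vanishes outside
      \<open>P\<close>: on the diagonal the first and the last indicator cancel.\<close>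
    define e :: real where "e = of_bool [m = n] (mod q) - of_bool (q dvd m + n) - of_bool (m = n)"
    have Seq: "S m n = of_real (\<phi> / 2 * (of_bool [m = n] (mod q) - of_bool (q dvd m + n)))"
      using sum_odd_chars[OF q, of m n] True by (simp add: S_def X_def \<phi>_def)
    then have "D2 (m, n) = of_real (\<phi> / 2 * (a m * a n) * e)"
      using True unfolding D2_def D1_def prod.case Seq
      by (cases "m = n") (simp_all add: e_def power2_eq_square algebra_simps)
    then have "norm (D2 (m, n)) = \<phi> / 2 * (\<bar>a m\<bar> * \<bar>a n\<bar>) * \<bar>e\<bar>"
      by (simp only: norm_of_real) (simp add: abs_mult \<phi>_def)
    also have "\<dots> \<le> \<phi> / 2 * (\<bar>a m\<bar> * \<bar>a n\<bar>) * of_bool ((m, n) \<in> P)"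
      using True by (intro mult_left_mono) (auto simp: e_def P_def offdiagonal_pairs_def \<phi>_def)
    also have "\<dots> \<le> \<phi> / 2 * ((K * real m powr (-\<sigma>)) * (K * real n powr (-\<sigma>))) * of_bool ((m, n) \<in> P)"
      using K by (intro mult_right_mono mult_left_mono mult_mono a) (auto simp: \<phi>_def)
    finally show ?thesis by (simp add: power2_eq_square mult_ac of_bool_def split: if_splits)
  qed
  have D2P: "(D2 has_sum ((\<Sum>chi\<in>X. T chi * cnj (T chi)) - of_real (\<phi> / 2 * W))) P"
  proof (rule has_sum_cong_neutral[THEN iffD1, rotated 3, OF D2s])
    show "D2 p = 0" if "p \<in> UNIV \<times> UNIV - P" for p
      using D2[of "fst p" "snd p"] that by simp
  qed auto
  note sP = C(1)[OF q0, folded P_def]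
  define h :: "nat \<times> nat \<Rightarrow> real" where "h = (\<lambda>(m, n). real m powr (-\<sigma>) * real n powr (-\<sigma>))"
  have sh: "(\<lambda>p. \<phi> / 2 * K\<^sup>2 * h p) summable_on P" unfolding h_def by (rule summable_on_cmult_right[OF sP])
  have D2h: "norm (D2 p) \<le> \<phi> / 2 * K\<^sup>2 * h p" if "p \<in> P" for p
    using D2[of "fst p" "snd p"] that by (auto simp: h_def split: prod.splits if_splits)
  have sD: "(\<lambda>p. norm (D2 p)) summable_on P"
    by (rule Infinite_Sum.abs_summable_on_comparison_test'[OF sh D2h])
  have "norm ((\<Sum>chi\<in>X. T chi * cnj (T chi)) - of_real (\<phi> / 2 * W)) \<le> infsum (\<lambda>p. norm (D2 p)) P"
    using norm_infsum_bound[OF sD] infsumI[OF D2P] by simp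
  also have "\<dots> \<le> infsum (\<lambda>p. \<phi> / 2 * K\<^sup>2 * h p) P" by (rule infsum_mono[OF sD sh D2h])
  also have "\<dots> = \<phi> / 2 * K\<^sup>2 * infsum h P" by (rule infsum_cmult_right')
  also have "\<dots> \<le> \<phi> / 2 * K\<^sup>2 * (C * real q powr (-\<sigma>))"
    using C(2)[OF q0] by (intro mult_left_mono) (auto simp: \<phi>_def P_def h_def)
  also have "(\<Sum>chi\<in>X. T chi * cnj (T chi)) - of_real (\<phi> / 2 * W) = of_real ((\<Sum>chi\<in>X. (norm (T chi))\<^sup>2) - \<phi> / 2 * W)"
    by (simp flip: complex_norm_square)
  finally show ?thesis unfolding norm_of_real by (simp add: X_def T_def W_def \<phi>_def mult.assoc)
qed

text \<open>Since the weight lies between 0 and 1/n, the difference of squares is at most 2/n times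
  1/n minus the weight, and the latter is at most (4/5)^J n^(-3/4) by
  \<open>taylor_weight_bounds\<close> with \<open>b = 5/4\<close>. The coprimality indicator is
  bounded by 1, so the constant is uniform in \<open>q\<close>.\<close>

lemma diagonal_truncation:
  "\<exists>C\<ge>0. \<forall>q J. \<bar>(\<Sum>\<^sub>\<infinity>n. of_bool (coprime n q) * (zeta_inv_coeff k n * taylor_weight J n)\<^sup>2) - coprime_square_sum k q\<bar>
     \<le> C * (4 / 5) ^ J"
proof -
  \<comment> \<open>The exponent 1/8 makes the squared coefficient n^(1/4), so that the terms decay
    like n^(1/4 - 3/4 - 1) = n^(-3/2).\<close>
  obtain B where B: "B > 0" "\<forall>n. \<bar>zeta_inv_coeff k n\<bar> \<le> B * real n powr (1/8)"
    using zeta_inv_coeff_bound[of "1/8" k] by auto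
  define C where "C = 2 * B\<^sup>2 * (\<Sum>\<^sub>\<infinity>n. real n powr (-(3/2)))"
  have sh: "(\<lambda>n. 2 * B\<^sup>2 * real n powr (-(3/2))) summable_on UNIV"
    by (intro summable_on_cmult_right summable_on_powr) simp
  have "C \<ge> 0" unfolding C_def by (intro mult_nonneg_nonneg infsum_nonneg) auto
  moreover have "\<bar>(\<Sum>\<^sub>\<infinity>n. of_bool (coprime n q) * (zeta_inv_coeff k n * taylor_weight J n)\<^sup>2) - coprime_square_sum k q\<bar>
     \<le> C * (4 / 5) ^ J" for q J
  proof -
    define u v where "u n = of_bool (coprime n q) * (zeta_inv_coeff k n * taylor_weight J n)\<^sup>2"
      and "v n = of_bool (coprime n q) * ((zeta_inv_coeff k n)\<^sup>2 / (real n)\<^sup>2)" for n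
    have uv: "u n \<le> v n" "v n - u n \<le> (4 / 5) ^ J * (2 * B\<^sup>2 * real n powr (-(3/2)))" for n
    proof -
      have "u n \<le> v n \<and> v n - u n \<le> (4 / 5) ^ J * (2 * B\<^sup>2 * real n powr (-(3/2)))"
      proof (cases "n = 0")
        case False
        define w where "w = taylor_weight J n"
        have w: "0 \<le> w" "w \<le> 1 / real n" "(5 / 4) ^ J * (1 / real n - w) \<le> real n powr (-2 + 5 / 4)"
          unfolding w_def using taylor_weight_bounds[of n 1 J] taylor_weight_bounds(4)[of n "5/4" J] False by auto
        have d: "(1 / real n)\<^sup>2 - w\<^sup>2 \<ge> 0" using w by (simp add: power_mono)
        have "1 / real n - w = (4 / 5) ^ J * ((5 / 4) ^ J * (1 / real n - w))"
          by (simp flip: mult.assoc power_mult_distrib)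
        also have "\<dots> \<le> (4 / 5) ^ J * real n powr (-2 + 5 / 4)" using w(3) by (intro mult_left_mono) auto
        finally have w4: "1 / real n - w \<le> (4 / 5) ^ J * real n powr (-(3/4))" by simp
        have "(1 / real n)\<^sup>2 - w\<^sup>2 = (1 / real n - w) * (1 / real n + w)" by (simp add: power2_eq_square algebra_simps)
        also have "\<dots> \<le> ((4 / 5) ^ J * real n powr (-(3/4))) * (2 / real n)"
          using w by (intro mult_mono w4) auto
        also have "2 / real n = 2 * real n powr (-1)" using False by (simp add: powr_minus_divide)
        finally have e: "(1 / real n)\<^sup>2 - w\<^sup>2 \<le> 2 * (4 / 5) ^ J * (real n powr (-(3/4)) * real n powr (-1))" by (simp add: mult_ac)
        have "\<bar>zeta_inv_coeff k n\<bar>\<^sup>2 \<le> (B * real n powr (1/8))\<^sup>2" using B by (intro power_mono) auto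
        then have z: "(zeta_inv_coeff k n)\<^sup>2 \<le> B\<^sup>2 * (real n powr (1/8) * real n powr (1/8))"
          by (simp add: power2_eq_square mult_ac)
        have vu: "v n - u n = of_bool (coprime n q) * ((zeta_inv_coeff k n)\<^sup>2 * ((1 / real n)\<^sup>2 - w\<^sup>2))"
          by (simp add: u_def v_def w_def power_mult_distrib power_divide right_diff_distrib)
        also have "\<dots> \<le> 1 * ((B\<^sup>2 * (real n powr (1/8) * real n powr (1/8))) * (2 * (4 / 5) ^ J * (real n powr (-(3/4)) * real n powr (-1))))"
          by (intro mult_mono z e d mult_nonneg_nonneg) auto
        also have "\<dots> = (4 / 5) ^ J * (2 * B\<^sup>2 * (real n powr (1/8) * real n powr (1/8) * (real n powr (-(3/4)) * real n powr (-1))))"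
          by (simp add: mult_ac)
        also have "real n powr (1/8) * real n powr (1/8) * (real n powr (-(3/4)) * real n powr (-1)) = real n powr (-(3/2))"
          by (simp only: powr_add[symmetric]) simp
        finally have "v n - u n \<le> (4 / 5) ^ J * (2 * B\<^sup>2 * real n powr (-(3/2)))" .
        moreover have "v n - u n \<ge> 0" unfolding vu using d by (intro mult_nonneg_nonneg) auto
        ultimately show ?thesis by simp
      qed (simp add: u_def v_def)
      then show "u n \<le> v n" "v n - u n \<le> (4 / 5) ^ J * (2 * B\<^sup>2 * real n powr (-(3/2)))" by auto
    qed
    have sv: "v summable_on UNIV" unfolding v_def by (rule summable_coprime_square)
    have su: "u summable_on UNIV" by (rule summable_on_comparison_test[OF sv uv(1)]) (simp add: u_def)
    have "((\<lambda>n. v n + - u n) has_sum (infsum v UNIV + - infsum u UNIV)) UNIV"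
      by (intro has_sum_add has_sum_uminusI has_sum_infsum sv su)
    then have d: "((\<lambda>n. v n - u n) has_sum (infsum v UNIV - infsum u UNIV)) UNIV" by simp
    have "infsum v UNIV - infsum u UNIV \<ge> 0" by (rule has_sum_nonneg[OF d]) (use uv in auto)
    moreover have "infsum v UNIV - infsum u UNIV \<le> (4 / 5) ^ J * C"
    proof (rule has_sum_mono[OF d])
      show "((\<lambda>n. (4 / 5) ^ J * (2 * B\<^sup>2 * real n powr (-(3/2)))) has_sum (4 / 5) ^ J * C) UNIV"
        unfolding C_def by (intro has_sum_cmult_right has_sum_infsum summable_on_powr) simp
    qed (rule uv)
    moreover have "coprime_square_sum k q = infsum v UNIV" by (simp only: coprime_square_sum_def v_def[abs_def])
    ultimately have "\<bar>infsum u UNIV - coprime_square_sum k q\<bar> \<le> C * (4 / 5) ^ J"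
      by (simp add: abs_le_iff mult.commute)
    then show ?thesis by (simp only: u_def[abs_def])
  qed
  ultimately show ?thesis by blast
qed

theorem theorem5p4:
  fixes k :: nat and \<epsilon> :: real
  assumes "k > 0" and "GRH" and "\<epsilon> > 0"
  shows "\<exists>M. \<forall>q::nat. q \<ge> 2 \<longrightarrow>
    \<bar>(\<Sum>chi\<in>{chi. odd_char q chi}. 1 / norm (dirichlet_L chi 1) ^ (2 * k))
      - C_const k / 2 * real (totient q) * (\<Prod>p\<in>prime_factors q. 1 / local_factor k p)\<bar>
    \<le> M * (C_const k / 2 * real (totient q) * (\<Prod>p\<in>prime_factors q. 1 / local_factor k p))
        * real q powr (-1 + \<epsilon>)"
proof -
  \<comment> \<open>Squaring \<open>k\<close>-th powers of a bound of order q^10 costs q^(20 k); the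
    additional 1 leaves a saving of 1/q when (4/5)^J has paid for it.\<close>
  define A where "A = real (20 * k + 1) / ln (5 / 4)"
  \<comment> \<open>Chosen such that \<open>\<beta>\<close> to the power A ln q is q^(\<epsilon>/4).
    The off-diagonal bound uses the square of this, q^(\<epsilon>/2).\<close>
  define \<beta> where "\<beta> = exp (\<epsilon> / (4 * A))"
  \<comment> \<open>The weight decays like n^(-1 - \<theta>). The coefficients may use up \<theta>/2
    of this, and what remains is the exponent \<open>-\<sigma>\<close>, still below -1.\<close>
  define \<theta> where "\<theta> = 1 - 1 / \<beta>"
  define \<sigma> where "\<sigma> = 1 + \<theta> / 2"
  have A: "A > 0" by (simp add: A_def)
  have \<beta>: "\<beta> > 1" using A assms(3) by (simp add: \<beta>_def)
  then have \<theta>: "\<theta> > 0" by (simp add: \<theta>_def)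
  then have \<sigma>: "\<sigma> > 1" by (simp add: \<sigma>_def)
  obtain B where B: "B > 0" "\<forall>n. \<bar>zeta_inv_coeff k n\<bar> \<le> B * real n powr (\<theta> / 2)"
    using zeta_inv_coeff_bound[of "\<theta> / 2" k] \<theta> by auto
  obtain Cp where Cp: "Cp \<ge> 0" "\<And>q. q > 0 \<Longrightarrow> (\<lambda>(m, n). real m powr (-\<sigma>) * real n powr (-\<sigma>)) summable_on offdiagonal_pairs q"
    "\<And>q. q > 0 \<Longrightarrow> (\<Sum>\<^sub>\<infinity>(m, n)\<in>offdiagonal_pairs q. real m powr (-\<sigma>) * real n powr (-\<sigma>)) \<le> Cp * real q powr (-\<sigma>)"
    using offdiagonal_sum_bound[OF \<sigma>] by metis
  obtain Cd where Cd: "Cd \<ge> 0" "\<And>q J. \<bar>(\<Sum>\<^sub>\<infinity>n. of_bool (coprime n q) * (zeta_inv_coeff k n * taylor_weight J n)\<^sup>2) - coprime_square_sum k q\<bar>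
     \<le> Cd * (4 / 5) ^ J"
    using diagonal_truncation[of k] by metis
  obtain CL where CL: "CL > 0" "\<And>q chi s. q > 0 \<Longrightarrow> dirichlet_char q chi \<Longrightarrow> \<not> principal_char q chi \<Longrightarrow>
     norm (s - 2) \<le> 5 / 4 \<Longrightarrow> norm (1 / dirichlet_L chi s) \<le> CL * real q ^ 10"
    using L_inverse_bound[OF assms(2)] by metis
  \<comment> \<open>One summand each for the Taylor truncation, the off-diagonal pairs and the
    truncated diagonal. The 70 is twice the 35 below: the number of odd characters is estimated by
    \<open>totient q\<close>, while the main term carries half of it.\<close>
  define M where "M = 70 * CL ^ (2 * k) + (B * \<beta>)\<^sup>2 * Cp + Cd"
  have M0: "M \<ge> 0" using CL(1) Cp(1) Cd(1) by (simp add: M_def)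
  show ?thesis
  proof (intro exI[of _ M] allI impI)
    fix q :: nat assume q2: "q \<ge> 2"
    then have q: "q > 1" and q0: "q > 0" and lq: "ln (real q) > 0" by auto
    define \<phi> where "\<phi> = real (totient q)"
    define X where "X = {chi. odd_char q chi}"
    define E where "E = coprime_square_sum k q"
    define J where "J = nat \<lceil>A * ln (real q)\<rceil>"
    define a where "a n = zeta_inv_coeff k n * taylor_weight J n" for n
    define T where "T chi = (\<Sum>\<^sub>\<infinity>n. of_real (a n) * chi n)" for chi :: "nat \<Rightarrow> complex"
    define W where "W = (\<Sum>\<^sub>\<infinity>n. of_bool (coprime n q) * (a n)\<^sup>2)"
    have \<phi>0: "\<phi> \<ge> 0" by (simp add: \<phi>_def)
    have J: "A * ln (real q) \<le> real J" "real J \<le> A * ln (real q) + 1"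
      using A lq by (auto simp: J_def)
    have J1: "(4 / 5) ^ J \<le> real q powr (- real (20 * k + 1))"
    proof -
      have "(4 / 5 :: real) ^ J = exp (- (real J * ln (5 / 4)))"
        by (simp add: exp_minus exp_of_nat_mult flip: power_inverse)
      also have "\<dots> \<le> exp (- (A * ln (real q) * ln (5 / 4)))" using J(1) by (simp add: mult_right_mono)
      also have "A * ln (real q) * ln (5 / 4) = real (20 * k + 1) * ln (real q)" by (simp add: A_def)
      also have "exp (- (real (20 * k + 1) * ln (real q))) = real q powr (- real (20 * k + 1))"
        using q0 by (simp add: powr_def algebra_simps)
      finally show ?thesis .
    qed
    have J2: "\<beta> ^ J \<le> \<beta> * real q powr (\<epsilon> / 4)"
    proof -
      have "\<beta> ^ J = exp (real J * (\<epsilon> / (4 * A)))" unfolding \<beta>_def by (rule exp_of_nat_mult[symmetric])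
      also have "\<dots> \<le> exp ((A * ln (real q) + 1) * (\<epsilon> / (4 * A)))"
        using J(2) A assms(3) by (simp add: mult_right_mono divide_right_mono)
      also have "(A * ln (real q) + 1) * (\<epsilon> / (4 * A)) = \<epsilon> / (4 * A) + \<epsilon> / 4 * ln (real q)"
        using A by (simp add: field_simps)
      also have "exp \<dots> = \<beta> * real q powr (\<epsilon> / 4)" using q0 by (simp add: exp_add \<beta>_def powr_def)
      finally show ?thesis .
    qed
    have J3: "(4 / 5) ^ J \<le> real q powr (-1)"
      using q by (intro order_trans[OF J1] powr_mono) auto
    define K where "K = B * \<beta> * real q powr (\<epsilon> / 4)"
    have K0: "K \<ge> 0" using B(1) \<beta> by (simp add: K_def)
    have ab: "\<bar>a n\<bar> \<le> K * real n powr (-\<sigma>)" for n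
    proof (cases "n = 0")
      case False
      note w = taylor_weight_bounds(1,3)[of n \<beta> J]
      have "\<bar>a n\<bar> = \<bar>zeta_inv_coeff k n\<bar> * taylor_weight J n" using w(1) False \<beta> by (simp add: a_def abs_mult)
      also have "\<dots> \<le> (B * real n powr (\<theta> / 2)) * (\<beta> ^ J * real n powr (-2 + 1 / \<beta>))"
        using w False \<beta> B by (intro mult_mono) auto
      also have "\<dots> \<le> (B * real n powr (\<theta> / 2)) * ((\<beta> * real q powr (\<epsilon> / 4)) * real n powr (-2 + 1 / \<beta>))"
        using B(1) by (intro mult_left_mono mult_right_mono J2) auto
      also have "\<dots> = K * (real n powr (\<theta> / 2) * real n powr (-2 + 1 / \<beta>))" by (simp add: K_def)
      also have "real n powr (\<theta> / 2) * real n powr (-2 + 1 / \<beta>) = real n powr (-\<sigma>)"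
        unfolding powr_add[symmetric]
        by (rule arg_cong[where f = "\<lambda>x. real n powr x"]) (simp add: \<sigma>_def \<theta>_def diff_divide_distrib)
      finally show ?thesis .
    qed (simp add: a_def)
    have qs: "real q powr (-\<sigma>) \<le> real q powr (-1)" using q \<sigma> by (intro powr_mono) auto
    have S1: "\<bar>(\<Sum>chi\<in>X. (norm (T chi))\<^sup>2) - \<phi> / 2 * W\<bar> \<le> \<phi> / 2 * (K\<^sup>2 * (Cp * real q powr (-\<sigma>)))"
      unfolding X_def T_def W_def \<phi>_def by (rule odd_chars_mean_square[OF \<sigma> Cp(2,3) q K0 ab])
    have S2: "\<bar>W - E\<bar> \<le> Cd * (4 / 5) ^ J" unfolding W_def a_def E_def by (rule Cd(2))
    define MF where "MF = (CL * real q ^ 10) ^ k"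
    have MF0: "MF \<ge> 0" using CL(1) by (simp add: MF_def)
    have S3: "\<bar>1 / norm (dirichlet_L chi 1) ^ (2 * k) - (norm (T chi))\<^sup>2\<bar> \<le> 35 * CL ^ (2 * k) * real q powr (-1)"
      if "chi \<in> X" for chi
    proof -
      have chi: "dirichlet_char q chi" "\<not> principal_char q chi"
        using odd_char_nonprincipal[of q chi] that q by (auto simp: X_def)
      define F where "F s = (1 / dirichlet_L chi s) ^ k" for s
      have FM: "norm (F s) \<le> MF" if "norm (s - 2) \<le> 5 / 4" for s
        unfolding F_def MF_def norm_power by (intro power_mono CL(2)[OF q0 chi that]) auto
      have ball: "Re z > 1 / 2" if "z \<in> ball 2 (3 / 2)" for z :: complex
        using that complex_Re_le_cmod[of "2 - z"] by (simp add: dist_norm)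
      have "norm (F 1 - (\<Sum>\<^sub>\<infinity>n. (of_real (zeta_inv_coeff k n) * chi n) * of_real (taylor_weight J n))) \<le> 5 * MF * (4 / 5) ^ J"
      proof (rule dirichlet_series_taylor_truncation(2))
        show "(\<lambda>n. norm (of_real (zeta_inv_coeff k n) * chi n * of_nat n powr - s)) summable_on UNIV" if "Re s > 1" for s
          by (rule summable_L_inverse[OF chi(1) q0 that])
        show "F s = (\<Sum>\<^sub>\<infinity>n. of_real (zeta_inv_coeff k n) * chi n * of_nat n powr - s)" if "Re s > 1" for s
        proof -
          have "dirichlet_L chi s \<noteq> 0" using dirichlet_L_nonzero[OF assms(2) chi q0] that by simp
          then show ?thesis using dirichlet_L_power_mult_inverse[OF chi(1) q0 that, of k]
            by (simp add: F_def power_divide field_simps)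
        qed
        show "F holomorphic_on ball 2 (3 / 2)" unfolding F_def
          by (intro holomorphic_intros holomorphic_on_subset[OF dirichlet_L_by_parts(4)[OF chi q0]])
             (use ball dirichlet_L_nonzero[OF assms(2) chi q0] in force)+
        show "norm (F s) \<le> MF" if "norm (s - 2) = 5 / 4" for s using FM that by simp
      qed
      also have "(\<Sum>\<^sub>\<infinity>n. (of_real (zeta_inv_coeff k n) * chi n) * of_real (taylor_weight J n)) = T chi"
        unfolding T_def a_def by (intro infsum_cong) (simp add: mult_ac)
      finally have d: "norm (F 1 - T chi) \<le> 5 * MF * (4 / 5) ^ J" .
      have F1: "norm (F 1) \<le> MF" by (rule FM) simp
      have "norm (T chi) \<le> norm (F 1) + norm (F 1 - T chi)" by (metis norm_minus_commute norm_triangle_sub)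
      also have "\<dots> \<le> MF + 5 * MF * 1"
        using F1 d MF0 by (intro add_mono order_trans[OF d] mult_left_mono) (auto simp: power_le_one)
      finally have T6: "norm (T chi) \<le> 6 * MF" by simp
      have "1 / norm (dirichlet_L chi 1) ^ (2 * k) = (norm (F 1))\<^sup>2"
        by (simp add: F_def norm_power norm_divide power_divide power_mult[symmetric] mult.commute)
      then have "\<bar>1 / norm (dirichlet_L chi 1) ^ (2 * k) - (norm (T chi))\<^sup>2\<bar> =
          \<bar>norm (F 1) - norm (T chi)\<bar> * (norm (F 1) + norm (T chi))"
        by (simp add: power2_eq_square square_diff_square_factored abs_mult)
      \<comment> \<open>The difference of squares is factored: one \<open>MF\<close> comes from the
        truncation error, the other from the sum of the two norms, and 35 = 5 (1 + 6).\<close>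
      also have "\<dots> \<le> (5 * MF * (4 / 5) ^ J) * (MF + 6 * MF)"
        using d MF0 by (intro mult_mono add_mono F1 T6 order_trans[OF norm_triangle_ineq3]) auto
      also have "\<dots> = 35 * (MF\<^sup>2 * (4 / 5) ^ J)" by (simp add: power2_eq_square)
      also have "MF\<^sup>2 * (4 / 5) ^ J \<le> MF\<^sup>2 * real q powr (- real (20 * k + 1))" by (intro mult_left_mono J1) auto
      also have "MF\<^sup>2 = CL ^ (2 * k) * real q powr (real (20 * k))"
      proof -
        have "real q powr real (20 * k) = real q ^ (20 * k)" using q0 by (intro powr_realpow) simp
        moreover have "MF\<^sup>2 = CL ^ (2 * k) * real q ^ (20 * k)"
          unfolding MF_def power_mult_distrib power_mult[symmetric] by (simp add: mult_ac)
        ultimately show ?thesis by simp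
      qed
      also have "CL ^ (2 * k) * real q powr (real (20 * k)) * real q powr (- real (20 * k + 1)) = CL ^ (2 * k) * real q powr (-1)"
        by (simp add: mult.assoc flip: powr_add)
      finally show ?thesis by (simp add: mult.assoc)
    qed
    have S4: "\<bar>(\<Sum>chi\<in>X. 1 / norm (dirichlet_L chi 1) ^ (2 * k)) - (\<Sum>chi\<in>X. (norm (T chi))\<^sup>2)\<bar> \<le> \<phi> * (35 * CL ^ (2 * k) * real q powr (-1))"
    proof -
      have "\<bar>(\<Sum>chi\<in>X. 1 / norm (dirichlet_L chi 1) ^ (2 * k)) - (\<Sum>chi\<in>X. (norm (T chi))\<^sup>2)\<bar> \<le>
         (\<Sum>chi\<in>X. \<bar>1 / norm (dirichlet_L chi 1) ^ (2 * k) - (norm (T chi))\<^sup>2\<bar>)"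
        unfolding sum_subtractf[symmetric] by (rule sum_abs)
      also have "\<dots> \<le> (\<Sum>chi\<in>X. 35 * CL ^ (2 * k) * real q powr (-1))" by (intro sum_mono S3)
      also have "\<dots> = real (card X) * (35 * CL ^ (2 * k) * real q powr (-1))" by simp
      also have "\<dots> \<le> \<phi> * (35 * CL ^ (2 * k) * real q powr (-1))"
        using card_odd_chars[OF q] CL(1) by (intro mult_right_mono) (auto simp: \<phi>_def X_def)
      finally show ?thesis .
    qed
    have qe: "real q powr (-1) \<le> real q powr (-1 + \<epsilon>)" "real q powr (\<epsilon> / 2) * real q powr (-1) \<le> real q powr (-1 + \<epsilon>)"
    proof -
      show "real q powr (-1) \<le> real q powr (-1 + \<epsilon>)" by (rule powr_mono) (use q assms(3) in auto)
      show "real q powr (\<epsilon> / 2) * real q powr (-1) \<le> real q powr (-1 + \<epsilon>)"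
        unfolding powr_add[symmetric] by (rule powr_mono) (use q assms(3) in auto)
    qed
    have K2: "K\<^sup>2 = (B * \<beta>)\<^sup>2 * real q powr (\<epsilon> / 2)"
      by (simp add: K_def power2_eq_square mult_ac flip: powr_add)
    have P1: "\<phi> * (35 * CL ^ (2 * k) * real q powr (-1)) \<le> \<phi> / 2 * (70 * CL ^ (2 * k) * real q powr (-1 + \<epsilon>))"
    proof -
      have "\<phi> * (35 * CL ^ (2 * k) * real q powr (-1)) \<le> \<phi> * (35 * CL ^ (2 * k) * real q powr (-1 + \<epsilon>))"
        using CL(1) \<phi>0 by (intro mult_left_mono qe) auto
      then show ?thesis by (simp add: mult_ac)
    qed
    have P2: "\<phi> / 2 * (K\<^sup>2 * (Cp * real q powr (-\<sigma>))) \<le> \<phi> / 2 * ((B * \<beta>)\<^sup>2 * Cp * real q powr (-1 + \<epsilon>))"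
    proof (intro mult_left_mono)
      have "K\<^sup>2 * (Cp * real q powr (-\<sigma>)) \<le> K\<^sup>2 * (Cp * real q powr (-1))"
        using Cp(1) by (intro mult_left_mono qs) auto
      also have "\<dots> = (B * \<beta>)\<^sup>2 * Cp * (real q powr (\<epsilon> / 2) * real q powr (-1))" by (simp add: K2 mult_ac)
      also have "\<dots> \<le> (B * \<beta>)\<^sup>2 * Cp * real q powr (-1 + \<epsilon>)" using Cp(1) by (intro mult_left_mono qe) auto
      finally show "K\<^sup>2 * (Cp * real q powr (-\<sigma>)) \<le> (B * \<beta>)\<^sup>2 * Cp * real q powr (-1 + \<epsilon>)" .
    qed (use \<phi>0 in simp)
    have P3: "\<bar>\<phi> / 2 * W - \<phi> / 2 * E\<bar> \<le> \<phi> / 2 * (Cd * real q powr (-1 + \<epsilon>))"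
    proof -
      have "\<bar>\<phi> / 2 * W - \<phi> / 2 * E\<bar> = \<phi> / 2 * \<bar>W - E\<bar>" using \<phi>0 by (simp only: right_diff_distrib[symmetric] abs_mult abs_of_nonneg divide_nonneg_nonneg zero_le_numeral)
      also have "\<bar>W - E\<bar> \<le> Cd * real q powr (-1 + \<epsilon>)"
        using Cd(1) by (intro order_trans[OF S2] mult_left_mono order_trans[OF J3] qe)
      finally show ?thesis using \<phi>0 by (simp add: mult_left_mono)
    qed
    have main: "C_const k / 2 * real (totient q) * (\<Prod>p\<in>prime_factors q. 1 / local_factor k p) = \<phi> / 2 * E"
      by (simp add: E_def coprime_square_sum_eq[OF q0] \<phi>_def)
    have "\<bar>(\<Sum>chi\<in>X. 1 / norm (dirichlet_L chi 1) ^ (2 * k)) - \<phi> / 2 * E\<bar> \<le>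
       \<phi> / 2 * (70 * CL ^ (2 * k) * real q powr (-1 + \<epsilon>)) + \<phi> / 2 * ((B * \<beta>)\<^sup>2 * Cp * real q powr (-1 + \<epsilon>))
        + \<phi> / 2 * (Cd * real q powr (-1 + \<epsilon>))"
      using S4 S1 P1 P2 P3 by linarith
    also have "\<dots> = M * (\<phi> / 2 * 1) * real q powr (-1 + \<epsilon>)" by (simp add: M_def algebra_simps)
    \<comment> \<open>The term at \<open>n = 1\<close> gives \<open>E \<ge> 1\<close>, which turns
      the absolute error into one relative to the main term.\<close>
    also have "\<dots> \<le> M * (\<phi> / 2 * E) * real q powr (-1 + \<epsilon>)"
      using M0 \<phi>0 coprime_square_sum_ge_1[of k q] by (intro mult_right_mono mult_left_mono) (auto simp: E_def)
    finally show "\<bar>(\<Sum>chi\<in>{chi. odd_char q chi}. 1 / norm (dirichlet_L chi 1) ^ (2 * k))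
      - C_const k / 2 * real (totient q) * (\<Prod>p\<in>prime_factors q. 1 / local_factor k p)\<bar>
    \<le> M * (C_const k / 2 * real (totient q) * (\<Prod>p\<in>prime_factors q. 1 / local_factor k p))
        * real q powr (-1 + \<epsilon>)"
      unfolding main X_def .
  qed
qed

end
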